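(* Let $\Delta\ge4$ be an integer and let $G$ be a connected graph of maximum degree at most $\Delta$. (i) If $G$ is $\Delta$-special, then $i(G)=\left(1-\frac{\Delta}{\lfloor \Delta^2/4\rfloor+\Delta}\right)\lvert V(G)\rvert+\frac{\Delta}{\lfloor \Delta^2/4\rfloor+\Delta}$. (ii) If $G$ is not $\Delta$-special and $\Delta\neq 5$, then $i(G)\le \left(1-\frac{\Delta}{\lfloor \Delta^2/4\rfloor+\Delta}\right)\lvert V(G)\rvert$. (iii) If $G$ is not $\Delta$-special and $\Delta=5$, then $i(G)\le \frac{5}{9}\lvert V(G)\rvert$.
   Context: All graphs are finite and simple. An independent dominating set of a graph is a set $S$ of pairwise non-adjacent vertices such that every vertex not in $S$ has a neighbor in $S$; $i(G)$ denotes the minimum size of an independent dominating set of $G$. For an integer $\Delta\ge4$, a connected graph $G$ is called $\Delta$-special if: (1) every vertex that belongs to some cycle of $G$ has degree $\Delta$; (2) every edge has at least one end that belongs to some cycle; (3) each component of the subgraph induced by the set of all vertices that belong to cycles is isomorphic to $K_{\lceil \Delta/2\rceil+1}$, or to $K_{\lfloor \Delta/2\rfloor+1}$, or (only when $\Delta=4$) to an odd cycle. (In particular $K_1$ is $\Delta$-special.) *)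

theory Defs
  imports Complex_Main "Graph_Theory.Graph_Theory"
begin

text \<open>
  Finite simple graphs are the symmetric, loop-free digraphs without parallel arcs of the locale
  \<^locale>\<open>graph\<close>: an edge \<open>uv\<close> is a pair of opposite arcs. Hence the degree of a vertex is
  its \<^const>\<open>out_degree\<close>, and the components of a graph are its \<open>sccs\<close>.
\<close>

definition independent_dominating_set :: "('a, 'b) pre_digraph \<Rightarrow> 'a set \<Rightarrow> bool" where
  "independent_dominating_set G S \<longleftrightarrow>
     S \<subseteq> verts G \<and>
     (\<forall>u\<in>S. \<forall>v\<in>S. \<not> u \<rightarrow>\<^bsub>G\<^esub> v) \<and>
     (\<forall>v\<in>verts G - S. \<exists>u\<in>S. v \<rightarrow>\<^bsub>G\<^esub> u)"

definition independent_domination_number :: "('a, 'b) pre_digraph \<Rightarrow> nat" where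
  "independent_domination_number G = Min (card ` {S. independent_dominating_set G S})"

text \<open>
  The library's \<open>cycle\<close> also admits the closed walk \<open>u, v, u\<close> along the two arcs of a single edge.
  In a simple graph, a \<open>cycle\<close> of length at least 3 is a cycle in the usual undirected sense.
\<close>

definition cycle_verts :: "('a, 'b) pre_digraph \<Rightarrow> 'a set" where
  "cycle_verts G = {v. \<exists>p. pre_digraph.cycle G p \<and> 3 \<le> length p \<and> v \<in> tail G ` set p}"

definition cycle_graph :: "nat \<Rightarrow> nat pair_pre_digraph" where
  "cycle_graph n =
     \<lparr> pverts = {..<n},
       parcs = {(u, v). u < n \<and> v < n \<and> (v = Suc u mod n \<or> u = Suc v mod n)} \<rparr>"

definition odd_cycle_graph :: "('a, 'b) pre_digraph \<Rightarrow> bool" where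
  "odd_cycle_graph H \<longleftrightarrow>
     (\<exists>n\<ge>3. odd n \<and> digraph_iso H (with_proj (cycle_graph n)))"

text \<open>
  The predicate \<^term>\<open>complete_digraph n H\<close> says that \<open>H\<close> is a complete simple graph on \<open>n\<close>
  vertices, that is, isomorphic to the complete graph on \<open>n\<close> vertices.
\<close>

definition special :: "nat \<Rightarrow> ('a, 'b) pre_digraph \<Rightarrow> bool" where
  "special \<Delta> G \<longleftrightarrow>
     Digraph_Component.connected G \<and>
     (\<forall>v\<in>cycle_verts G. out_degree G v = \<Delta>) \<and>
     (\<forall>e\<in>arcs G. tail G e \<in> cycle_verts G \<or> head G e \<in> cycle_verts G) \<and>
     (\<forall>H\<in>pre_digraph.sccs (G \<restriction> cycle_verts G).
        complete_digraph (nat \<lceil>real \<Delta> / 2\<rceil> + 1) H \<or>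
        complete_digraph (nat \<lfloor>real \<Delta> / 2\<rfloor> + 1) H \<or>
        \<Delta> = 4 \<and> odd_cycle_graph H)"

end

theory Submission
  imports Defs
begin

text \<open>
  Partition the vertices into stars with at least one leaf each, let \<open>m v\<close> be the number of leaves of the
  centre \<open>v\<close> and \<open>j v\<close> its degree in the graph of centres, so \<open>m v + j v \<le> \<Delta>\<close>. A maximal independent set
  extending an independent set \<open>B\<close> of centres has at most \<open>(\<Sum>v. m v) - (\<Sum>v\<in>B. m v - 1)\<close> elements. A weighted
  Caro-Wei argument produces a \<open>B\<close> for which this is at most the claimed multiple of the number of
  vertices; it only fails at components of the graph of centres that are regular with
  \<open>m v * j v = \<lfloor>\<Delta>\<^sup>2 / 4\<rfloor>\<close> throughout, and there Brooks' theorem helps except for complete graphs and, for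
  \<open>\<Delta> = 4\<close>, odd cycles. In these bad components all edges to the outside lead to own leaves. In a star
  partition with the fewest bad components, leaves can be traded to move a bad component through the
  graph; if it cannot be destroyed on the way, then the graph is special.

  In a special graph the complete graphs and odd cycles form a tree together with the remaining
  vertices, and gluing them one by one gives the exact value.
\<close>

text \<open>Write c for floor(Delta^2/4) and let a centre have M leaves and A neighbouring centres,
  A + M = Delta. In the goal (c + Delta) |S| <= c |V| every centre costs Delta M - c, and putting it
  into \<open>B\<close> earns (M - 1) (c + Delta). The constant comes from the identity (A + 1)
  (Delta M - c) = (M - 1) (c + Delta) + Delta (A M - c + 1): as A M <= c, a centre fails to pay for
  its closed neighbourhood only if A M = c, and then the deficit is at most Delta. One cheaper
  neighbour, or for Delta other than 5 one neighbour fewer, covers it. Delta = 5 differs: a triangle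
  with two pendant vertices at each vertex has maximum degree 4, i = 5 and |V| = 9, and 5/9 > 6/11.

  The exact value means (c + Delta) (i - 1) = c (|V| - 1); both differences add up when graphs are
  glued at one vertex.

  Two pieces with a common outer neighbour cannot both be bad, since this vertex is a leaf of one
  star only. So no single star partition reveals all pieces of a special graph, and whole families
  of partitions have to be followed.\<close>

locale ugraph =
  fixes V :: "'a set" and E :: "'a \<Rightarrow> 'a \<Rightarrow> bool"
  assumes finV: "finite V"
    and E_sym: "E x y \<Longrightarrow> E y x"
    and E_irrefl: "\<not> E x x"
    and E_dom: "E x y \<Longrightarrow> x \<in> V"
begin

definition N :: "'a \<Rightarrow> 'a set" where
  "N v = {u. E v u}"

text \<open>
  Connectivity is expressed through closed sets instead of walks: a connectivity hypothesis is then used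
  by exhibiting a closed set.
\<close>

definition lnk :: "'a set \<Rightarrow> 'a \<Rightarrow> 'a \<Rightarrow> bool" where
  "lnk X x y \<longleftrightarrow> (\<forall>A. x \<in> A \<longrightarrow> (\<forall>u\<in>A. \<forall>w\<in>X. E u w \<longrightarrow> w \<in> A) \<longrightarrow> y \<in> A)"

definition cset :: "'a set \<Rightarrow> bool" where
  "cset X \<longleftrightarrow> (\<forall>x\<in>X. \<forall>y\<in>X. lnk X x y)"

definition comp :: "'a set \<Rightarrow> 'a \<Rightarrow> 'a set" where
  "comp X v = {y. lnk X v y}"

section \<open>Linked vertices, connected sets and components\<close>

lemma in_N [simp]: "u \<in> N v \<longleftrightarrow> E v u"
  by (simp add: N_def)

lemma E_dom2: "E x y \<Longrightarrow> y \<in> V"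
  using E_dom E_sym by blast

lemma N_subset: "N v \<subseteq> V"
  using E_dom2 by auto

lemma finN [simp]: "finite (N v)"
  using N_subset finV finite_subset by blast

lemma lnk_refl [simp]: "lnk X x x"
  by (simp add: lnk_def)

lemma lnk_step: "lnk X x y \<Longrightarrow> E y z \<Longrightarrow> z \<in> X \<Longrightarrow> lnk X x z"
  unfolding lnk_def by blast

lemma lnk_trans: "lnk X x y \<Longrightarrow> lnk X y z \<Longrightarrow> lnk X x z"
  unfolding lnk_def by blast

lemma lnk_edge: "E x y \<Longrightarrow> y \<in> X \<Longrightarrow> lnk X x y"
  using lnk_refl lnk_step by blast

lemma lnk_mono: "lnk X x y \<Longrightarrow> X \<subseteq> Y \<Longrightarrow> lnk Y x y"
  unfolding lnk_def by blast

lemma lnk_induct: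
  assumes "lnk X x y" "x \<in> A" "\<And>u w. u \<in> A \<Longrightarrow> w \<in> X \<Longrightarrow> E u w \<Longrightarrow> w \<in> A"
  shows "y \<in> A"
  using assms unfolding lnk_def by blast

lemma lnk_in: "lnk X x y \<Longrightarrow> x \<in> X \<Longrightarrow> y \<in> X"
  by (rule lnk_induct)

text \<open>A link may start outside \<open>X\<close>, while all vertices after the start lie in
  \<open>X\<close>; the way back to \<open>x\<close> therefore requires
  \<open>x \<in> X\<close>.\<close>

lemma lnk_sym:
  assumes "lnk X x y" "x \<in> X"
  shows "lnk X y x"
proof -
  have "y \<in> {u \<in> X. lnk X u x}"
  proof (rule lnk_induct[OF assms(1)])
    fix u w assume "u \<in> {u \<in> X. lnk X u x}" "w \<in> X" "E u w"
    then show "w \<in> {u \<in> X. lnk X u x}"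
      using lnk_edge[of w u X] lnk_trans[of X w u x] E_sym[of u w] by auto
  qed (use assms in auto)
  then show ?thesis by simp
qed

lemma cset_subset:
  assumes "cset X" "x \<in> X" "x \<in> A" "\<And>u w. u \<in> A \<Longrightarrow> u \<in> X \<Longrightarrow> w \<in> X \<Longrightarrow> E u w \<Longrightarrow> w \<in> A"
  shows "X \<subseteq> A"
proof
  fix y assume "y \<in> X"
  then have "lnk X x y" using assms by (auto simp: cset_def)
  then have "y \<in> A \<inter> X"
    by (rule lnk_induct) (use assms in auto)
  then show "y \<in> A" by simp
qed

lemma comp_subset: "v \<in> X \<Longrightarrow> comp X v \<subseteq> X"
  using lnk_in by (auto simp: comp_def)

lemma comp_self [simp]: "v \<in> comp X v"
  by (simp add: comp_def)

lemma comp_closed: "u \<in> comp X v \<Longrightarrow> E u w \<Longrightarrow> w \<in> X \<Longrightarrow> w \<in> comp X v"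
  using lnk_step by (auto simp: comp_def)

lemma csetI:
  assumes "\<And>y. y \<in> X \<Longrightarrow> lnk X x y" "x \<in> X"
  shows "cset X"
  unfolding cset_def using assms lnk_sym lnk_trans by meson

lemma cset_comp:
  assumes "v \<in> X"
  shows "cset (comp X v)"
proof (rule csetI)
  fix y assume "y \<in> comp X v"
  then have "lnk X v y" by (simp add: comp_def)
  then have "y \<in> {y. lnk (comp X v) v y \<and> y \<in> comp X v}"
    by (rule lnk_induct) (use comp_closed lnk_step in auto)
  then show "lnk (comp X v) v y" by simp
qed simp

lemma cset_Un:
  assumes "cset X" "cset Y" "x \<in> X" "y \<in> Y" "E x y"
  shows "cset (X \<union> Y)"
proof (rule csetI)
  show "x \<in> X \<union> Y" using assms by simp
  fix z assume "z \<in> X \<union> Y"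
  then show "lnk (X \<union> Y) x z"
  proof
    assume "z \<in> X"
    then show ?thesis using assms lnk_mono[of X x z] by (auto simp: cset_def)
  next
    assume "z \<in> Y"
    then have "lnk (X \<union> Y) y z" using assms lnk_mono[of Y y z] by (auto simp: cset_def)
    moreover have "lnk (X \<union> Y) x y" using assms lnk_edge by auto
    ultimately show ?thesis using lnk_trans by blast
  qed
qed

lemma cset_insert:
  assumes "cset X" "x \<in> X" "E x y"
  shows "cset (insert y X)"
proof -
  have "cset {y}" by (auto simp: cset_def)
  then show ?thesis using cset_Un[of X "{y}" x y] assms by auto
qed

section \<open>Brooks' theorem\<close>

definition pcol :: "nat \<Rightarrow> 'a set \<Rightarrow> ('a \<Rightarrow> nat) \<Rightarrow> bool" where
  "pcol k S col \<longleftrightarrow> (\<forall>x\<in>S. col x < k) \<and> (\<forall>x\<in>S. \<forall>y\<in>S. E x y \<longrightarrow> col x \<noteq> col y)"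

text \<open>A colouring order in which every vertex except the last still has an uncoloured
  neighbour at its turn, so that its coloured neighbours cannot block all colours.\<close>

primrec greedy_order :: "'a list \<Rightarrow> bool" where
  "greedy_order [] = True"
| "greedy_order (v # vs) = ((vs \<noteq> [] \<longrightarrow> (\<exists>u\<in>set vs. E v u)) \<and> greedy_order vs)"

lemma greedy_order_successively: "successively E vs \<Longrightarrow> greedy_order vs"
  by (induction vs rule: induct_list012) auto

text \<open>Lets a path be coloured before \<open>ys\<close> if its next vertex \<open>u\<close>
  belongs to \<open>ys\<close>; \<open>u\<close> need not come first there.\<close>

lemma greedy_order_append:
  "successively E (xs @ [u]) \<Longrightarrow> u \<in> set ys \<Longrightarrow> greedy_order ys \<Longrightarrow> greedy_order (xs @ ys)"
  by (induction xs rule: induct_list012) auto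

lemma pcol_extend:
  assumes "pcol k S col" "v \<notin> S" "card (col ` (N v \<inter> S)) < k"
  shows "\<exists>c. pcol k (insert v S) (col(v := c))"
proof -
  have "\<exists>c\<in>{..<k}. c \<notin> col ` (N v \<inter> S)"
  proof (rule ccontr)
    assume "\<not> ?thesis"
    then have "{..<k} \<subseteq> col ` (N v \<inter> S)" by auto
    then have "card {..<k} \<le> card (col ` (N v \<inter> S))" by (rule card_mono[rotated]) simp
    then show False using assms by simp
  qed
  then obtain c where "c < k" "c \<notin> col ` (N v \<inter> S)" by auto
  then have "pcol k (insert v S) (col(v := c))"
    using assms E_sym E_irrefl unfolding pcol_def by (auto simp: image_iff)
  then show ?thesis by blast
qed

text \<open>Only the last vertex has no later neighbour to save a colour; it sees \<open>x\<close>
  and \<open>y\<close> in the same colour instead, and this again leaves one colour free.\<close>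

lemma pcol_extend_list:
  assumes "pcol k S col" "vs \<noteq> []" "distinct vs" "set vs \<inter> S = {}" "S \<union> set vs \<subseteq> X"
    "\<And>v. v \<in> set vs \<Longrightarrow> card (N v \<inter> X) \<le> k" "greedy_order vs"
    "x \<in> S" "y \<in> S" "x \<noteq> y" "E (last vs) x" "E (last vs) y" "col x = col y"
  shows "\<exists>col'. pcol k (S \<union> set vs) col'"
  using assms
proof (induction vs arbitrary: S col)
  case (Cons v vs)
  have "card (col ` (N v \<inter> S)) < k"
  proof (cases "vs = []")
    case True
    have "y \<in> N v \<inter> S - {x}" using Cons.prems True by auto
    then have "col x \<in> col ` (N v \<inter> S - {x})" using Cons.prems(13) by (metis imageI)
    then have "col ` (N v \<inter> S) = col ` (N v \<inter> S - {x})" by auto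
    then have "card (col ` (N v \<inter> S)) \<le> card (N v \<inter> S - {x})"
      using card_image_le[of "N v \<inter> S - {x}" col] by simp
    also have "\<dots> < card (N v \<inter> X)"
      by (rule psubset_card_mono) (use Cons.prems True in auto)
    finally show ?thesis using Cons.prems by force
  next
    case False
    then obtain u where u: "u \<in> set vs" "E v u" using Cons.prems by auto
    have "card (col ` (N v \<inter> S)) \<le> card (N v \<inter> S)" by (rule card_image_le) simp
    also have "\<dots> < card (N v \<inter> X)"
      by (rule psubset_card_mono) (use Cons.prems u in auto)
    finally show ?thesis using Cons.prems by force
  qed
  with Cons.prems obtain c where c: "pcol k (insert v S) (col(v := c))"
    using pcol_extend[of k S col v] by auto
  show ?case
  proof (cases "vs = []")
    case True
    then show ?thesis using c by auto
  next
    case False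
    have "\<exists>col'. pcol k (insert v S \<union> set vs) col'"
      by (rule Cons.IH[OF c]) (use Cons.prems False in auto)
    then show ?thesis by auto
  qed
qed simp

lemma max_path_exists:
  assumes "finite X" "P0 \<in> \<P>" "\<And>P. P \<in> \<P> \<Longrightarrow> distinct P \<and> set P \<subseteq> X"
  obtains P where "P \<in> \<P>" "\<And>Q. Q \<in> \<P> \<Longrightarrow> length Q \<le> length P"
proof -
  have "\<forall>P. P \<in> \<P> \<longrightarrow> length P < Suc (card X)"
  proof (intro allI impI)
    fix P assume "P \<in> \<P>"
    then have "length P = card (set P)" "set P \<subseteq> X" using assms distinct_card by metis+
    then show "length P < Suc (card X)" using card_mono[OF assms(1)] by (metis less_Suc_eq_le)
  qed
  then show ?thesis
    using ex_has_greatest_nat[of "\<lambda>P. P \<in> \<P>" P0 length "Suc (card X)"] assms(2) that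
    by (metis less_imp_le)
qed

text \<open>
  This is Zajac's proof of Brooks' theorem: a maximal path \<open>x, v, y, \<dots>\<close> starting with two non-adjacent
  neighbours of \<open>v\<close> closes up to a cycle \<open>C\<close>. If \<open>C\<close> has an edge to the outside, colour the outside
  first, then repeat the colour of an outer neighbour of \<open>u \<in> C\<close> on the successor of \<open>u\<close> and colour the
  rest of \<open>C\<close> greedily, ending in \<open>u\<close>; otherwise give \<open>x\<close> and \<open>y\<close> the same colour and end in \<open>v\<close>.
\<close>

theorem brooks:
  assumes "finite X" "3 \<le> k" "\<And>v. v \<in> X \<Longrightarrow> card (N v \<inter> X) \<le> k"
    "\<And>K. K \<subseteq> X \<Longrightarrow> card K = Suc k \<Longrightarrow> \<exists>x\<in>K. \<exists>y\<in>K. x \<noteq> y \<and> \<not> E x y"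
  shows "\<exists>col. pcol k X col"
  using assms
proof (induction X rule: finite_psubset_induct)
  case (psubset X)
  have IH: "\<exists>col. pcol k Y col" if "Y \<subset> X" for Y
  proof (rule psubset.IH[OF that \<open>3 \<le> k\<close>])
    fix v assume "v \<in> Y"
    then have "card (N v \<inter> Y) \<le> card (N v \<inter> X)" "card (N v \<inter> X) \<le> k"
      using that psubset by (auto intro!: card_mono)
    then show "card (N v \<inter> Y) \<le> k" by simp
  qed (use that psubset in auto)
  show ?case
  proof (cases "X = {}")
    case True
    then show ?thesis by (auto simp: pcol_def)
  next
    case nonempty: False
    show ?thesis
    proof (cases "\<exists>v\<in>X. card (N v \<inter> X) < k")
      case True
      then obtain v where v: "v \<in> X" "card (N v \<inter> X) < k" by auto
      obtain col where col: "pcol k (X - {v}) col" using IH[of "X - {v}"] v by auto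
      have "card (col ` (N v \<inter> (X - {v}))) \<le> card (N v \<inter> (X - {v}))"
        by (rule card_image_le) simp
      also have "\<dots> \<le> card (N v \<inter> X)" by (rule card_mono) auto
      finally obtain c where "pcol k (insert v (X - {v})) (col(v := c))"
        using pcol_extend[OF col, of v] v by auto
      then show ?thesis using v by (auto simp: insert_absorb)
    next
      case False
      then have reg: "\<And>v. v \<in> X \<Longrightarrow> card (N v \<inter> X) = k"
        using psubset.prems by (meson le_antisym not_less)
      obtain v where v: "v \<in> X" using nonempty by auto
      \<comment> \<open>By regularity the closed neighbourhood of \<open>v\<close> has
        \<open>Suc k\<close> vertices and so is not a clique. As \<open>v\<close> is adjacent to all
        its other members, the non-adjacent pair consists of neighbours of \<open>v\<close>.\<close>
      have "card (insert v (N v \<inter> X)) = Suc k" using reg[OF v] E_irrefl by simp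
      moreover have "insert v (N v \<inter> X) \<subseteq> X" using v by auto
      ultimately obtain x y where xy: "E v x" "E v y" "x \<in> X" "y \<in> X" "x \<noteq> y" "\<not> E x y"
        using psubset.prems(3)[of "insert v (N v \<inter> X)"] E_sym by auto
      define \<P> where "\<P> = {P. \<exists>R. P = x # v # y # R \<and> distinct P \<and> set P \<subseteq> X \<and> successively E P}"
      have P0: "[x, v, y] \<in> \<P>" using xy v E_sym E_irrefl by (auto simp: \<P>_def)
      obtain P where P: "P \<in> \<P>" and maxP: "\<And>Q. Q \<in> \<P> \<Longrightarrow> length Q \<le> length P"
        using max_path_exists[OF psubset.hyps P0] by (auto simp: \<P>_def)
      obtain R where R: "P = x # v # y # R" "distinct P" "set P \<subseteq> X" "successively E P"
        using P by (auto simp: \<P>_def)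
      define l where "l = last P"
      have lP: "l \<in> set P" using R by (auto simp: l_def)
      have Nl: "N l \<inter> X \<subseteq> set P"
      proof
        fix z assume z: "z \<in> N l \<inter> X"
        show "z \<in> set P"
        proof (rule ccontr)
          assume "z \<notin> set P"
          have "successively E (P @ [z])"
            using R(4) z by (subst successively_append_iff) (simp add: l_def)
          then have "P @ [z] \<in> \<P>"
            using z R(1-3) \<open>z \<notin> set P\<close> by (auto simp: \<P>_def)
          then show False using maxP by fastforce
        qed
      qed
      have "card (N l \<inter> X) = k" using reg lP R by auto
      then have "N l \<inter> X \<noteq> {}" using \<open>3 \<le> k\<close> by auto
      then have "\<exists>c\<in>set P. E l c" using Nl by auto
      \<comment> \<open>Closing up at the first neighbour of \<open>l\<close> on the path puts all
        neighbours of \<open>l\<close> on the cycle, so \<open>l\<close> has no outer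
        neighbour.\<close>
      then obtain Q c D where split: "P = Q @ c # D" "E l c" "\<forall>q\<in>set Q. \<not> E l q"
        using split_list_first_prop[of P "E l"] by blast
      define C where "C = c # D"
      have NlC: "N l \<inter> X \<subseteq> set C" using Nl split by (auto simp: C_def)
      have PC: "P = Q @ C" "C \<noteq> []" "last C = l" using split by (auto simp: C_def l_def)
      have CX: "set C \<subseteq> X" using PC R by auto
      have sC: "successively E C" "distinct C" using PC R by (auto simp: successively_append_iff)
      have "X - set C \<subset> X" using CX PC(2) by (cases C) auto
      then obtain col where col: "pcol k (X - set C) col" using IH by blast
      show ?thesis
      proof (cases "\<exists>u\<in>set C. \<exists>w\<in>X - set C. E u w")
        case True
        \<comment> \<open>The last such \<open>u\<close> is chosen so that its successor
          \<open>u'\<close> has no outer neighbour; any outer colour is then admissible for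
          \<open>u'\<close>.\<close>
        then obtain C1 u C2 where C: "C = C1 @ u # C2" "\<exists>w\<in>X - set C. E u w"
            "\<forall>q\<in>set C2. \<not> (\<exists>w\<in>X - set C. E q w)"
          using split_list_last_prop[of C "\<lambda>u. \<exists>w\<in>X - set C. E u w"] by blast
        then obtain w where w: "w \<in> X" "w \<notin> set C" "E u w" by auto
        have "C2 \<noteq> []"
        proof
          assume "C2 = []"
          then have "u = l" using C PC by auto
          then show False using w NlC by auto
        qed
        then obtain u' C3 where C3: "C2 = u' # C3" by (cases C2) auto
        \<comment> \<open>The cycle from behind \<open>u'\<close> through \<open>l\<close> and
          \<open>c\<close> around to \<open>u\<close>.\<close>
        let ?vs = "C3 @ C1 @ [u]"
        let ?S = "insert u' (X - set C)"
        have nb: "\<not> E u' z" if "z \<in> X - set C" for z using C C3 that by auto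
        have pc: "pcol k ?S (col(u' := col w))"
          using col nb w E_sym E_irrefl unfolding pcol_def by (auto simp: C C3)
        have "u' \<noteq> w" using w C C3 by auto
        moreover have "E u u'" using sC C C3 by (auto simp: successively_append_iff)
        moreover have "successively E ?vs"
        proof -
          have "last C3 = l" if "C3 \<noteq> []" using PC C C3 that by auto
          moreover have "hd (C1 @ [u]) = c" using C C_def by (cases C1) auto
          ultimately show ?thesis
            using sC C C3 split by (auto simp: successively_append_iff successively_Cons hd_append split: if_splits)
        qed
        ultimately have *: "u' \<noteq> w" "E u u'" "successively E ?vs" by auto
        have setC: "set C = insert u (insert u' (set C1 \<union> set C3))" using C(1) C3 by auto
        have dC: "distinct ?vs" "u' \<notin> set ?vs" using sC(2) C(1) C3 by auto
        have "\<exists>col'. pcol k (?S \<union> set ?vs) col'"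
        proof (rule pcol_extend_list[OF pc, where x=w and y=u' and X=X])
          show "greedy_order ?vs" using * greedy_order_successively by blast
          show "distinct ?vs" by (rule dC)
          show "set ?vs \<inter> ?S = {}" using dC(2) setC by auto
          show "?S \<union> set ?vs \<subseteq> X" using CX setC by auto
          show "card (N z \<inter> X) \<le> k" if "z \<in> set ?vs" for z
            using that CX setC psubset.prems(2)[of z] by auto
          show "u' \<in> ?S" "w \<in> ?S" "?vs \<noteq> []" using w by auto
          show "w \<noteq> u'" "E (last ?vs) w" "E (last ?vs) u'" using * w by auto
          show "(col(u' := col w)) w = (col(u' := col w)) u'" by simp
        qed
        moreover have "?S \<union> set ?vs = X" using setC CX by auto
        ultimately show ?thesis by simp
      next
        case False
        \<comment> \<open>A predecessor of \<open>c\<close> on the path would be an outer neighbour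
          of the cycle. Hence the cycle is the whole path and contains \<open>x\<close>,
          \<open>v\<close> and \<open>y\<close>, none of which has a neighbour outside.\<close>
        have "Q = []"
        proof (rule ccontr)
          assume "Q \<noteq> []"
          then have "E (last Q) c" "last Q \<in> set Q"
            using R(4) split by (auto simp: successively_append_iff)
          moreover have "set Q \<subseteq> X - set C" using R(2,3) unfolding PC(1) by auto
          ultimately have "E c (last Q)" "last Q \<in> X - set C" using E_sym by auto
          then show False using False C_def by auto
        qed
        then have CP: "C = P" using PC by simp
        then have pc: "pcol k (insert x (insert y (X - set P))) (col(x := 0, y := 0))"
        proof -
          have "\<not> E x z \<and> \<not> E z x \<and> \<not> E y z \<and> \<not> E z y" if "z \<in> X - set P" for z
          proof -
            have "x \<in> set C" "y \<in> set C" using CP R(1) by auto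
            then show ?thesis using False that CP E_sym by metis
          qed
          moreover have "\<not> E y x" using xy(6) E_sym by blast
          ultimately show ?thesis
            using col xy(5,6) E_irrefl \<open>3 \<le> k\<close> unfolding CP pcol_def by simp
        qed
        have "N v \<inter> X \<subseteq> set P" using False CP R by auto
        moreover have "\<not> N v \<inter> X \<subseteq> {x, y}"
        proof
          assume "N v \<inter> X \<subseteq> {x, y}"
          then have "card (N v \<inter> X) \<le> card {x, y}" by (rule card_mono[rotated]) simp
          then show False using reg[OF v] \<open>3 \<le> k\<close> card_insert_le_m1[of 2 "{y}" x] by auto
        qed
        ultimately obtain r where "r \<in> N v \<inter> X" "r \<notin> {x, y}" "r \<in> set P" by blast
        then have r: "E v r" "r \<in> set P" "r \<noteq> x" "r \<noteq> y" by auto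
        then have "r \<in> set R" using R(1) E_irrefl by auto
        then obtain R1 R2 where R12: "R = R1 @ r # R2" by (meson split_list)
        \<comment> \<open>\<open>3 \<le> k\<close> gives \<open>v\<close> a third neighbour
          \<open>r\<close> on the path. \<open>R1\<close> leads forwards to \<open>r\<close>,
          \<open>R2\<close> is traversed backwards to \<open>r\<close>, and \<open>v\<close> comes
          last because it sees the equally coloured \<open>x\<close> and \<open>y\<close>.\<close>
        let ?vs = "R1 @ (rev R2 @ [r]) @ [v]"
        have "successively E R" using R by (auto simp: successively_Cons)
        then have s: "successively E (R1 @ [r])" "successively E (r # R2)"
          using R12 by (auto simp: successively_append_iff)
        have "successively E (rev (r # R2))"
          using s(2) by (subst successively_rev) (metis successively_mono E_sym)
        then have "successively E ((rev R2 @ [r]) @ [v])"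
          using r(1) E_sym by (auto simp: successively_append_iff)
        then have g: "greedy_order ?vs"
          using greedy_order_append[OF s(1), of "(rev R2 @ [r]) @ [v]"] greedy_order_successively by auto
        have "\<exists>col'. pcol k (insert x (insert y (X - set P)) \<union> set ?vs) col'"
          by (rule pcol_extend_list[OF pc, where x=x and y=y and X=X])
            (use R R12 g psubset.prems(2) xy in auto)
        moreover have "insert x (insert y (X - set P)) \<union> set ?vs = X" using R R12 by auto
        ultimately show ?thesis by simp
      qed
    qed
  qed
qed

definition indep :: "'a set \<Rightarrow> bool" where
  "indep B \<longleftrightarrow> (\<forall>x\<in>B. \<forall>y\<in>B. \<not> E x y)"

section \<open>Connected 2-regular graphs\<close>

text \<open>A longest path from \<open>z\<close> exhausts \<open>C\<close>. Its end has both
  neighbours on the path, interior vertices already have two neighbours there, so the second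
  neighbour of the end is \<open>z\<close>; the path is then closed under adjacency.\<close>

lemma cycle_enumeration:
  assumes C: "finite C" "cset C" "\<And>v. v \<in> C \<Longrightarrow> card (N v \<inter> C) = 2" and z: "z \<in> C"
  obtains p :: "nat \<Rightarrow> 'a" where "p 0 = z" "bij_betw p {..<card C} C" "3 \<le> card C"
    "\<And>i j. i < card C \<Longrightarrow> j < card C \<Longrightarrow>
       E (p i) (p j) \<longleftrightarrow> j = Suc i mod card C \<or> i = Suc j mod card C"
proof -
  define \<P> where "\<P> = {P. P \<noteq> [] \<and> hd P = z \<and> distinct P \<and> set P \<subseteq> C \<and> successively E P}"
  have z1: "[z] \<in> \<P>" using z by (simp add: \<P>_def)
  have "distinct P \<and> set P \<subseteq> C" if "P \<in> \<P>" for P using that by (simp add: \<P>_def)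
  from max_path_exists[OF C(1) z1 this]
  obtain P where P: "P \<in> \<P>" and maxP: "\<And>Q. Q \<in> \<P> \<Longrightarrow> length Q \<le> length P"
    by blast
  define n where "n = length P"
  define p where "p = (!) P"
  have P': "P \<noteq> []" "p 0 = z" "distinct P" "set P \<subseteq> C" "successively E P"
    using P by (auto simp: \<P>_def p_def hd_conv_nth)
  have n0: "0 < n" using P' by (simp add: n_def)
  have lastP: "last P = p (n - 1)" using P' by (simp add: last_conv_nth p_def n_def)
  have adj: "E (p i) (p (Suc i))" if "Suc i < n" for i
    using P'(5) that by (simp add: successively_conv_nth p_def n_def)
  have inj: "p i = p j \<longleftrightarrow> i = j" if "i < n" "j < n" for i j
    using P'(3) that by (simp add: p_def n_def nth_eq_iff_index_eq)
  have setP: "set P = p ` {..<n}" by (auto simp: p_def n_def set_conv_nth)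
  have inC: "p i \<in> C" if "i < n" for i using P'(4) setP that by auto
  have Nl: "N (p (n - 1)) \<inter> C \<subseteq> set P"
  proof
    fix x assume x: "x \<in> N (p (n - 1)) \<inter> C"
    show "x \<in> set P"
    proof (rule ccontr)
      assume "x \<notin> set P"
      have "successively E (P @ [x])"
        using P'(5) x lastP by (subst successively_append_iff) simp
      then have "P @ [x] \<in> \<P>" using x P \<open>x \<notin> set P\<close> by (auto simp: \<P>_def)
      then show False using maxP by fastforce
    qed
  qed
  have pair: "N (p i) \<inter> C = {x, y}" if "i < n" "x \<in> C" "y \<in> C" "x \<noteq> y" "E (p i) x" "E (p i) y" for i x y
  proof (rule card_subset_eq[symmetric])
    show "card {x, y} = card (N (p i) \<inter> C)" using that C(3) inC by simp
  qed (use that in auto)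
  have n3: "3 \<le> n"
  proof (rule ccontr)
    assume "\<not> ?thesis"
    then have "n \<le> 2" by simp
    have "N (p (n - 1)) \<inter> C \<subseteq> set P - {p (n - 1)}" using Nl E_irrefl by auto
    then have "card (N (p (n - 1)) \<inter> C) \<le> card (set P - {p (n - 1)})"
      by (rule card_mono[rotated]) simp
    also have "\<dots> = n - 1"
    proof -
      have "p (n - 1) \<in> set P" using setP n0 by auto
      then show ?thesis using distinct_card[OF P'(3)] by (simp add: card_Diff_singleton n_def)
    qed
    finally show False using C(3)[OF inC[of "n - 1"]] \<open>n \<le> 2\<close> n0 by simp
  qed
  have interior: "N (p i) \<inter> C = {p (i - 1), p (Suc i)}" if "0 < i" "Suc i < n" for i
  proof (rule pair)
    show "E (p i) (p (i - 1))" using adj[of "i - 1"] E_sym that by simp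
    show "E (p i) (p (Suc i))" using adj that by simp
    show "p (i - 1) \<noteq> p (Suc i)" using that by (subst inj) auto
  qed (use that inC in auto)
  have prev: "E (p (n - 1)) (p (n - 2))"
  proof -
    have "Suc (n - 2) = n - 1" using n3 by simp
    then show ?thesis using adj[of "n - 2"] E_sym n3 by simp
  qed
  have close: "E (p (n - 1)) (p 0)"
  proof (rule ccontr)
    assume no: "\<not> ?thesis"
    have "\<not> N (p (n - 1)) \<inter> C \<subseteq> {p (n - 2)}"
    proof
      assume "N (p (n - 1)) \<inter> C \<subseteq> {p (n - 2)}"
      then have "card (N (p (n - 1)) \<inter> C) \<le> card {p (n - 2)}" by (rule card_mono[rotated]) simp
      then show False using C(3)[OF inC[of "n - 1"]] n0 by simp
    qed
    then obtain x where x: "x \<in> N (p (n - 1)) \<inter> C" "x \<noteq> p (n - 2)" by blast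
    then obtain j where j: "x = p j" "j < n" using Nl setP by auto
    have Ex: "E (p (n - 1)) (p j)" "p j \<noteq> p (n - 2)" using j x by auto
    have "j \<noteq> 0" using Ex no by (metis (no_types))
    moreover have "j \<noteq> n - 1" using Ex E_irrefl by (metis (no_types))
    moreover have "j \<noteq> n - 2" using Ex by (metis (no_types))
    ultimately have "N (p j) \<inter> C = {p (j - 1), p (Suc j)}" "Suc j < n - 1" using interior j by auto
    moreover have "p (n - 1) \<in> N (p j) \<inter> C" using Ex E_sym inC n0 by auto
    ultimately have "p (n - 1) = p (j - 1) \<or> p (n - 1) = p (Suc j)" by auto
    moreover have "n - 1 \<noteq> j - 1" "n - 1 \<noteq> Suc j" "j - 1 < n" "n - 1 < n" "Suc j < n"
      using \<open>Suc j < n - 1\<close> n3 by auto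
    ultimately show False using inj by metis
  qed
  \<comment> \<open>\<open>(i + n - 1) mod n\<close> is the cyclic predecessor; adding
    \<open>n\<close> avoids truncated subtraction at \<open>i = 0\<close>.\<close>
  have nbrs: "N (p i) \<inter> C = {p (Suc i mod n), p ((i + n - 1) mod n)}" if "i < n" for i
  proof -
    consider "i = 0" | "i = n - 1" | "0 < i" "Suc i < n" using \<open>i < n\<close> by linarith
    then show ?thesis
    proof cases
      case 1
      have "N (p 0) \<inter> C = {p 1, p (n - 1)}"
        by (rule pair) (use adj[of 0] close E_sym inC n3 inj in auto)
      then show ?thesis using 1 n3 by simp
    next
      case 2
      have "N (p (n - 1)) \<inter> C = {p 0, p (n - 2)}"
        by (rule pair) (use prev close inC n3 inj in auto)
      moreover have "(i + n - 1) mod n = n - 2"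
      proof -
        have "i + n - 1 = (n - 2) + n" using 2 n3 by simp
        then have "(i + n - 1) mod n = (n - 2) mod n" by (metis mod_add_self2)
        then show ?thesis using n3 by simp
      qed
      ultimately show ?thesis using 2 n3 by simp
    next
      case 3
      have "i + n - 1 = (i - 1) + n" using 3 by simp
      then have "(i + n - 1) mod n = (i - 1) mod n" by (metis mod_add_self2)
      then have "(i + n - 1) mod n = i - 1" using 3 by simp
      then show ?thesis using interior 3 by auto
    qed
  qed
  have "C \<subseteq> set P"
  proof (rule cset_subset[OF C(2) z])
    show "z \<in> set P" using P' setP n0 by auto
    fix u w assume "u \<in> set P" "u \<in> C" "w \<in> C" "E u w"
    then obtain i where "i < n" "u = p i" using setP by auto
    then have "w \<in> N (p i) \<inter> C" using \<open>w \<in> C\<close> \<open>E u w\<close> by simp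
    then have "w \<in> {p (Suc i mod n), p ((i + n - 1) mod n)}"
      using nbrs[OF \<open>i < n\<close>] by blast
    then show "w \<in> set P" using setP n0 by auto
  qed
  then have CP: "C = set P" using P' by auto
  then have cn: "card C = n" using P' by (simp add: n_def distinct_card)
  have "E (p i) (p j) \<longleftrightarrow> j = Suc i mod n \<or> i = Suc j mod n" if "i < n" "j < n" for i j
  proof -
    have "E (p i) (p j) \<longleftrightarrow> p j \<in> N (p i) \<inter> C" using inC that by auto
    also have "\<dots> \<longleftrightarrow> j = Suc i mod n \<or> j = (i + n - 1) mod n"
      unfolding nbrs[OF that(1)] using inj that n0 by simp
    also have "j = (i + n - 1) mod n \<longleftrightarrow> i = Suc j mod n"
    proof (cases "i = 0")
      case True
      then have "(i + n - 1) mod n = n - 1" using n3 by simp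
      then show ?thesis using True that n3
        by (cases "Suc j < n") (auto simp: le_Suc_eq not_less)
    next
      case False
      then have "i + n - 1 = (i - 1) + n" by simp
      then have "(i + n - 1) mod n = (i - 1) mod n" by (metis mod_add_self2)
      then have "(i + n - 1) mod n = i - 1" using that by simp
      then show ?thesis using False that n3 by (cases "Suc j < n") (auto simp: not_less le_Suc_eq)
    qed
    finally show ?thesis .
  qed
  moreover have "bij_betw p {..<n} C" using CP setP inj by (auto simp: bij_betw_def inj_on_def)
  ultimately show ?thesis using that[of p] P' n3 by (simp add: cn)
qed

lemma cycle_indep:
  assumes "finite C" "cset C" "\<And>v. v \<in> C \<Longrightarrow> card (N v \<inter> C) = 2" "z \<in> C"
  shows "\<exists>B\<subseteq>C. indep B \<and> card B = card C div 2 \<and> (odd (card C) \<longrightarrow> z \<notin> B)"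
proof -
  obtain p :: "nat \<Rightarrow> 'a" where p: "p 0 = z" "bij_betw p {..<card C} C" "3 \<le> card C"
    "\<And>i j. i < card C \<Longrightarrow> j < card C \<Longrightarrow>
       E (p i) (p j) \<longleftrightarrow> j = Suc i mod card C \<or> i = Suc j mod card C"
    using cycle_enumeration[OF assms] by blast
  \<comment> \<open>For odd length the offset is 1, so that the positions 1, 3, ... skip
    \<open>p 0 = z\<close>; for even length it is 0.\<close>
  define n s where "n = card C" and "s = card C mod 2"
  have small: "Suc (2 * t + s) < n" if "t < n div 2" for t
    using that unfolding s_def n_def[symmetric] by presburger
  have pinj: "p i = p j \<longleftrightarrow> i = j" if "i < n" "j < n" for i j
    using p(2) that by (auto simp: bij_betw_def inj_on_def n_def)
  define B where "B = (\<lambda>t. p (2 * t + s)) ` {..<n div 2}"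
  have "B \<subseteq> C" using small p(2) by (fastforce simp: B_def bij_betw_def n_def)
  moreover have "indep B"
    unfolding indep_def
  proof (intro ballI notI)
    fix x y assume "x \<in> B" "y \<in> B" "E x y"
    then obtain t t' where t: "t < n div 2" "t' < n div 2" "x = p (2 * t + s)" "y = p (2 * t' + s)"
      by (auto simp: B_def)
    then have "2 * t' + s = Suc (2 * t + s) mod n \<or> 2 * t + s = Suc (2 * t' + s) mod n"
      using p(4)[of "2 * t + s" "2 * t' + s"] small[of t] small[of t'] \<open>E x y\<close> by (simp add: n_def)
    then have "2 * t' + s = Suc (2 * t + s) \<or> 2 * t + s = Suc (2 * t' + s)"
      using small[OF t(1)] small[OF t(2)] by simp
    then show False by presburger
  qed
  moreover have "card B = n div 2"
  proof -
    have "inj_on (\<lambda>t. p (2 * t + s)) {..<n div 2}"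
    proof (rule inj_onI)
      fix t t' assume "t \<in> {..<n div 2}" "t' \<in> {..<n div 2}" "p (2 * t + s) = p (2 * t' + s)"
      then show "t = t'" using small[of t] small[of t'] pinj[of "2 * t + s" "2 * t' + s"] by simp
    qed
    then show ?thesis by (simp add: B_def card_image)
  qed
  moreover have "z \<notin> B" if "odd n"
  proof
    assume "z \<in> B"
    then obtain t where "t < n div 2" "p (2 * t + s) = p 0" using p(1) by (auto simp: B_def)
    then have "2 * t + s = 0" using pinj[of "2 * t + s" 0] small[of t] by simp
    then show False using that by (simp add: s_def n_def odd_iff_mod_2_eq_one)
  qed
  ultimately show ?thesis by (auto simp: n_def)
qed

end

section \<open>A weighted bound on independent sets\<close>

text \<open>(a + b)^2 = 4ab + (a - b)^2, so equality with the rounded quarter forces (a - b)^2 <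
  4.\<close>

lemma balanced_product:
  fixes a b :: nat
  assumes "a * b = (a + b)\<^sup>2 div 4"
  shows "a = b \<or> a = Suc b \<or> b = Suc a"
proof -
  have *: "e < 2" if "x * (x + e) = (x + (x + e))\<^sup>2 div 4" for x e :: nat
  proof -
    have "(x + (x + e))\<^sup>2 = 4 * (x * (x + e)) + e\<^sup>2" by (simp add: power2_eq_square algebra_simps)
    then have "(x + (x + e))\<^sup>2 div 4 = x * (x + e) + e\<^sup>2 div 4" by simp
    then have "e\<^sup>2 < 4" using that by (simp add: div_eq_0_iff)
    then have "e\<^sup>2 < 2\<^sup>2" by simp
    then show "e < 2" using power2_less_imp_less by blast
  qed
  show ?thesis
  proof (cases "a \<le> b")
    case True
    then show ?thesis using *[of a "b - a"] assms by auto
  next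
    case False
    then show ?thesis using *[of b "a - b"] assms by (auto simp: algebra_simps)
  qed
qed

lemma product_le_quarter_square: "a * b \<le> (a + b)\<^sup>2 div 4" for a b :: nat
proof -
  have "4 * (a * b) \<le> (a + b)\<^sup>2"
  proof -
    have "0 \<le> (int a - int b)\<^sup>2" by simp
    then have "4 * (int a * int b) \<le> (int a + int b)\<^sup>2" by (simp add: power2_eq_square algebra_simps)
    then show ?thesis by (metis of_nat_add of_nat_le_iff of_nat_mult of_nat_numeral of_nat_power)
  qed
  then show ?thesis by linarith
qed

locale dgraph = ugraph +
  fixes D :: nat
  assumes D4: "4 \<le> D" and deg_le: "v \<in> V \<Longrightarrow> card (N v) \<le> D"
begin

abbreviation quarter :: int where
  "quarter \<equiv> int (D\<^sup>2 div 4)"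

text \<open>
  The vertex sets of the non-trivial blocks of a special graph: every vertex has \<open>a\<close> neighbours inside
  and will have \<open>b\<close> neighbours outside. A graph with \<open>a\<close>-regular \<open>C\<close> and \<open>Suc a\<close> vertices is
  complete; for \<open>D = 4\<close> the second alternative is an odd cycle.
\<close>

definition piece :: "nat \<Rightarrow> nat \<Rightarrow> 'a set \<Rightarrow> bool" where
  "piece a b C \<longleftrightarrow> C \<noteq> {} \<and> C \<subseteq> V \<and> cset C \<and> a + b = D \<and> a * b = D\<^sup>2 div 4 \<and>
     (\<forall>u\<in>C. card (N u \<inter> C) = a) \<and> (card C = Suc a \<or> D = 4 \<and> odd (card C))"

text \<open>
  In a minimal counterexample, no independent set \<open>B\<close> pays for its closed neighbourhood. Applied to a
  vertex of maximal weight \<open>M\<close>, hypothesis \<open>H1\<close> makes its closed neighbourhood regular of constant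
  weight, and this spreads over the whole component, where \<open>H2\<close> applies.
\<close>

lemma weighted_indep_generic:
  fixes P Q R :: int and m :: "'a \<Rightarrow> nat"
  assumes P0: "0 \<le> P" and R0: "0 \<le> R"
    and H1: "\<And>M d. 1 \<le> M \<Longrightarrow> M + d \<le> D \<Longrightarrow> (int M - 1) * R < (int d + 1) * (P * int M - Q) \<Longrightarrow>
      d + M = D \<and> d * M = D\<^sup>2 div 4 \<and> (int d + 1) * (P * int M - Q) - P \<le> (int M - 1) * R"
    and H2: "\<And>C a b. C \<subseteq> V \<Longrightarrow> C \<noteq> {} \<Longrightarrow> cset C \<Longrightarrow> a + b = D \<Longrightarrow> a * b = D\<^sup>2 div 4 \<Longrightarrow>
      (\<And>u. u \<in> C \<Longrightarrow> card (N u \<inter> C) = a) \<Longrightarrow> \<not> piece a b C \<Longrightarrow>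
      \<exists>B\<subseteq>C. B \<noteq> {} \<and> indep B \<and> int (card C) * (P * int b - Q) \<le> int (card B) * (int b - 1) * R"
    and X: "X \<subseteq> V" "\<And>v. v \<in> X \<Longrightarrow> 1 \<le> m v \<and> m v + card (N v \<inter> X) \<le> D"
    and nobad: "\<And>C a b. C \<subseteq> X \<Longrightarrow> piece a b C \<Longrightarrow> \<exists>u\<in>C. m u \<noteq> b"
  shows "\<exists>B\<subseteq>X. indep B \<and> (\<Sum>v\<in>X. P * int (m v) - Q) \<le> R * (\<Sum>v\<in>B. int (m v) - 1)"
proof -
  have "finite X" using X finV finite_subset by blast
  then show ?thesis using X nobad
  proof (induction X rule: finite_psubset_induct)
    case (psubset X)
    let ?t = "\<lambda>v. P * int (m v) - Q"
    let ?w = "\<lambda>v. int (m v) - 1"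
    \<comment> \<open>The vertices used up when \<open>B\<close> is chosen. If some
      \<open>B0\<close> earns at least their total cost, it is chosen and the induction continues on
      the rest.\<close>
    define cl where "cl = (\<lambda>B. B \<union> (\<Union>u\<in>B. N u \<inter> X))"
    show ?case
    proof (cases "\<exists>B0\<subseteq>X. B0 \<noteq> {} \<and> indep B0 \<and> sum ?t (cl B0) \<le> R * sum ?w B0")
      case True
      then obtain B0 where B0: "B0 \<subseteq> X" "B0 \<noteq> {}" "indep B0" "sum ?t (cl B0) \<le> R * sum ?w B0" by blast
      have cl: "cl B0 \<subseteq> X" "cl B0 \<noteq> {}" using B0 by (auto simp: cl_def)
      have "\<exists>B\<subseteq>X - cl B0. indep B \<and> sum ?t (X - cl B0) \<le> R * sum ?w B"
      proof (rule psubset.IH)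
        show "X - cl B0 \<subset> X" using cl by auto
        show "1 \<le> m v \<and> m v + card (N v \<inter> (X - cl B0)) \<le> D" if "v \<in> X - cl B0" for v
        proof -
          have "card (N v \<inter> (X - cl B0)) \<le> card (N v \<inter> X)" by (rule card_mono) auto
          then show ?thesis using psubset.prems(2)[of v] that by auto
        qed
        show "\<exists>u\<in>C. m u \<noteq> b" if "C \<subseteq> X - cl B0" "piece a b C" for C a b
          using psubset.prems(3)[of C a b] that by blast
        show "X - cl B0 \<subseteq> V" using psubset.prems(1) by blast
      qed
      then obtain B where B: "B \<subseteq> X - cl B0" "indep B" "sum ?t (X - cl B0) \<le> R * sum ?w B" by blast
      have sep: "\<not> E x y \<and> \<not> E y x" if "x \<in> B0" "y \<in> B" for x y
      proof -
        have "y \<in> X" "y \<notin> cl B0" using B(1) that by auto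
        then have "\<not> E x y" using that by (auto simp: cl_def)
        then show ?thesis using E_sym by blast
      qed
      have "indep (B0 \<union> B)"
        unfolding indep_def
      proof (intro ballI)
        fix x y assume "x \<in> B0 \<union> B" "y \<in> B0 \<union> B"
        then show "\<not> E x y" using sep B(2) B0(3) by (metis UnE indep_def)
      qed
      moreover have "sum ?t X = sum ?t (X - cl B0) + sum ?t (cl B0)"
        using sum.subset_diff[OF cl(1) psubset.hyps] .
      moreover have "sum ?w (B0 \<union> B) = sum ?w B0 + sum ?w B"
      proof (rule sum.union_disjoint)
        show "finite B0" "finite B" using B(1) B0(1) psubset.hyps by (meson finite_subset Diff_subset)+
        show "B0 \<inter> B = {}" using B(1) by (auto simp: cl_def)
      qed
      ultimately have "B0 \<union> B \<subseteq> X \<and> indep (B0 \<union> B) \<and> sum ?t X \<le> R * sum ?w (B0 \<union> B)"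
        using B B0 by (auto simp: algebra_simps)
      then show ?thesis by blast
    next
      case False
      then have strict: "R * sum ?w B0 < sum ?t (cl B0)" if "B0 \<subseteq> X" "B0 \<noteq> {}" "indep B0" for B0
        using that by (meson not_le)
      show ?thesis
      proof (cases "X = {}")
        case True
        then show ?thesis by (auto simp: indep_def)
      next
        case False
        define M where "M = Max (m ` X)"
        have mM: "m x \<le> M" if "x \<in> X" for x using psubset.hyps that by (simp add: M_def)
        have "M \<in> m ` X" using False psubset.hyps by (simp add: M_def)
        then obtain v where v: "v \<in> X" "m v = M" by auto
        have top: "card (N x \<inter> X) + M = D \<and> card (N x \<inter> X) * M = D\<^sup>2 div 4 \<and>
            (\<forall>u\<in>N x \<inter> X. m u = M) \<and> 0 < P * int M - Q" if x: "x \<in> X" "m x = M" for x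
        proof -
          let ?d = "card (N x \<inter> X)"
          have clx: "cl {x} = insert x (N x \<inter> X)" by (auto simp: cl_def)
          have lt: "(int M - 1) * R < sum ?t (insert x (N x \<inter> X))"
            using strict[of "{x}"] x E_irrefl by (simp add: clx indep_def mult.commute)
          have tle: "?t u \<le> P * int M - Q" if "u \<in> X" for u
            using mM[OF that] P0 by (simp add: mult_left_mono)
          have s: "sum ?t (insert x (N x \<inter> X)) = ?t x + sum ?t (N x \<inter> X)"
            using E_irrefl by simp
          have "sum ?t (N x \<inter> X) \<le> int ?d * (P * int M - Q)"
            using sum_bounded_above[of "N x \<inter> X" ?t "P * int M - Q"] tle by auto
          then have le: "(int M - 1) * R < (int ?d + 1) * (P * int M - Q)"
            using lt s x by (simp add: algebra_simps)
          have M1: "1 \<le> M" "M + ?d \<le> D" using psubset.prems(2)[of x] x by auto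
          note h = H1[OF M1 le]
          \<comment> \<open>A neighbour with fewer leaves lowers the cost of the closed
            neighbourhood by at least \<open>P\<close>, and the last conclusion of \<open>H1\<close>
            says that \<open>{x}\<close> would then pay.\<close>
          have "m u = M" if u: "u \<in> N x \<inter> X" for u
          proof (rule ccontr)
            assume "m u \<noteq> M"
            then have "int (m u) \<le> int M - 1" using mM[of u] u by auto
            then have "P * int (m u) \<le> P * (int M - 1)" using P0 by (simp add: mult_left_mono)
            then have "?t u \<le> P * int M - Q - P" by (simp add: algebra_simps)
            moreover have "sum ?t (N x \<inter> X) = ?t u + sum ?t (N x \<inter> X - {u})"
              using u by (simp add: sum.remove)
            moreover have "sum ?t (N x \<inter> X - {u}) \<le> int (card (N x \<inter> X - {u})) * (P * int M - Q)"
              using sum_bounded_above[of "N x \<inter> X - {u}" ?t "P * int M - Q"] tle by auto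
            moreover have "int (card (N x \<inter> X - {u})) = int ?d - 1"
            proof -
              have "0 < ?d" using u by (auto simp: card_gt_0_iff)
              then show ?thesis using u by (simp add: card_Diff_singleton)
            qed
            ultimately have "sum ?t (N x \<inter> X) \<le> int ?d * (P * int M - Q) - P"
              by (simp add: algebra_simps)
            then have "(int M - 1) * R < (int ?d + 1) * (P * int M - Q) - P"
              using lt s x by (simp add: algebra_simps)
            then show False using h by simp
          qed
          \<comment> \<open>Positivity is what later allows the cost of \<open>cl B\<close> to be
            bounded by the cost of all of \<open>C\<close>.\<close>
          moreover have "0 < P * int M - Q"
          proof (rule ccontr)
            assume "\<not> ?thesis"
            then have "?t u \<le> 0" if "u \<in> insert x (N x \<inter> X)" for u
              using tle[of u] x that by fastforce
            then have "sum ?t (insert x (N x \<inter> X)) \<le> 0" by (rule sum_nonpos)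
            moreover have "0 \<le> (int M - 1) * R" using M1 R0 by simp
            ultimately show False using lt by simp
          qed
          ultimately show ?thesis using h by simp
        qed
        define C where "C = comp X v"
        have CX: "C \<subseteq> X" "v \<in> C" "cset C" using v comp_subset cset_comp by (auto simp: C_def)
        have mC: "m x = M" if "x \<in> C" for x
        proof -
          have "lnk X v x" using that by (simp add: C_def comp_def)
          then have "x \<in> {u \<in> X. m u = M}"
          proof (rule lnk_induct)
            fix u w assume "u \<in> {u \<in> X. m u = M}" "w \<in> X" "E u w"
            moreover from this have "w \<in> N u \<inter> X" by simp
            ultimately show "w \<in> {u \<in> X. m u = M}" using top[of u] by blast
          qed (use v in auto)
          then show ?thesis by simp
        qed
        have NC: "N x \<inter> C = N x \<inter> X" if "x \<in> C" for x
          using that CX(1) comp_closed[of x X v] by (auto simp: C_def)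
        define a where "a = card (N v \<inter> X)"
        have a: "a + M = D" "a * M = D\<^sup>2 div 4" using top[OF v] by (auto simp: a_def)
        have reg: "card (N x \<inter> C) = a" if "x \<in> C" for x
          using top[of x] mC[OF that] CX that NC[OF that] a by auto
        have "\<not> piece a M C" using psubset.prems(3)[OF CX(1)] mC by blast
        then obtain B where B: "B \<subseteq> C" "B \<noteq> {}" "indep B"
            "int (card C) * (P * int M - Q) \<le> int (card B) * (int M - 1) * R"
          using H2[of C a M] CX a reg psubset.prems(1) by auto
        have "cl B \<subseteq> C"
        proof
          fix x assume "x \<in> cl B"
          then consider "x \<in> B" | u where "u \<in> B" "x \<in> N u \<inter> X" by (auto simp: cl_def)
          then show "x \<in> C"
          proof cases
            case 2
            then show ?thesis using NC[of u] B(1) by blast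
          qed (use B in auto)
        qed
        have "sum ?t (cl B) = int (card (cl B)) * (P * int M - Q)"
          using mC \<open>cl B \<subseteq> C\<close> by (subst sum.cong[of _ _ _ "\<lambda>_. P * int M - Q"]) auto
        also have "\<dots> \<le> int (card C) * (P * int M - Q)"
          using top[OF v] \<open>cl B \<subseteq> C\<close> finite_subset[OF CX(1) psubset.hyps]
          by (intro mult_right_mono) (auto intro: card_mono)
        also have "\<dots> \<le> R * sum ?w B"
          using B(4) mC B(1) by (subst sum.cong[of B B ?w "\<lambda>_. int M - 1"]) (auto simp: algebra_simps)
        finally show ?thesis using strict[of B] B CX by fastforce
      qed
    qed
  qed
qed

text \<open>A clique on \<open>Suc a\<close> vertices would be closed in the connected
  \<open>a\<close>-regular set \<open>C\<close> and hence be all of \<open>C\<close>. So Brooks'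
  theorem gives \<open>a\<close> colours, and some colour class is at least as large as the
  average.\<close>

lemma regular_indep:
  assumes "3 \<le> a" "finite C" "cset C" "\<And>u. u \<in> C \<Longrightarrow> card (N u \<inter> C) = a" "card C \<noteq> Suc a"
  shows "\<exists>B\<subseteq>C. indep B \<and> card C \<le> a * card B"
proof -
  have "\<exists>x\<in>K. \<exists>y\<in>K. x \<noteq> y \<and> \<not> E x y" if K: "K \<subseteq> C" "card K = Suc a" for K
  proof (rule ccontr)
    assume clique: "\<not> ?thesis"
    have fK: "finite K" using K assms(2) finite_subset by blast
    have eq: "N x \<inter> C = K - {x}" if "x \<in> K" for x
    proof (rule card_subset_eq[symmetric])
      show "K - {x} \<subseteq> N x \<inter> C"
      proof
        fix y assume "y \<in> K - {x}"
        then show "y \<in> N x \<inter> C" using clique that K by (metis DiffD1 DiffD2 IntI in_N insertCI subsetD)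
      qed
      show "card (K - {x}) = card (N x \<inter> C)" using assms(4)[of x] that K by auto
    qed simp
    obtain x where "x \<in> K" using K by force
    have "C \<subseteq> K"
    proof (rule cset_subset[OF assms(3)])
      show "x \<in> C" "x \<in> K" using \<open>x \<in> K\<close> K by auto
      fix u w assume "u \<in> K" "w \<in> C" "E u w"
      then have "w \<in> N u \<inter> C" by simp
      then show "w \<in> K" using eq[OF \<open>u \<in> K\<close>] by blast
    qed
    then show False using K assms(5) by auto
  qed
  then obtain col where col: "pcol a C col"
    using brooks[OF assms(2,1)] assms(4) by (metis order_refl)
  define cls where "cls = (\<lambda>i. {x \<in> C. col x = i})"
  have "\<exists>i<a. card C \<le> a * card (cls i)"
  proof (rule ccontr)
    assume "\<not> ?thesis"
    then have less: "a * card (cls i) < card C" if "i < a" for i using that not_le by blast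
    have "C = (\<Union>i<a. cls i)" using col by (auto simp: cls_def pcol_def)
    then have "card C = card (\<Union>i<a. cls i)" by simp
    also have "\<dots> \<le> (\<Sum>i<a. card (cls i))" by (rule card_UN_le) simp
    finally have "a * card C \<le> (\<Sum>i<a. a * card (cls i))" by (simp flip: sum_distrib_left)
    also have "\<dots> < (\<Sum>i<a. card C)"
      by (rule sum_strict_mono) (use less assms(1) in \<open>auto simp: lessThan_empty_iff\<close>)
    finally show False by simp
  qed
  then obtain i where "card C \<le> a * card (cls i)" by blast
  moreover have "indep (cls i)" "cls i \<subseteq> C" using col unfolding cls_def indep_def pcol_def by blast+
  ultimately show ?thesis by blast
qed

text \<open>Let c be the rounded quarter. Every star has \<open>m v + 1\<close> vertices, so
  inserting |S| <= |V| - |X| - (sum of \<open>m v - 1\<close> over \<open>B\<close>) into (c + D)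
  |S| <= c |V| leaves exactly this inequality, where \<open>X\<close> will be the set of
  centres.\<close>

lemma weighted_indep:
  fixes m :: "'a \<Rightarrow> nat"
  assumes "D \<noteq> 5" and X: "X \<subseteq> V" "\<And>v. v \<in> X \<Longrightarrow> 1 \<le> m v \<and> m v + card (N v \<inter> X) \<le> D"
    and nobad: "\<And>C a b. C \<subseteq> X \<Longrightarrow> piece a b C \<Longrightarrow> \<exists>u\<in>C. m u \<noteq> b"
  shows "\<exists>B\<subseteq>X. indep B \<and> (\<Sum>v\<in>X. int D * int (m v) - int (D\<^sup>2 div 4))
    \<le> (int (D\<^sup>2 div 4) + int D) * (\<Sum>v\<in>B. int (m v) - 1)"
proof -
  define c where "c = int (D\<^sup>2 div 4)"
  \<comment> \<open>\<open>M\<close> is half of \<open>D\<close> up to rounding. This is where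
    \<open>D \<noteq> 5\<close> enters: \<open>A = 3\<close>, \<open>M = 2\<close> would violate the
    inequality.\<close>
  have square: "D \<le> M * M" if "A + M = D" "A * M = D\<^sup>2 div 4" for A M
  proof -
    have "A = M \<or> A = Suc M \<or> M = Suc A" using balanced_product[of A M] that by simp
    then show ?thesis
    proof (elim disjE)
      assume "A = M"
      then have "2 \<le> M" "D = 2 * M" using that D4 by auto
      then show ?thesis by simp
    next
      assume "A = Suc M"
      then have "3 \<le> M" "D = 2 * M + 1" using that(1) D4 \<open>D \<noteq> 5\<close> by presburger+
      moreover from this have "3 * M \<le> M * M" by simp
      ultimately show ?thesis by linarith
    next
      assume "M = Suc A"
      then have "4 \<le> M" "D + 1 = 2 * M" using that(1) D4 \<open>D \<noteq> 5\<close> by presburger+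
      moreover from this have "4 * M \<le> M * M" by simp
      ultimately show ?thesis by linarith
    qed
  qed
  show ?thesis
    unfolding c_def[symmetric]
  proof (rule weighted_indep_generic[OF _ _ _ _ X])
    show "0 \<le> int D" "0 \<le> c + int D" by (auto simp: c_def)
    show "\<exists>u\<in>C. m u \<noteq> b" if "C \<subseteq> X" "piece a b C" for C a b using nobad that .
  next
    fix M d :: nat
    assume h: "1 \<le> M" "M + d \<le> D" "(int M - 1) * (c + int D) < (int d + 1) * (int D * int M - c)"
    define A where "A = D - M"
    have D: "D = A + M" "int D = int A + int M" and dA: "d \<le> A" using h by (auto simp: A_def)
    have "A * M \<le> D\<^sup>2 div 4" using product_le_quarter_square[of A M] by (simp only: D(1))
    then have cge: "int A * int M \<le> c" unfolding c_def by (metis of_nat_le_iff of_nat_mult)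
    have c0: "0 \<le> c" by (simp add: c_def)
    have pos: "0 < int D * int M - c"
    proof (rule ccontr)
      assume "\<not> ?thesis"
      then have "(int d + 1) * (int D * int M - c) \<le> 0" by (intro mult_nonneg_nonpos) auto
      moreover have "0 \<le> (int M - 1) * (c + int D)" using h c0 by simp
      ultimately show False using h by simp
    qed
    have id: "(int A + 1) * (int D * int M - c) = (int M - 1) * (c + int D) + int D * (int A * int M - c + 1)"
      by (simp add: D algebra_simps)
    have "(int d + 1) * (int D * int M - c) \<le> (int A + 1) * (int D * int M - c)"
      using pos dA by (intro mult_right_mono) auto
    then have "0 < int D * (int A * int M - c + 1)" using h(3) id by simp
    then have "0 < int A * int M - c + 1" using D4 by (simp add: zero_less_mult_iff)
    then have ceq: "int A * int M = c" using cge by simp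
    then have AM: "A * M = D\<^sup>2 div 4" unfolding c_def by (metis of_nat_eq_iff of_nat_mult)
    have DM: "int D * int M - c = int M * int M" using D ceq by (simp add: algebra_simps)
    have "int D \<le> int M * int M" using square[of A M] D AM by (metis of_nat_le_iff of_nat_mult)
    \<comment> \<open>With fewer than \<open>A\<close> neighbours the cost drops by at least
      \<open>D * M - c = M * M\<close>, which by \<open>square\<close> absorbs the deficit
      \<open>D\<close>.\<close>
    have "d = A"
    proof (rule ccontr)
      assume "d \<noteq> A"
      then have "(int d + 1) * (int D * int M - c) \<le> int A * (int D * int M - c)"
        using pos dA by (intro mult_right_mono) auto
      also have "\<dots> = (int A + 1) * (int D * int M - c) - int M * int M"
        using DM by (simp add: algebra_simps)
      also have "\<dots> = (int M - 1) * (c + int D) + int D - int M * int M"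
        using id ceq by simp
      finally show False using h(3) \<open>int D \<le> int M * int M\<close> by simp
    qed
    then show "d + M = D \<and> d * M = D\<^sup>2 div 4 \<and>
        (int d + 1) * (int D * int M - c) - int D \<le> (int M - 1) * (c + int D)"
      using D AM id ceq by simp
  next
    fix C a b
    assume C: "C \<subseteq> V" "C \<noteq> {}" "cset C" "a + b = D" "a * b = D\<^sup>2 div 4"
      "\<And>u. u \<in> C \<Longrightarrow> card (N u \<inter> C) = a" "\<not> piece a b C"
    have fC: "finite C" using C finV finite_subset by blast
    have cC: "0 < card C" using fC C by (simp add: card_gt_0_iff)
    have bal: "a = b \<or> a = Suc b \<or> b = Suc a" using balanced_product[of a b] C by simp
    have np: "card C \<noteq> Suc a" "D = 4 \<Longrightarrow> even (card C)"
      using C unfolding piece_def by blast+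
    have "\<exists>B\<subseteq>C. indep B \<and> card C \<le> a * card B"
    proof (cases "3 \<le> a")
      case True
      show ?thesis by (rule regular_indep[OF True fC C(3) C(6) np(1)])
    next
      case False
      \<comment> \<open>Brooks' theorem needs three colours. What remains is a cycle with
        \<open>D = 4\<close>, of even length because \<open>C\<close> is not a piece.\<close>
      then have ab: "a = 2" "b = 2" "D = 4" using bal C D4 \<open>D \<noteq> 5\<close> by auto
      obtain z where "z \<in> C" using C by auto
      then obtain B where "B \<subseteq> C" "indep B" "card B = card C div 2"
        using cycle_indep[OF fC C(3), of z] C(6) ab by auto
      then show ?thesis using np(2) ab by auto
    qed
    then obtain B where B: "B \<subseteq> C" "indep B" "card C \<le> a * card B" by blast
    have cab: "c = int a * int b" using C(5) by (simp add: c_def flip: of_nat_mult)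
    have Dab: "int D = int a + int b" using C by simp
    \<comment> \<open>With \<open>c = a * b\<close> and \<open>D = a + b\<close> one gets
      \<open>D * b - c = b * b\<close> and \<open>(b - 1) * (c + D) = a * b * b + b * b - D\<close>,
      so \<open>num\<close> is equivalent to \<open>D \<le> b * b\<close>.\<close>
    have "int b * int b \<ge> int D" using square[of a b] C by (metis of_nat_le_iff of_nat_mult)
    then have num: "int a * (int D * int b - c) \<le> (int b - 1) * (c + int D)"
      by (simp add: cab Dab algebra_simps)
    have "0 \<le> int D * int b - c" by (simp add: cab Dab algebra_simps)
    then have "int (card C) * (int D * int b - c) \<le> int (a * card B) * (int D * int b - c)"
      using B by (intro mult_right_mono) (simp_all only: of_nat_le_iff)
    also have "\<dots> = int (card B) * (int a * (int D * int b - c))" by (simp add: algebra_simps)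
    also have "\<dots> \<le> int (card B) * ((int b - 1) * (c + int D))" using num by (intro mult_left_mono) auto
    finally have "int (card C) * (int D * int b - c) \<le> int (card B) * (int b - 1) * (c + int D)"
      by (simp add: algebra_simps)
    moreover have "B \<noteq> {}" using B cC by auto
    ultimately show "\<exists>B\<subseteq>C. B \<noteq> {} \<and> indep B \<and>
        int (card C) * (int D * int b - c) \<le> int (card B) * (int b - 1) * (c + int D)"
      using B by blast
  qed
qed

text \<open>The same translation as in \<open>weighted_indep\<close>, now of 9 |S| <= 5 |V|. The
  first condition is a check of finitely many \<open>M\<close>; at \<open>M = 2\<close>,
  \<open>d = 2\<close> the price is met with equality.\<close>

lemma weighted_indep_5:
  fixes m :: "'a \<Rightarrow> nat"
  assumes "D = 5" and X: "X \<subseteq> V" "\<And>v. v \<in> X \<Longrightarrow> 1 \<le> m v \<and> m v + card (N v \<inter> X) \<le> D"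
    and nobad: "\<And>C a b. C \<subseteq> X \<Longrightarrow> piece a b C \<Longrightarrow> \<exists>u\<in>C. m u \<noteq> b"
  shows "\<exists>B\<subseteq>X. indep B \<and> (\<Sum>v\<in>X. 4 * int (m v) - 5) \<le> 9 * (\<Sum>v\<in>B. int (m v) - 1)"
proof (rule weighted_indep_generic[OF _ _ _ _ X])
  show "\<exists>u\<in>C. m u \<noteq> b" if "C \<subseteq> X" "piece a b C" for C a b using nobad that .
next
  fix M d :: nat
  assume h: "1 \<le> M" "M + d \<le> D" "(int M - 1) * 9 < (int d + 1) * (4 * int M - 5)"
  have "M \<in> {1, 2, 3, 4, 5}" using h \<open>D = 5\<close> by auto
  then show "d + M = D \<and> d * M = D\<^sup>2 div 4 \<and> (int d + 1) * (4 * int M - 5) - 4 \<le> (int M - 1) * 9"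
  proof (elim insertE)
    assume "M = 2"
    then have "d = 3" using h \<open>D = 5\<close> by simp
    then show ?thesis using \<open>M = 2\<close> \<open>D = 5\<close> by simp
  next
    assume "M = 3"
    then have "d = 2" using h \<open>D = 5\<close> by simp
    then show ?thesis using \<open>M = 3\<close> \<open>D = 5\<close> by simp
  qed (use h \<open>D = 5\<close> in auto)
next
  fix C a b
  assume C: "C \<subseteq> V" "C \<noteq> {}" "cset C" "a + b = D" "a * b = D\<^sup>2 div 4"
    "\<And>u. u \<in> C \<Longrightarrow> card (N u \<inter> C) = a" "\<not> piece a b C"
  have fC: "finite C" using C finV finite_subset by blast
  have cC: "0 < card C" using fC C by (simp add: card_gt_0_iff)
  have bal: "a = b \<or> a = Suc b \<or> b = Suc a" using balanced_product[of a b] C by simp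
  then consider "a = 3" "b = 2" | "a = 2" "b = 3" using C(4) \<open>D = 5\<close> by linarith
  then show "\<exists>B\<subseteq>C. B \<noteq> {} \<and> indep B \<and> int (card C) * (4 * int b - 5) \<le> int (card B) * (int b - 1) * 9"
  proof cases
    case 1
    have np: "card C \<noteq> Suc a" using C unfolding piece_def by blast
    have "\<exists>B\<subseteq>C. indep B \<and> card C \<le> a * card B"
      by (rule regular_indep[OF _ fC C(3) C(6) np]) (use 1 in auto)
    then obtain B where B: "B \<subseteq> C" "indep B" "card C \<le> 3 * card B" using 1 by blast
    moreover have "B \<noteq> {}" using B cC by auto
    ultimately show ?thesis using 1 by (intro exI[of _ B]) auto
  next
    case 2
    have np: "card C \<noteq> 3"
    proof
      assume "card C = 3"
      then have "card C = Suc a" using 2 by simp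
      then have "piece a b C" unfolding piece_def using C(1-6) by blast
      then show False using C(7) by blast
    qed
    obtain z where z: "z \<in> C" using C by auto
    have reg: "\<And>u. u \<in> C \<Longrightarrow> card (N u \<inter> C) = 2" using C 2 by simp
    have "3 \<le> card C" using cycle_enumeration[OF fC C(3) reg z] by blast
    then have "4 \<le> card C" using np by simp
    obtain B where B: "B \<subseteq> C" "indep B" "card B = card C div 2"
      using cycle_indep[OF fC C(3) reg z] by blast
    \<comment> \<open>For the 5-cycle this says 35 <= 36. With the weights belonging to 6/11 the
      corresponding condition would be 45 <= 44.\<close>
    then have "7 * card C \<le> 18 * card B" using \<open>4 \<le> card C\<close> by presburger
    moreover have "B \<noteq> {}" using B \<open>4 \<le> card C\<close> by auto
    ultimately show ?thesis using 2 B by (intro exI[of _ B]) auto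
  qed
qed simp_all

end

section \<open>Star partitions\<close>

context ugraph
begin

definition ids :: "'a set \<Rightarrow> bool" where
  "ids S \<longleftrightarrow> S \<subseteq> V \<and> indep S \<and> (\<forall>v\<in>V - S. \<exists>u\<in>S. E v u)"

lemma ids_extend:
  assumes "indep B" "B \<subseteq> V"
  obtains S where "B \<subseteq> S" "ids S"
proof -
  define \<F> where "\<F> = {S. B \<subseteq> S \<and> S \<subseteq> V \<and> indep S}"
  have "finite \<F>" by (rule finite_subset[of _ "Pow V"]) (use finV in \<open>auto simp: \<F>_def\<close>)
  moreover have "B \<in> \<F>" using assms by (simp add: \<F>_def)
  ultimately obtain S where "S \<in> \<F>" and "\<forall>T\<in>\<F>. S \<subseteq> T \<longrightarrow> S = T"
    using finite_has_maximal[of \<F>] by blast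
  then have S: "B \<subseteq> S" "S \<subseteq> V" "indep S"
    and max: "\<And>T. B \<subseteq> T \<Longrightarrow> T \<subseteq> V \<Longrightarrow> indep T \<Longrightarrow> S \<subseteq> T \<Longrightarrow> S = T"
    by (simp_all add: \<F>_def)
  have "\<exists>u\<in>S. E v u" if "v \<in> V - S" for v
  proof (rule ccontr)
    assume "\<not> ?thesis"
    then have "indep (insert v S)" using S(3) E_sym E_irrefl unfolding indep_def by blast
    then show False using max[of "insert v S"] S that by blast
  qed
  then show ?thesis using that S by (simp add: ids_def)
qed

abbreviation star_at :: "'a set \<Rightarrow> ('a \<Rightarrow> 'a) \<Rightarrow> 'a \<Rightarrow> bool" where
  "star_at U f x \<equiv> f x \<in> U \<and> f (f x) = f x \<and> (f x \<noteq> x \<longrightarrow> E (f x) x) \<and>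
     (f x = x \<longrightarrow> (\<exists>y\<in>U. y \<noteq> x \<and> f y = x))"

text \<open>
  A partition of \<open>U\<close> into stars with at least one leaf each, encoded by the map sending every vertex
  to the centre of its star.
\<close>

definition star_on :: "'a set \<Rightarrow> ('a \<Rightarrow> 'a) \<Rightarrow> bool" where
  "star_on U f \<longleftrightarrow> (\<forall>x\<in>U. star_at U f x)"

definition centres :: "('a \<Rightarrow> 'a) \<Rightarrow> 'a set" where
  "centres f = {x \<in> V. f x = x}"

definition leaves :: "('a \<Rightarrow> 'a) \<Rightarrow> 'a \<Rightarrow> 'a set" where
  "leaves f v = {x \<in> V. x \<noteq> v \<and> f x = v}"

lemma finite_leaves [simp]: "finite (leaves f v)"
  using finV by (simp add: leaves_def)

lemma finite_centres [simp]: "finite (centres f)"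
  using finV by (simp add: centres_def)

lemma leaves_subset_N: "star_on V f \<Longrightarrow> leaves f v \<subseteq> N v"
  by (auto simp: star_on_def leaves_def)

lemma leaves_nonempty: "star_on V f \<Longrightarrow> v \<in> centres f \<Longrightarrow> 1 \<le> card (leaves f v)"
  using card_gt_0_iff[of "leaves f v"] finite_leaves[of f v]
  by (fastforce simp: star_on_def centres_def leaves_def)

text \<open>If \<open>u\<close> is a centre, \<open>w\<close> becomes its leaf. If \<open>u\<close>
  is a leaf, it either leaves a star that keeps another leaf and becomes the centre of
  \<open>w\<close>, or its star is a single edge and is recentred at \<open>u\<close>.\<close>

lemma star_on_extend:
  assumes "star_on U f" "u \<in> U" "w \<notin> U" "E u w"
  shows "\<exists>g. star_on (insert w U) g"
proof -
  have f: "\<And>x. x \<in> U \<Longrightarrow> star_at U f x"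
    using assms(1) by (simp add: star_on_def)
  have "u \<noteq> w" using assms by auto
  consider "f u = u" | "f u \<noteq> u" "\<exists>y\<in>U. y \<noteq> f u \<and> y \<noteq> u \<and> f y = f u"
    | "f u \<noteq> u" "\<forall>y\<in>U. f y = f u \<longrightarrow> y = f u \<or> y = u" by blast
  then show ?thesis
  proof cases
    case 1
    have "star_on (insert w U) (f(w := u))"
      unfolding star_on_def
    proof
      fix x assume "x \<in> insert w U"
      then consider "x = w" | "x \<in> U" "x \<noteq> w" using assms by auto
      then show "star_at (insert w U) (f(w := u)) x"
      proof cases
        case 1
        then show ?thesis using \<open>f u = u\<close> \<open>u \<noteq> w\<close> assms by auto
      next
        case 2
        have "f x \<noteq> w" using f[OF 2(1)] assms(3) by auto
        moreover have "\<exists>y\<in>insert w U. y \<noteq> x \<and> (f(w := u)) y = x" if fx: "f x = x"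
        proof -
          obtain y where "y \<in> U" "y \<noteq> x" "f y = x" using f[OF 2(1)] fx by blast
          then show ?thesis using assms(3) by (intro bexI[of _ y]) auto
        qed
        ultimately show ?thesis using f[OF 2(1)] 2 by simp
      qed
    qed
    then show ?thesis by blast
  next
    case 2
    let ?g = "f(u := u, w := u)"
    have "star_on (insert w U) ?g"
      unfolding star_on_def
    proof
      fix x assume "x \<in> insert w U"
      then consider "x = w" | "x = u" | "x \<in> U" "x \<noteq> w" "x \<noteq> u" using assms by auto
      then show "star_at (insert w U) ?g x"
      proof cases
        case 1
        then show ?thesis using \<open>u \<noteq> w\<close> assms by auto
      next
        case 2
        then show ?thesis using \<open>u \<noteq> w\<close> assms by (auto intro!: bexI[of _ w])
      next
        case 3
        have "f x \<noteq> w" using f[OF 3(1)] assms(3) by auto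
        moreover have "f x \<noteq> u" using f[OF 3(1)] 2 by auto
        moreover have "\<exists>y\<in>insert w U. y \<noteq> x \<and> ?g y = x" if fx: "f x = x"
        proof (cases "x = f u")
          case True
          then obtain y where "y \<in> U" "y \<noteq> f u" "y \<noteq> u" "f y = f u" using 2 by blast
          then show ?thesis using True assms(3) by (intro bexI[of _ y]) auto
        next
          case False
          obtain y where "y \<in> U" "y \<noteq> x" "f y = x" using f[OF 3(1)] fx by blast
          moreover from this have "y \<noteq> u" using False by auto
          ultimately show ?thesis using assms(3) by (intro bexI[of _ y]) auto
        qed
        ultimately show ?thesis using f[OF 3(1)] 3 by simp
      qed
    qed
    then show ?thesis by blast
  next
    case 3
    let ?v = "f u"
    let ?g = "f(?v := u, u := u, w := u)"
    have v: "?v \<in> U" "f ?v = ?v" "E ?v u" "?v \<noteq> w" using f[OF assms(2)] 3 assms(3) by auto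
    have "star_on (insert w U) ?g"
      unfolding star_on_def
    proof
      fix x assume "x \<in> insert w U"
      then consider "x = w" | "x = u" | "x = ?v" | "x \<in> U" "x \<noteq> w" "x \<noteq> u" "x \<noteq> ?v"
        using assms by auto
      then show "star_at (insert w U) ?g x"
      proof cases
        case 1
        then show ?thesis using \<open>u \<noteq> w\<close> assms by auto
      next
        case 2
        then show ?thesis using \<open>u \<noteq> w\<close> assms by (auto intro!: bexI[of _ w])
      next
        case 3
        then show ?thesis using v E_sym \<open>u \<noteq> w\<close> assms by auto
      next
        case 4
        have "f x \<noteq> w" using f[OF 4(1)] assms(3) by auto
        moreover have "f x \<noteq> u" using f[OF 4(1)] 3 by auto
        moreover have "f x \<noteq> ?v" using 4 3 by auto
        moreover have "\<exists>y\<in>insert w U. y \<noteq> x \<and> ?g y = x" if fx: "f x = x"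
        proof -
          obtain y where "y \<in> U" "y \<noteq> x" "f y = x" using f[OF 4(1)] fx by blast
          moreover from this have "y \<noteq> u" "y \<noteq> ?v" using 4 v by auto
          ultimately show ?thesis using assms(3) by (intro bexI[of _ y]) auto
        qed
        ultimately show ?thesis using f[OF 4(1)] 4 by simp
      qed
    qed
    then show ?thesis by blast
  qed
qed

text \<open>A single edge is a star, and by \<open>star_on_extend\<close> a maximal vertex set with
  a star partition is closed under adjacency.\<close>

lemma star_exists:
  assumes "cset V" "2 \<le> card V"
  shows "\<exists>f. star_on V f"
proof -
  define \<U> where "\<U> = {U. U \<subseteq> V \<and> U \<noteq> {} \<and> (\<exists>f. star_on U f)}"
  have "V \<noteq> {}" using assms by auto
  then obtain x where x: "x \<in> V" by blast
  have "\<exists>y. E x y"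
  proof (rule ccontr)
    assume "\<not> ?thesis"
    then have "V \<subseteq> {x}" by (intro cset_subset[OF assms(1) x]) auto
    then have "card V \<le> card {x}" by (intro card_mono) auto
    then show False using assms by simp
  qed
  then obtain y where y: "E x y" by blast
  have "star_on {x, y} (\<lambda>_. x)" using y E_irrefl by (auto simp: star_on_def)
  then have "{x, y} \<in> \<U>" using x y E_dom2 by (auto simp: \<U>_def)
  moreover have "finite \<U>"
    by (rule finite_subset[of _ "Pow V"]) (use finV in \<open>auto simp: \<U>_def\<close>)
  ultimately obtain U where U: "U \<in> \<U>" and max: "\<forall>W\<in>\<U>. U \<subseteq> W \<longrightarrow> U = W"
    using finite_has_maximal[of \<U>] by blast
  obtain f u where f: "star_on U f" and u: "u \<in> U" "U \<subseteq> V" using U by (auto simp: \<U>_def)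
  have "V \<subseteq> U"
  proof (rule cset_subset[OF assms(1)])
    show "u \<in> V" "u \<in> U" using u by auto
    fix s w assume s: "s \<in> U" "w \<in> V" "E s w"
    show "w \<in> U"
    proof (rule ccontr)
      assume "w \<notin> U"
      then have "insert w U \<in> \<U>" using star_on_extend[OF f s(1) _ s(3)] s u by (auto simp: \<U>_def)
      then show False using max \<open>w \<notin> U\<close> by blast
    qed
  qed
  then show ?thesis using f u by auto
qed

text \<open>
  A maximal independent set meets the star at \<open>v\<close> in one vertex if it contains \<open>v\<close>, and in at most
  its leaves otherwise.
\<close>

lemma star_bound:
  assumes f: "star_on V f" and B: "B \<subseteq> centres f" "indep B"
  shows "\<exists>S. ids S \<and>
    int (card S) + (\<Sum>v\<in>B. int (card (leaves f v)) - 1) + int (card (centres f)) \<le> int (card V)"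
proof -
  obtain S where S: "B \<subseteq> S" "ids S" using ids_extend[OF B(2)] B(1) by (auto simp: centres_def)
  define st where "st = (\<lambda>v. {x \<in> V. f x = v})"
  have part: "card T = (\<Sum>v\<in>centres f. card (T \<inter> st v))" if "T \<subseteq> V" for T
  proof -
    have "T = (\<Union>v\<in>centres f. T \<inter> st v)"
      using that f by (auto simp: st_def centres_def star_on_def)
    moreover have "card (\<Union>v\<in>centres f. T \<inter> st v) = (\<Sum>v\<in>centres f. card (T \<inter> st v))"
      by (rule card_UN_disjoint) (use finV in \<open>auto simp: st_def\<close>)
    ultimately show ?thesis by simp
  qed
  have st: "st v = insert v (leaves f v)" "v \<notin> leaves f v" if "v \<in> centres f" for v
    using that by (auto simp: st_def leaves_def centres_def)
  have SV: "S \<subseteq> V" "indep S" using S by (auto simp: ids_def)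
  have each: "int (card (S \<inter> st v)) + (if v \<in> B then int (card (leaves f v)) - 1 else 0) + 1
      \<le> int (card (V \<inter> st v))" if v: "v \<in> centres f" for v
  proof -
    have "V \<inter> st v = st v" by (auto simp: st_def)
    then have cV: "card (V \<inter> st v) = Suc (card (leaves f v))" using st[OF v] by simp
    show ?thesis
    proof (cases "v \<in> S")
      case True
      have "S \<inter> st v \<subseteq> {v}"
        using True SV(2) leaves_subset_N[OF f, of v] st[OF v] by (auto simp: indep_def)
      then have "card (S \<inter> st v) \<le> card {v}" by (rule card_mono[rotated]) simp
      then show ?thesis using cV leaves_nonempty[OF f v] by auto
    next
      case False
      then have "S \<inter> st v \<subseteq> leaves f v" using st[OF v] by auto
      then have "card (S \<inter> st v) \<le> card (leaves f v)" by (rule card_mono[rotated]) simp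
      then show ?thesis using cV False S(1) by auto
    qed
  qed
  have "(\<Sum>v\<in>centres f. int (card (S \<inter> st v)) + (if v \<in> B then int (card (leaves f v)) - 1 else 0) + 1)
      \<le> (\<Sum>v\<in>centres f. int (card (V \<inter> st v)))"
    by (rule sum_mono) (rule each)
  moreover have "(\<Sum>v\<in>centres f. if v \<in> B then int (card (leaves f v)) - 1 else 0) =
      (\<Sum>v\<in>B. int (card (leaves f v)) - 1)"
    using B(1) by (simp add: sum.If_cases Int_absorb1)
  ultimately have "int (card S) + (\<Sum>v\<in>B. int (card (leaves f v)) - 1) + int (card (centres f)) \<le> int (card V)"
    using part[OF SV(1)] part[of V] by (simp add: sum.distrib)
  then show ?thesis using S by blast
qed

end

context dgraph
begin

text \<open>
  Among the components of the graph of centres, exactly the bad ones violate the weighted bound on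
  independent sets.
\<close>

definition bad :: "('a \<Rightarrow> 'a) \<Rightarrow> 'a set \<Rightarrow> bool" where
  "bad f C \<longleftrightarrow> C \<subseteq> centres f \<and> (\<exists>a b. piece a b C \<and> (\<forall>u\<in>C. card (leaves f u) = b))"

lemma star_degree:
  assumes "star_on V f" "v \<in> centres f"
  shows "card (leaves f v) + card (N v \<inter> centres f) \<le> D"
proof -
  have "leaves f v \<inter> (N v \<inter> centres f) = {}" by (auto simp: leaves_def centres_def)
  then have "card (leaves f v) + card (N v \<inter> centres f) = card (leaves f v \<union> (N v \<inter> centres f))"
    by (simp add: card_Un_disjoint)
  also have "\<dots> \<le> card (N v)"
    by (rule card_mono) (use leaves_subset_N[OF assms(1)] in auto)
  finally show ?thesis using deg_le[of v] assms(2) by (simp add: centres_def)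
qed

lemma sum_leaves:
  assumes "star_on V f"
  shows "(\<Sum>v\<in>centres f. int (card (leaves f v))) = int (card V) - int (card (centres f))"
proof -
  have "V = centres f \<union> (\<Union>v\<in>centres f. leaves f v)"
    using assms by (auto simp: centres_def leaves_def star_on_def)
  then have "card V = card (centres f \<union> (\<Union>v\<in>centres f. leaves f v))" by simp
  also have "\<dots> = card (centres f) + card (\<Union>v\<in>centres f. leaves f v)"
    by (rule card_Un_disjoint) (auto simp: centres_def leaves_def finV)
  also have "card (\<Union>v\<in>centres f. leaves f v) = (\<Sum>v\<in>centres f. card (leaves f v))"
    by (rule card_UN_disjoint) (auto simp: leaves_def finV)
  finally show ?thesis by simp
qed

lemma no_bad_bound:
  assumes f: "star_on V f" and nobad: "\<And>C. \<not> bad f C"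
  shows "\<exists>S. ids S \<and> (if D = 5 then 9 * card S \<le> 5 * card V
    else (D\<^sup>2 div 4 + D) * card S \<le> D\<^sup>2 div 4 * card V)"
proof -
  let ?m = "\<lambda>v. card (leaves f v)"
  have X: "centres f \<subseteq> V" "\<And>v. v \<in> centres f \<Longrightarrow> 1 \<le> ?m v \<and> ?m v + card (N v \<inter> centres f) \<le> D"
    using leaves_nonempty[OF f] star_degree[OF f] by (auto simp: centres_def)
  have nb: "\<exists>u\<in>C. ?m u \<noteq> b" if "C \<subseteq> centres f" "piece a b C" for C a b
  proof (rule ccontr)
    assume "\<not> ?thesis"
    then have "\<forall>u\<in>C. ?m u = b" by simp
    then have "bad f C" using that unfolding bad_def by (intro conjI exI)
    then show False using nobad by simp
  qed
  show ?thesis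
  proof (cases "D = 5")
    case True
    have "\<exists>B\<subseteq>centres f. indep B \<and>
        (\<Sum>v\<in>centres f. 4 * int (?m v) - 5) \<le> 9 * (\<Sum>v\<in>B. int (?m v) - 1)"
      by (rule weighted_indep_5[OF True X]) (assumption | rule nb)+
    then obtain B where B: "B \<subseteq> centres f" "indep B"
        "(\<Sum>v\<in>centres f. 4 * int (?m v) - 5) \<le> 9 * (\<Sum>v\<in>B. int (?m v) - 1)"
      by blast
    obtain S where S: "ids S" "int (card S) + (\<Sum>v\<in>B. int (?m v) - 1) + int (card (centres f)) \<le> int (card V)"
      using star_bound[OF f B(1,2)] by blast
    define w where "w = (\<Sum>v\<in>B. int (?m v) - 1)"
    have "(\<Sum>v\<in>centres f. 4 * int (?m v) - 5) = 4 * (int (card V) - int (card (centres f))) - 5 * int (card (centres f))"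
      using sum_leaves[OF f] by (simp add: sum_subtractf flip: sum_distrib_left)
    then have "4 * (int (card V) - int (card (centres f))) - 5 * int (card (centres f)) \<le> 9 * w"
      using B(3) by (simp only: w_def)
    then have "9 * int (card S) \<le> 5 * int (card V)" using S(2)[folded w_def] by (simp add: algebra_simps)
    then show ?thesis using S True by (intro exI[of _ S]) auto
  next
    case False
    have "\<exists>B\<subseteq>centres f. indep B \<and>
        (\<Sum>v\<in>centres f. int D * int (?m v) - int (D\<^sup>2 div 4)) \<le>
         (int (D\<^sup>2 div 4) + int D) * (\<Sum>v\<in>B. int (?m v) - 1)"
      by (rule weighted_indep[OF False X]) (assumption | rule nb)+
    then obtain B where B: "B \<subseteq> centres f" "indep B"
        "(\<Sum>v\<in>centres f. int D * int (?m v) - int (D\<^sup>2 div 4)) \<le>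
         (int (D\<^sup>2 div 4) + int D) * (\<Sum>v\<in>B. int (?m v) - 1)"
      by blast
    obtain S where S: "ids S" "int (card S) + (\<Sum>v\<in>B. int (?m v) - 1) + int (card (centres f)) \<le> int (card V)"
      using star_bound[OF f B(1,2)] by blast
    define c where "c = int (D\<^sup>2 div 4)"
    have c0: "0 \<le> c" by (simp add: c_def)
    have "(\<Sum>v\<in>centres f. int D * int (?m v) - c) =
        int D * (int (card V) - int (card (centres f))) - c * int (card (centres f))"
      using sum_leaves[OF f] by (simp add: sum_subtractf flip: sum_distrib_left)
    moreover have "(c + int D) * (int (card S) + (\<Sum>v\<in>B. int (?m v) - 1) + int (card (centres f)))
        \<le> (c + int D) * int (card V)"
      using S(2) c0 by (intro mult_left_mono) auto
    ultimately have "(c + int D) * int (card S) \<le> c * int (card V)"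
      using B(3) by (simp add: algebra_simps flip: c_def)
    then have "int ((D\<^sup>2 div 4 + D) * card S) \<le> int (D\<^sup>2 div 4 * card V)"
      by (simp add: c_def)
    then show ?thesis using S False by (intro exI[of _ S]) (simp only: of_nat_le_iff if_False simp_thms)
  qed
qed

section \<open>Minimising the number of tight pieces\<close>

lemma piece_params:
  assumes "piece a b C"
  shows "2 \<le> a" "2 \<le> b"
proof -
  have "a + b = D" "a * b = (a + b)\<^sup>2 div 4" using assms by (auto simp: piece_def)
  then show "2 \<le> a" "2 \<le> b" using balanced_product[of a b] D4 by auto
qed

text \<open>The \<open>a\<close> neighbours inside \<open>C\<close> and the \<open>b\<close> leaves
  already make up the largest possible degree \<open>a + b = D\<close>, so no room is left for any
  other neighbour.\<close>

lemma bad_props: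
  assumes f: "star_on V f" and C: "bad f C"
  obtains a b where "piece a b C" "2 \<le> a" "2 \<le> b" "C \<subseteq> centres f" "C \<noteq> {}" "cset C"
    "\<And>u. u \<in> C \<Longrightarrow> card (N u \<inter> C) = a"
    "\<And>u. u \<in> C \<Longrightarrow> card (leaves f u) = b"
    "\<And>u. u \<in> C \<Longrightarrow> N u - C = leaves f u"
    "\<And>u. u \<in> C \<Longrightarrow> card (N u) = D"
proof -
  obtain a b where ab: "piece a b C" "\<And>u. u \<in> C \<Longrightarrow> card (leaves f u) = b" and CJ: "C \<subseteq> centres f"
    using C by (auto simp: bad_def)
  have p: "a + b = D" "\<And>u. u \<in> C \<Longrightarrow> card (N u \<inter> C) = a" "C \<subseteq> V" "C \<noteq> {}" "cset C"
    using ab(1) by (auto simp: piece_def)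
  have eq: "N u = (N u \<inter> C) \<union> leaves f u" "card (N u) = D" if u: "u \<in> C" for u
  proof -
    have dis: "(N u \<inter> C) \<inter> leaves f u = {}" using CJ by (auto simp: leaves_def centres_def)
    have sub: "(N u \<inter> C) \<union> leaves f u \<subseteq> N u" using leaves_subset_N[OF f] by auto
    have cD: "card ((N u \<inter> C) \<union> leaves f u) = D"
      using p ab(2) u dis by (simp add: card_Un_disjoint)
    have "card (N u) \<le> D" using deg_le p(3) u by auto
    then have "(N u \<inter> C) \<union> leaves f u = N u"
      using sub cD by (intro card_seteq) auto
    then show "N u = (N u \<inter> C) \<union> leaves f u" "card (N u) = D" using cD by auto
  qed
  have "N u - C = leaves f u" if "u \<in> C" for u
  proof -
    have "leaves f u \<inter> C = {}" using CJ by (auto simp: leaves_def centres_def)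
    then show ?thesis using eq(1)[OF that] by blast
  qed
  then show ?thesis using that[of a b] ab p CJ eq(2) piece_params[OF ab(1)] by blast
qed

lemma bad_leaves:
  assumes "star_on V f" "bad f C" "u \<in> C"
  shows "N u - C = leaves f u"
  by (rule bad_props[OF assms(1,2)]) (use assms(3) in simp)

lemma bad_centre_nbr:
  assumes "star_on V f" "bad f C" "u \<in> C" "E u w" "w \<in> centres f"
  shows "w \<in> C"
proof (rule ccontr)
  assume "w \<notin> C"
  have "w \<in> N u - C" using assms(4) \<open>w \<notin> C\<close> by simp
  then have "w \<in> leaves f u" using bad_leaves[OF assms(1-3)] by blast
  moreover have "u \<in> centres f" using assms(2,3) by (auto simp: bad_def)
  ultimately show False using assms(5) by (auto simp: leaves_def centres_def)
qed

lemma bad_leaf: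
  assumes "star_on V f" "bad f C" "u \<in> C" "E u w" "w \<notin> C"
  shows "f w = u" "w \<noteq> u" "w \<notin> centres f"
proof -
  have "w \<in> N u - C" using assms(4,5) by simp
  then have "w \<in> leaves f u" using bad_leaves[OF assms(1-3)] by blast
  moreover have "u \<in> centres f" using assms(2,3) by (auto simp: bad_def)
  ultimately show "f w = u" "w \<noteq> u" "w \<notin> centres f" by (auto simp: leaves_def centres_def)
qed

lemma bad_unique:
  assumes "star_on V f" "bad f C" "bad f C'" "x \<in> C" "x \<in> C'"
  shows "C = C'"
proof -
  have "A \<subseteq> B" if "bad f A" "bad f B" "x \<in> A" "x \<in> B" for A B
  proof -
    have "cset A" "A \<subseteq> centres f" using that(1) by (auto simp: bad_def piece_def)
    then show ?thesis
      using cset_subset[of A x B] that bad_centre_nbr[OF assms(1) that(2)] by blast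
  qed
  then show ?thesis using assms by blast
qed

lemma bad_transfer:
  assumes "bad g C" "\<And>u. u \<in> C \<Longrightarrow> u \<in> centres f \<and> leaves f u = leaves g u"
  shows "bad f C"
  using assms unfolding bad_def by fastforce

definition Bad :: "('a \<Rightarrow> 'a) \<Rightarrow> 'a set set" where
  "Bad f = {C. bad f C}"

definition minimal :: "('a \<Rightarrow> 'a) \<Rightarrow> bool" where
  "minimal f \<longleftrightarrow> star_on V f \<and> (\<forall>g. star_on V g \<longrightarrow> card (Bad f) \<le> card (Bad g))"

lemma finite_Bad [simp]: "finite (Bad f)"
  by (rule finite_subset[of _ "Pow V"]) (use finV in \<open>auto simp: Bad_def bad_def centres_def\<close>)

lemma minimal_star: "minimal f \<Longrightarrow> star_on V f"
  by (simp add: minimal_def)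

lemma minimal_subset:
  assumes "minimal f" "star_on V g" "\<And>C. bad g C \<Longrightarrow> bad f C"
  shows "minimal g" "Bad g = Bad f"
proof -
  have sub: "Bad g \<subseteq> Bad f" using assms(3) by (auto simp: Bad_def)
  then have "card (Bad g) \<le> card (Bad f)" by (rule card_mono[rotated]) simp
  then show "minimal g" using assms(1,2) le_trans unfolding minimal_def by blast
  have "card (Bad f) \<le> card (Bad g)" using assms by (auto simp: minimal_def)
  then show "Bad g = Bad f" using sub by (intro card_seteq) auto
qed

text \<open>The contradiction that ends the local modifications: one bad piece is destroyed and none
  is created.\<close>

lemma minimal_drop:
  assumes "minimal f" "star_on V g" "bad f C" "\<not> bad g C" "\<And>C. bad g C \<Longrightarrow> bad f C"
  shows False
  using minimal_subset(2)[OF assms(1,2,5)] assms(3,4) by (auto simp: Bad_def)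

text \<open>By \<open>bad_unique\<close> at most one bad piece contains \<open>z\<close>, so losing
  \<open>C\<close> and gaining only pieces through \<open>z\<close> does not raise the count;
  minimality then forces exactly such a gain.\<close>

lemma minimal_shift:
  assumes "minimal f" "star_on V g" "bad f C" "\<not> bad g C" "\<And>C. bad g C \<Longrightarrow> bad f C \<or> z \<in> C"
  obtains C' where "bad g C'" "z \<in> C'" "minimal g"
proof -
  have "\<exists>C'. bad g C' \<and> z \<in> C'" using minimal_drop[OF assms(1-4)] assms(5) by blast
  then obtain C' where C': "bad g C'" "z \<in> C'" by blast
  have "Bad g \<subseteq> insert C' (Bad f - {C})"
    using assms(4,5) C' bad_unique[OF assms(2)] by (auto simp: Bad_def)
  then have "card (Bad g) \<le> card (insert C' (Bad f - {C}))" by (rule card_mono[rotated]) simp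
  also have "\<dots> \<le> Suc (card (Bad f - {C}))" by (rule card_insert_le_m1) auto
  also have "\<dots> = card (Bad f)"
    by (rule card_Suc_Diff1) (use assms(3) in \<open>auto simp: Bad_def[THEN eqset_imp_iff]\<close>)
  finally have "minimal g" using assms(1,2) le_trans unfolding minimal_def by blast
  then show ?thesis using that C' by blast
qed

text \<open>
  Handing over a leaf of a bad piece to an adjacent centre \<open>z\<close> repairs the bad piece, and at most the
  piece of \<open>z\<close> becomes bad. A region is a family of pieces among which the badness can be moved freely
  in a star partition with the minimal number of bad pieces: for every \<open>C\<close> in the family some partition
  \<open>g\<close> with the same centres, differing from \<open>f\<close> only on the leaves of the family, has \<open>C\<close> as bad piece.
  A maximal region is the whole graph, which is then special.
\<close>

definition fringe :: "('a \<Rightarrow> 'a) \<Rightarrow> 'a set set \<Rightarrow> 'a set" where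
  "fringe f \<C> = {x \<in> V. f x \<noteq> x \<and> f x \<in> \<Union>\<C>}"

definition token :: "('a \<Rightarrow> 'a) \<Rightarrow> 'a set set \<Rightarrow> 'a set \<Rightarrow> ('a \<Rightarrow> 'a) \<Rightarrow> bool" where
  "token f \<C> C g \<longleftrightarrow> minimal g \<and> centres g = centres f \<and> bad g C \<and>
     (\<forall>x\<in>V. x \<notin> fringe f \<C> \<longrightarrow> g x = f x) \<and> (\<forall>x\<in>fringe f \<C>. g x \<in> \<Union>\<C>)"

text \<open>
  The pieces and their leaves form a tree: deleting a leaf \<open>w\<close> separates each of its neighbours \<open>z\<close>
  from the others. Edges between two leaves are only excluded later, so they are ignored here.
\<close>

definition cuts :: "'a set \<Rightarrow> 'a set \<Rightarrow> bool" where
  "cuts W F \<longleftrightarrow> (\<forall>w\<in>F. \<forall>z\<in>W. E w z \<longrightarrow> (\<exists>A\<subseteq>(W \<union> F) - {w}. N w \<inter> A \<inter> W = {z} \<and>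
     (\<forall>x\<in>A. \<forall>y\<in>W \<union> F. E x y \<and> (x \<in> W \<or> y \<in> W) \<longrightarrow> y \<in> insert w A)))"

definition region :: "('a \<Rightarrow> 'a) \<Rightarrow> 'a set set \<Rightarrow> bool" where
  "region f \<C> \<longleftrightarrow> minimal f \<and> \<C> \<noteq> {} \<and> (\<forall>C\<in>\<C>. \<exists>g. token f \<C> C g) \<and> cuts (\<Union>\<C>) (fringe f \<C>)"

text \<open>A token only redistributes fringe vertices among the vertices of the pieces, so all
  tokens share one fringe.\<close>

lemma token_fringe:
  assumes "token f \<C> C g"
  shows "fringe g \<C> = fringe f \<C>"
proof -
  have g: "centres g = centres f" "\<And>x. x \<in> V \<Longrightarrow> x \<notin> fringe f \<C> \<Longrightarrow> g x = f x"
    "\<And>x. x \<in> fringe f \<C> \<Longrightarrow> g x \<in> \<Union>\<C>" using assms by (auto simp: token_def)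
  have "x \<in> fringe g \<C> \<longleftrightarrow> x \<in> fringe f \<C>" if "x \<in> V" for x
  proof (cases "x \<in> fringe f \<C>")
    case True
    then have "x \<notin> centres g" using g(1) by (auto simp: fringe_def centres_def)
    then show ?thesis using True g(3) that by (auto simp: fringe_def centres_def)
  next
    case False
    then show ?thesis using g(2)[OF that False] that by (auto simp: fringe_def)
  qed
  then show ?thesis by (auto simp: fringe_def)
qed

section \<open>Neighbourhoods in a region\<close>

lemma region_centres:
  assumes "region f \<C>"
  shows "\<Union>\<C> \<subseteq> centres f" "\<Union>\<C> \<inter> fringe f \<C> = {}"
proof -
  show "\<Union>\<C> \<subseteq> centres f"
  proof
    fix x assume "x \<in> \<Union>\<C>"
    then obtain C where "C \<in> \<C>" "x \<in> C" by blast
    then obtain g where "token f \<C> C g" using assms by (auto simp: region_def)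
    then have "bad g C" "centres g = centres f" by (auto simp: token_def)
    then show "x \<in> centres f" using \<open>x \<in> C\<close> by (auto simp: bad_def)
  qed
  then show "\<Union>\<C> \<inter> fringe f \<C> = {}" by (auto simp: centres_def fringe_def)
qed

text \<open>Under the token that makes \<open>C\<close> bad, every neighbour of \<open>u\<close>
  outside \<open>C\<close> is a leaf of \<open>u\<close>, and the fringe does not depend on the
  token.\<close>

lemma region_nbrs:
  assumes "region f \<C>" "C \<in> \<C>" "u \<in> C"
  shows "N u \<subseteq> C \<union> fringe f \<C>"
proof
  fix w assume w: "w \<in> N u"
  obtain g where g: "token f \<C> C g" using assms by (auto simp: region_def)
  show "w \<in> C \<union> fringe f \<C>"
  proof (cases "w \<in> C")
    case False
    have "star_on V g" "bad g C" using g minimal_star by (auto simp: token_def)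
    then have "g w = u" "w \<noteq> u" using bad_leaf[of g C u w] assms w False by auto
    then have "w \<in> fringe g \<C>" using assms w E_dom2 by (auto simp: fringe_def)
    then show ?thesis using token_fringe[OF g] by simp
  qed simp
qed

lemma region_leaf_unique:
  assumes "region f \<C>" "C \<in> \<C>" "u \<in> C" "u' \<in> C" "E u w" "E u' w" "w \<notin> C"
  shows "u = u'"
proof -
  obtain g where g: "token f \<C> C g" using assms by (auto simp: region_def)
  then have "star_on V g" "bad g C" using minimal_star by (auto simp: token_def)
  then show ?thesis using bad_leaf(1)[of g C u w] bad_leaf(1)[of g C u' w] assms(3-7) by simp
qed

lemma region_closed:
  assumes "region f \<C>" "C \<in> \<C>" "u \<in> C" "E u w" "w \<in> centres f"
  shows "w \<in> C"
  using region_nbrs[OF assms(1-3)] assms(4,5) by (auto simp: fringe_def centres_def)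

text \<open>A leaf of a bad piece has only its own centre as neighbour in the piece, so everything
  except this leaf can serve as the separated side.\<close>

lemma region_init:
  assumes "minimal f" "bad f C"
  shows "region f {C}"
proof -
  have f: "star_on V f" using assms minimal_star by blast
  have "token f {C} C f" using assms by (auto simp: token_def fringe_def)
  moreover have "cuts C (fringe f {C})"
    unfolding cuts_def
  proof (intro ballI impI)
    fix w z assume w: "w \<in> fringe f {C}" "z \<in> C" "E w z"
    have CJ: "C \<subseteq> centres f" using assms by (auto simp: bad_def)
    have wC: "w \<notin> C" using w CJ by (auto simp: fringe_def centres_def)
    have fw: "z' = f w" if "z' \<in> C" "E w z'" for z'
      using bad_leaf(1)[OF f assms(2) that(1) E_sym[OF that(2)] wC] by simp
    have zz: "z' = z" if "z' \<in> C" "E w z'" for z' using fw[OF that] fw[OF w(2,3)] by simp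
    have "N w \<inter> (C \<union> fringe f {C} - {w}) \<inter> C = {z}"
    proof (rule equalityI; rule subsetI)
      fix x assume "x \<in> N w \<inter> (C \<union> fringe f {C} - {w}) \<inter> C"
      then have "x \<in> C" "E w x" by auto
      then show "x \<in> {z}" using zz[of x] by simp
    next
      fix x assume "x \<in> {z}"
      then show "x \<in> N w \<inter> (C \<union> fringe f {C} - {w}) \<inter> C" using w(2,3) wC by auto
    qed
    then show "\<exists>A\<subseteq>C \<union> fringe f {C} - {w}. N w \<inter> A \<inter> C = {z} \<and>
      (\<forall>x\<in>A. \<forall>y\<in>C \<union> fringe f {C}. E x y \<and> (x \<in> C \<or> y \<in> C) \<longrightarrow> y \<in> insert w A)"
      by (intro exI[of _ "C \<union> fringe f {C} - {w}"]) auto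
  qed
  ultimately show ?thesis using assms by (auto simp: region_def)
qed

text \<open>The new part meets the old one only in the leaf \<open>wa\<close>, which it reaches from
  \<open>W'\<close> only through the edge at \<open>za\<close>, so the tree structure survives. Seen
  from \<open>wa\<close>, the side of \<open>za\<close> is the new part; a new leaf other than
  \<open>wa\<close> has a single neighbour in the pieces and needs no proper separation.\<close>

lemma cuts_attach:
  assumes old: "cuts W F" and W: "W \<inter> F = {}"
    and new: "W' \<inter> F' = {}" "W' \<inter> (W \<union> F) = {}" "F' \<inter> W = {}" "F' \<inter> F = {wa}" "za \<in> W'"
    and edge: "\<And>u x. u \<in> W' \<Longrightarrow> E u x \<Longrightarrow> x \<in> W \<union> F \<Longrightarrow> u = za \<and> x = wa"
      "\<And>x u. x \<in> F' \<Longrightarrow> u \<in> W \<Longrightarrow> E x u \<Longrightarrow> x = wa"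
    and leaf: "\<And>x u u'. x \<in> F' \<Longrightarrow> u \<in> W' \<Longrightarrow> u' \<in> W' \<Longrightarrow> E x u \<Longrightarrow> E x u' \<Longrightarrow> u = u'"
  shows "cuts (W' \<union> W) (F' \<union> F)"
  unfolding cuts_def
proof (intro ballI impI)
  fix w z assume w: "w \<in> F' \<union> F" "z \<in> W' \<union> W" "E w z"
  let ?U = "(W' \<union> W) \<union> (F' \<union> F)"
  have edge': "u = za \<and> x = wa" if "u \<in> W'" "E x u" "x \<in> W \<union> F" for u x
    using edge(1)[OF that(1)] that E_sym by blast
  show "\<exists>A\<subseteq>?U - {w}. N w \<inter> A \<inter> (W' \<union> W) = {z} \<and>
      (\<forall>x\<in>A. \<forall>y\<in>?U. E x y \<and> (x \<in> W' \<union> W \<or> y \<in> W' \<union> W) \<longrightarrow> y \<in> insert w A)"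
  proof (cases "w \<in> F")
    case False
    then have wF: "w \<in> F'" "w \<noteq> wa" using w new(4) by auto
    then have "z \<in> W'" using w edge(2) by blast
    have "N w \<inter> (?U - {w}) \<inter> (W' \<union> W) = {z}"
    proof
      show "N w \<inter> (?U - {w}) \<inter> (W' \<union> W) \<subseteq> {z}"
      proof
        fix x assume "x \<in> N w \<inter> (?U - {w}) \<inter> (W' \<union> W)"
        then have "E w x" "x \<in> W' \<or> x \<in> W" by auto
        then show "x \<in> {z}"
          using leaf[OF wF(1) _ \<open>z \<in> W'\<close> _ w(3), of x] edge(2)[OF wF(1), of x] wF(2) by blast
      qed
      show "{z} \<subseteq> N w \<inter> (?U - {w}) \<inter> (W' \<union> W)" using w E_irrefl by auto
    qed
    then show ?thesis by (intro exI[of _ "?U - {w}"]) auto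
  next
    case wF: True
    show ?thesis
    proof (cases "z \<in> W'")
      case True
      then have wz: "z = za" "w = wa" using edge'[OF True w(3) UnI2[OF wF]] by simp_all
      let ?A = "(W' \<union> F') - {wa}"
      have "N wa \<inter> ?A \<inter> (W' \<union> W) = {za}"
      proof (rule equalityI; rule subsetI)
        fix x assume "x \<in> N wa \<inter> ?A \<inter> (W' \<union> W)"
        then have "x \<in> W'" "E wa x" using new(3) by auto
        then show "x \<in> {za}" using edge'[of x wa] wF wz(2) by blast
      next
        fix x assume "x \<in> {za}"
        then have "x = za" by simp
        moreover have "E wa za" using w(3) wz by simp
        moreover have "za \<noteq> wa" using new(5,1,4) by blast
        ultimately show "x \<in> N wa \<inter> ?A \<inter> (W' \<union> W)" using new(5) by simp
      qed
      moreover have "y \<in> insert wa ?A"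
        if "x \<in> ?A" "y \<in> ?U" "E x y" "x \<in> W' \<union> W \<or> y \<in> W' \<union> W" for x y
      proof -
        have "x \<in> ?A" "x \<in> W' \<union> W \<or> y \<in> W' \<union> W" by (fact that)+
        then consider "x \<in> W'" | "x \<in> F'" "x \<noteq> wa" "y \<in> W' \<union> W" "x \<notin> W'"
          using new(3) by blast
        then show ?thesis
        proof cases
          case 1
          then show ?thesis using edge(1)[OF 1 that(3)] that(2) by blast
        next
          case 2
          then show ?thesis using edge(2)[OF 2(1) _ that(3)] by blast
        qed
      qed
      ultimately show ?thesis using wz new by (intro exI[of _ ?A]) auto
    next
      case False
      then have zW: "z \<in> W" using w by auto
      then obtain A where A: "A \<subseteq> W \<union> F - {w}" "N w \<inter> A \<inter> W = {z}"
        "\<And>x y. x \<in> A \<Longrightarrow> y \<in> W \<union> F \<Longrightarrow> E x y \<Longrightarrow> x \<in> W \<or> y \<in> W \<Longrightarrow> y \<in> insert w A"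
        using old wF w(3) unfolding cuts_def by meson
      \<comment> \<open>An old side that contains \<open>wa\<close> absorbs the whole new part,
        which is attached there; any other old side is unaffected.\<close>
      define A' where "A' = (if wa \<in> A then A \<union> W' \<union> F' else A)"
      have "w \<notin> W'" using wF new by auto
      have wA: "wa \<in> A \<Longrightarrow> w \<noteq> wa" using A(1) by auto
      have "w \<notin> F'" if "wa \<in> A" using wA[OF that] wF new(4) by auto
      then have sub: "A' \<subseteq> ?U - {w}" using A(1) \<open>w \<notin> W'\<close> by (auto simp: A'_def)
      moreover have "N w \<inter> A' \<inter> (W' \<union> W) = {z}"
      proof -
        have "\<not> E w x" if "x \<in> W'" "wa \<in> A" for x
          using edge'[OF that(1), of w] wF wA[OF that(2)] by blast
        moreover have "x \<notin> W" if "x \<in> F'" for x using that new by auto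
        moreover have "x \<notin> W'" if "x \<in> A" for x using that A(1) new by auto
        ultimately have "N w \<inter> A' \<inter> (W' \<union> W) = N w \<inter> A \<inter> W" by (auto simp: A'_def)
        then show ?thesis using A(2) by simp
      qed
      moreover have "y \<in> insert w A'"
        if h: "x \<in> A'" "y \<in> ?U" "E x y" "x \<in> W' \<union> W \<or> y \<in> W' \<union> W" for x y
      proof -
        have xy: "x \<in> A \<or> (wa \<in> A \<and> x \<in> W' \<union> F' \<and> x \<notin> A)" using h(1) by (auto simp: A'_def split: if_splits)
        then show ?thesis
        proof
          assume x: "x \<in> A"
          then have xU: "x \<in> W \<union> F" using A(1) by auto
          consider "y \<in> W" | "y \<in> F" "x \<in> W" | "y \<in> F'" "x \<in> W" | "y \<in> W'"
            using h(2,4) xU new by auto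
          then show ?thesis
          proof cases
            case 1
            then show ?thesis using A(3)[OF x _ h(3)] by (auto simp: A'_def)
          next
            case 2
            then show ?thesis using A(3)[OF x _ h(3)] by (auto simp: A'_def)
          next
            case 3
            then have "y = wa" using edge(2)[OF 3] E_sym h(3) by blast
            then have "y \<in> F" using new(4) by auto
            then show ?thesis using A(3)[OF x _ h(3)] 3 by (auto simp: A'_def)
          next
            case 4
            then have "x = wa" using edge'[OF 4 h(3) xU] by simp
            then show ?thesis using x 4 by (auto simp: A'_def)
          qed
        next
          assume x: "wa \<in> A \<and> x \<in> W' \<union> F' \<and> x \<notin> A"
          then have "x \<noteq> wa" by auto
          consider "x \<in> W'" "y \<in> W \<union> F" | "x \<in> F'" "y \<in> W" | "y \<in> W' \<union> F'" | "x \<in> F'" "y \<in> F"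
            using h(2) x by auto
          then show ?thesis
          proof cases
            case 1
            then have "y = wa" using edge(1)[OF 1(1) h(3) 1(2)] by simp
            then show ?thesis using x by (auto simp: A'_def)
          next
            case 2
            then show ?thesis using edge(2)[OF 2 h(3)] \<open>x \<noteq> wa\<close> by simp
          next
            case 3
            then show ?thesis using x by (auto simp: A'_def)
          next
            case 4
            then show ?thesis using h(4) new W by auto
          qed
        qed
      qed
      ultimately show ?thesis by (intro exI[of _ A']) auto
    qed
  qed
qed

section \<open>Extending a region by a further piece\<close>

lemma star_leaf: "star_on U f \<Longrightarrow> x \<in> U \<Longrightarrow> f x = x \<Longrightarrow> \<exists>y\<in>U. y \<noteq> x \<and> f y = x"
  by (simp add: star_on_def)

text \<open>In the token for the piece containing \<open>f w\<close>, the vertex \<open>w\<close> is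
  a leaf of \<open>f w\<close>. Giving it to \<open>z\<close> destroys that bad piece, so
  \<open>minimal_shift\<close> produces a bad piece through \<open>z\<close>, which is attached to
  the region at \<open>w\<close>.\<close>

lemma region_extend:
  assumes reg: "region f \<C>" and w: "w \<in> fringe f \<C>" and z: "z \<in> centres f" "z \<notin> \<Union>\<C>" "E w z"
  shows "\<exists>f' C'. region f' (insert C' \<C>) \<and> z \<in> C'"
proof -
  define v where "v = f w"
  have v: "v \<in> \<Union>\<C>" "E v w" "v \<noteq> w"
    using w minimal_star[of f] reg by (auto simp: fringe_def v_def region_def star_on_def)
  then obtain C where C: "C \<in> \<C>" "v \<in> C" by blast
  obtain g where g: "token f \<C> C g" using reg C by (auto simp: region_def)
  then have g': "minimal g" "centres g = centres f" "bad g C" by (auto simp: token_def)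
  have sg: "star_on V g" using g'(1) minimal_star by blast
  have CJ: "\<Union>\<C> \<subseteq> centres f" "\<Union>\<C> \<inter> fringe f \<C> = {}" using region_centres[OF reg] by auto
  have wJ: "w \<notin> centres f" "w \<in> V" using w by (auto simp: fringe_def centres_def)
  have wC: "w \<notin> C" using C CJ wJ by auto
  have gw: "g w = v" using bad_leaf(1)[OF sg g'(3) C(2) v(2) wC] .
  have vV: "v \<in> V" "g v = v" using C CJ g'(2) by (auto simp: centres_def)
  have zV: "z \<in> V" "g z = z" "z \<noteq> w" "z \<noteq> v" using z g'(2) v wJ by (auto simp: centres_def)
  define h where "h = g(w := z)"
  obtain a b where Cab: "piece a b C" "2 \<le> b" "\<And>u. u \<in> C \<Longrightarrow> card (leaves g u) = b"
    using bad_props[OF sg g'(3)] by metis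
  have hstar: "star_on V h"
    unfolding star_on_def
  proof
    fix x assume x: "x \<in> V"
    have gx: "g x \<in> V" "g (g x) = g x" "g x \<noteq> x \<longrightarrow> E (g x) x" using sg x by (auto simp: star_on_def)
    have "g x \<noteq> w" using gx(2) gw v(3) by auto
    have "\<exists>y\<in>V. y \<noteq> x \<and> h y = x" if hx: "h x = x"
    proof (cases "x = v")
      case True
      \<comment> \<open>\<open>v\<close> remains the centre of a star because vertices of bad pieces
        have \<open>b \<ge> 2\<close> leaves.\<close>
      have "leaves g v \<noteq> {w}" using Cab C by (auto dest!: Cab(3))
      moreover have "w \<in> leaves g v" using gw v wJ by (auto simp: leaves_def)
      ultimately obtain y where "y \<in> leaves g v" "y \<noteq> w" by blast
      then show ?thesis using True by (intro bexI[of _ y]) (auto simp: leaves_def h_def)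
    next
      case False
      have "x \<noteq> w" using hx zV by (auto simp: h_def)
      then have "g x = x" using hx by (simp add: h_def)
      then obtain y where "y \<in> V" "y \<noteq> x" "g y = x"
        using star_leaf[OF sg x] by blast
      moreover from this have "y \<noteq> w" using gw False by auto
      ultimately show ?thesis by (intro bexI[of _ y]) (auto simp: h_def)
    qed
    then show "star_at V h x"
      using gx \<open>g x \<noteq> w\<close> zV E_sym[OF z(3)] by (auto simp: h_def)
  qed
  have hJ: "centres h = centres g" using gw v(3) zV by (auto simp: centres_def h_def)
  have hL: "leaves h u = leaves g u" if "u \<noteq> v" "u \<noteq> z" for u
    using that gw by (auto simp: leaves_def h_def)
  \<comment> \<open>\<open>v\<close> is still adjacent to the non-centre \<open>w\<close>, which is
    no longer its leaf; this is impossible in a bad piece.\<close>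
  have vbad: "v \<notin> C'" if "bad h C'" for C'
  proof
    assume "v \<in> C'"
    moreover have "w \<notin> C'" using that wJ hJ g'(2) by (auto simp: bad_def)
    ultimately have "h w = v" using bad_leaf(1)[OF hstar that _ v(2)] by blast
    then show False using zV by (simp add: h_def)
  qed
  have old: "bad g C' \<or> z \<in> C'" if "bad h C'" for C'
  proof (cases "z \<in> C'")
    case False
    have "bad g C'"
    proof (rule bad_transfer[OF that])
      fix u assume u: "u \<in> C'"
      then have "u \<in> centres g" using that hJ by (auto simp: bad_def)
      moreover have "u \<noteq> v" "u \<noteq> z" using u vbad[OF that] False by auto
      ultimately show "u \<in> centres g \<and> leaves g u = leaves h u" using hL by simp
    qed
    then show ?thesis by simp
  qed simp
  have "\<not> bad h C" using vbad C by blast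
  then obtain C' where C': "bad h C'" "z \<in> C'" "minimal h"
    using minimal_shift[OF g'(1) hstar g'(3) _ old] by blast
  have C'J: "C' \<subseteq> centres f" using C'(1) hJ g'(2) by (auto simp: bad_def)
  have dis: "C' \<inter> \<Union>\<C> = {}"
  proof (rule ccontr)
    assume "C' \<inter> \<Union>\<C> \<noteq> {}"
    then obtain u C2 where u: "u \<in> C'" "C2 \<in> \<C>" "u \<in> C2" by blast
    have "cset C'" using C'(1) by (auto simp: bad_def piece_def)
    then have "C' \<subseteq> C2"
      by (rule cset_subset[OF _ u(1,3)]) (use region_closed[OF reg u(2)] C'J in blast)
    then show False using C'(2) u(2) z(2) by blast
  qed
  have frh: "x \<in> fringe h (insert C' \<C>) \<longleftrightarrow> x \<in> fringe f \<C> \<or> x \<in> V \<and> h x \<noteq> x \<and> h x \<in> C'" for x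
  proof -
    have "x \<in> fringe f \<C> \<longleftrightarrow> x \<in> fringe g \<C>" using token_fringe[OF g] by simp
    then show ?thesis
      using C'(2) w zV(3) wJ(2) by (cases "x = w") (auto simp: fringe_def h_def)
  qed
  define F' where "F' = {x \<in> V. h x \<noteq> x \<and> h x \<in> C'}"
  have frh': "fringe h (insert C' \<C>) = F' \<union> fringe f \<C>" using frh by (auto simp: F'_def)
  have wF': "w \<in> F'" using zV wJ C' by (auto simp: F'_def h_def)
  \<comment> \<open>Under \<open>g\<close> the old fringe belongs to old pieces, and
    \<open>h\<close> moves only \<open>w\<close> over to \<open>C'\<close>.\<close>
  have F'F: "x = w" if "x \<in> F'" "x \<in> fringe f \<C>" for x
  proof (rule ccontr)
    assume "x \<noteq> w"
    then have "g x \<in> C'" using that by (auto simp: F'_def h_def)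
    moreover have "g x \<in> \<Union>\<C>" using that g by (auto simp: token_def)
    ultimately show False using dis by blast
  qed
  have F'J: "x \<notin> centres f" if "x \<in> F'" for x
    using that hJ g'(2) by (auto simp: F'_def centres_def)
  have C'N: "x \<in> C' \<or> (x \<in> F' \<and> h x = u)" if "u \<in> C'" "E u x" for u x
  proof (cases "x \<in> C'")
    case False
    then show ?thesis
      using bad_leaf[OF hstar C'(1) that False] that E_dom2 by (auto simp: F'_def)
  qed simp
  have "cuts (C' \<union> \<Union>\<C>) (F' \<union> fringe f \<C>)"
  proof (rule cuts_attach[where wa=w and za=z])
    show "cuts (\<Union>\<C>) (fringe f \<C>)" using reg by (simp add: region_def)
    show "\<Union>\<C> \<inter> fringe f \<C> = {}" by (rule CJ)
    show "C' \<inter> F' = {}" using C'J F'J by blast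
    show "C' \<inter> (\<Union>\<C> \<union> fringe f \<C>) = {}"
      using dis C'J by (auto simp: fringe_def centres_def)
    show "F' \<inter> \<Union>\<C> = {}" using F'J CJ(1) by blast
    show "F' \<inter> fringe f \<C> = {w}"
    proof (rule equalityI; rule subsetI)
      fix x assume "x \<in> F' \<inter> fringe f \<C>"
      then show "x \<in> {w}" using F'F[of x] by simp
    next
      fix x assume "x \<in> {w}"
      then show "x \<in> F' \<inter> fringe f \<C>" using wF' w by simp
    qed
    show "z \<in> C'" by (rule C')
  next
    fix u x assume u: "u \<in> C'" "E u x" "x \<in> \<Union>\<C> \<union> fringe f \<C>"
    have "x \<notin> C'" using u(3) dis C'J by (auto simp: fringe_def centres_def)
    then have x: "x \<in> F'" "h x = u" using C'N[OF u(1,2)] by auto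
    then have "x \<in> fringe f \<C>" using u(3) F'J[OF x(1)] CJ(1) by blast
    then have "x = w" using F'F[OF x(1)] by simp
    then show "u = z \<and> x = w" using x by (simp add: h_def)
  next
    fix x u assume x: "x \<in> F'" "u \<in> \<Union>\<C>" "E x u"
    then obtain C2 where C2: "C2 \<in> \<C>" "u \<in> C2" by blast
    have "x \<in> C2 \<union> fringe f \<C>" using region_nbrs[OF reg C2] E_sym[OF x(3)] by auto
    then have "x \<in> fringe f \<C>" using F'J[OF x(1)] CJ(1) C2 by blast
    then show "x = w" using F'F[OF x(1)] by simp
  next
    fix x u u' assume x: "x \<in> F'" "u \<in> C'" "u' \<in> C'" "E x u" "E x u'"
    have "x \<notin> C'" using F'J[OF x(1)] C'J by auto
    then show "u = u'"
      using bad_leaf(1)[OF hstar C'(1) x(2) E_sym[OF x(4)]] bad_leaf(1)[OF hstar C'(1) x(3) E_sym[OF x(5)]]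
      by simp
  qed
  moreover have "\<exists>g2. token h (insert C' \<C>) C2 g2" if C2: "C2 \<in> insert C' \<C>" for C2
  proof (cases "C2 = C'")
    case True
    have "token h (insert C' \<C>) C' h" using C' by (auto simp: token_def fringe_def)
    then show ?thesis using True by blast
  next
    case False
    \<comment> \<open>An old token still assigns \<open>w\<close> to an old piece. It differs from
      \<open>h\<close> at most on the old fringe, which contains \<open>w\<close>, and hence is a
      token of the larger region as well.\<close>
    then obtain g2 where g2: "token f \<C> C2 g2" using reg C2 by (auto simp: region_def)
    then have g2': "minimal g2" "centres g2 = centres f" "bad g2 C2"
      "\<And>x. x \<in> V \<Longrightarrow> x \<notin> fringe f \<C> \<Longrightarrow> g2 x = f x" "\<And>x. x \<in> fringe f \<C> \<Longrightarrow> g2 x \<in> \<Union>\<C>"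
      by (auto simp: token_def)
    have same: "g2 x = h x" if "x \<in> V" "x \<notin> fringe f \<C>" for x
    proof -
      have "g x = f x" using g that by (auto simp: token_def)
      moreover have "x \<noteq> w" using that w by auto
      ultimately show ?thesis using g2'(4)[OF that] by (simp add: h_def)
    qed
    have "g2 x \<in> \<Union>(insert C' \<C>)" if "x \<in> fringe h (insert C' \<C>)" for x
    proof (cases "x \<in> fringe f \<C>")
      case True
      then show ?thesis using g2'(5) by auto
    next
      case False
      then show ?thesis using that same[of x] by (auto simp: fringe_def)
    qed
    moreover have "g2 x = h x" if "x \<in> V" "x \<notin> fringe h (insert C' \<C>)" for x
      using same[OF that(1)] frh that(2) by blast
    ultimately have "token h (insert C' \<C>) C2 g2" using g2'(1-3) hJ g'(2) by (simp add: token_def)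
    then show ?thesis by blast
  qed
  ultimately have "region h (insert C' \<C>)" using C'(3) frh' by (simp add: region_def)
  then show ?thesis using C'(2) by blast
qed

text \<open>A bad piece \<open>C\<close> through the new centre \<open>y\<close> would contain all
  of an old piece \<open>C2\<close> next to \<open>y\<close>. Inside it the neighbour
  \<open>u\<close> of \<open>y\<close> has gained the neighbour \<open>y\<close>, but a neighbour
  \<open>p\<close> of \<open>u\<close> in \<open>C2\<close> has gained none, so \<open>C\<close> is
  not regular.\<close>

lemma recentre_not_bad:
  assumes reg: "region f \<C>" and y: "y \<in> fringe f \<C>" "N y \<inter> centres f \<subseteq> \<Union>\<C>"
    and g: "star_on V g" "centres g = insert y (centres f - {x})" "g x = y" "x \<noteq> y"
    and C: "bad g C" "y \<in> C"
  shows False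
proof -
  have yJ: "y \<notin> centres f" using y by (auto simp: fringe_def centres_def)
  obtain a b where ab: "2 \<le> a" "C \<subseteq> centres g" "\<And>u. u \<in> C \<Longrightarrow> card (N u \<inter> C) = a"
    using bad_props[OF g(1) C(1)] by metis
  have "N y \<inter> C \<noteq> {}" using ab(3)[OF C(2)] ab(1) by auto
  then obtain u where u: "E y u" "u \<in> C" by auto
  then have "u \<noteq> y" using E_irrefl by auto
  then have "u \<in> centres f" using ab(2) u(2) g(2) by auto
  then have "u \<in> \<Union>\<C>" using y(2) u(1) by auto
  then obtain C2 where C2: "C2 \<in> \<C>" "u \<in> C2" by blast
  obtain k where k: "token f \<C> C2 k" using reg C2 by (auto simp: region_def)
  then have k': "star_on V k" "bad k C2" "centres k = centres f" using minimal_star by (auto simp: token_def)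
  obtain a2 b2 where ab2: "2 \<le> a2" "C2 \<subseteq> centres k" "cset C2" "\<And>u. u \<in> C2 \<Longrightarrow> card (N u \<inter> C2) = a2"
    using bad_props[OF k'(1,2)] by metis
  have yC2: "y \<notin> C2" using ab2(2) yJ k'(3) by auto
  \<comment> \<open>An old centre adjacent to \<open>t\<close> but outside \<open>C\<close> would
    have to be a leaf of \<open>t\<close> under \<open>g\<close>, and the only old centre turned
    into a leaf is \<open>x\<close>, whose centre is \<open>y\<close>.\<close>
  have stay: "s \<in> C" if "t \<in> C" "t \<noteq> y" "E t s" "s \<in> centres f" for t s
  proof (rule ccontr)
    assume "s \<notin> C"
    then have "g s = t" "s \<notin> centres g" using bad_leaf[OF g(1) C(1) that(1,3)] by auto
    then have "s = x" using that(4) g(2) by auto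
    then show False using \<open>g s = t\<close> g(3) that(2) by simp
  qed
  have C2J: "C2 \<subseteq> centres f" using ab2(2) k'(3) by simp
  have "C2 \<subseteq> C"
  proof (rule cset_subset[OF ab2(3) C2(2) u(2)])
    fix p q assume "p \<in> C" "p \<in> C2" "q \<in> C2" "E p q"
    then show "q \<in> C" using stay[of p q] C2J yC2 by auto
  qed
  have "insert y (N u \<inter> C2) \<subseteq> N u \<inter> C" using \<open>C2 \<subseteq> C\<close> C(2) E_sym[OF u(1)] by auto
  then have "card (insert y (N u \<inter> C2)) \<le> card (N u \<inter> C)" by (rule card_mono[rotated]) simp
  then have gt: "Suc a2 \<le> a" using ab2(4)[OF C2(2)] ab(3)[OF u(2)] yC2 by simp
  have "N u \<inter> C2 \<noteq> {}" using ab2(4)[OF C2(2)] ab2(1) by auto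
  then obtain p where p: "E u p" "p \<in> C2" by auto
  then have "p \<noteq> u" using E_irrefl by auto
  have "\<not> E p y"
    using region_leaf_unique[OF reg C2(1) p(2) C2(2) _ E_sym[OF u(1)] yC2] \<open>p \<noteq> u\<close> by blast
  have "N p \<inter> C \<subseteq> N p \<inter> C2"
  proof
    fix q assume q: "q \<in> N p \<inter> C"
    then have "q \<noteq> y" using \<open>\<not> E p y\<close> by auto
    then have "q \<in> centres f" using q ab(2) g(2) by auto
    then show "q \<in> N p \<inter> C2" using region_closed[OF reg C2(1) p(2)] q by auto
  qed
  then have "card (N p \<inter> C) \<le> card (N p \<inter> C2)" by (rule card_mono[rotated]) simp
  then show False using ab(3)[of p] ab2(4)[of p] p(2) \<open>C2 \<subseteq> C\<close> gt by auto
qed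

text \<open>Turning round a star with a single edge creates no bad piece: the new centre has only
  one leaf, whereas bad pieces need \<open>b \<ge> 2\<close>.\<close>

lemma recentre_leaf:
  assumes k: "minimal k" and v: "v \<in> centres k" "leaves k v = {w}"
  defines "h \<equiv> k(v := w, w := w)"
  shows "star_on V h" "centres h = insert w (centres k - {v})"
    "\<And>C. bad h C \<Longrightarrow> bad k C" "\<And>C. bad k C \<Longrightarrow> v \<notin> C \<Longrightarrow> bad h C" "minimal h"
proof -
  have sk: "star_on V k" using k minimal_star by blast
  have kv: "v \<in> V" "k v = v" using v(1) by (auto simp: centres_def)
  have "w \<in> leaves k v" using v(2) by simp
  then have w: "w \<in> V" "w \<noteq> v" "k w = v" by (auto simp: leaves_def)
  have only: "x = w" if "x \<in> V" "x \<noteq> v" "k x = v" for x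
  proof -
    have "x \<in> leaves k v" using that by (simp add: leaves_def)
    then show ?thesis using v(2) by simp
  qed
  have Evw: "E v w" using sk w by (auto simp: star_on_def)
  show star: "star_on V h"
    unfolding star_on_def
  proof
    fix x assume x: "x \<in> V"
    have kx: "k x \<in> V" "k (k x) = k x" "k x \<noteq> x \<longrightarrow> E (k x) x" using sk x by (auto simp: star_on_def)
    consider "x = v" | "x = w" | "x \<noteq> v" "x \<noteq> w" by blast
    then show "star_at V h x"
    proof cases
      case 1
      then show ?thesis using w E_sym[OF Evw] by (simp add: h_def)
    next
      case 2
      then show ?thesis using w kv by (auto simp: h_def intro!: bexI[of _ v])
    next
      case 3
      have "k x \<noteq> v" using only[OF x] 3 by blast
      moreover have "k x \<noteq> w" using kx(2) w by auto
      moreover have "\<exists>y\<in>V. y \<noteq> x \<and> h y = x" if "k x = x"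
      proof -
        obtain y where y: "y \<in> V" "y \<noteq> x" "k y = x" using star_leaf[OF sk x \<open>k x = x\<close>] by blast
        then have "y \<noteq> v" "y \<noteq> w" using kv w 3 by auto
        then show ?thesis using y by (intro bexI[of _ y]) (auto simp: h_def)
      qed
      ultimately show ?thesis using kx 3 by (auto simp: h_def)
    qed
  qed
  show cent: "centres h = insert w (centres k - {v})"
    using w kv by (auto simp: centres_def h_def)
  have L: "leaves h u = leaves k u" if "u \<noteq> v" "u \<noteq> w" for u
    using that w kv by (auto simp: leaves_def h_def)
  have "k x \<noteq> w" if "x \<in> V" for x
  proof
    assume "k x = w"
    moreover have "k (k x) = k x" using sk that by (simp add: star_on_def)
    ultimately show False using w by simp
  qed
  then have "leaves h w \<subseteq> {v}" using w by (auto simp: leaves_def h_def)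
  then have "card (leaves h w) \<le> card {v}" by (rule card_mono[rotated]) simp
  then have w1: "card (leaves h w) \<le> 1" by simp
  have wbad: "w \<notin> C" if "bad h C" for C
  proof
    assume "w \<in> C"
    obtain b where "2 \<le> b" "\<And>u. u \<in> C \<Longrightarrow> card (leaves h u) = b"
      using bad_props[OF star \<open>bad h C\<close>] by metis
    then show False using w1 \<open>w \<in> C\<close> by fastforce
  qed
  show bb: "bad k C" if C: "bad h C" for C
  proof (rule bad_transfer[OF C])
    fix u assume u: "u \<in> C"
    then have "u \<in> centres h" "u \<noteq> w" using C wbad by (auto simp: bad_def)
    then show "u \<in> centres k \<and> leaves k u = leaves h u" using cent L[of u] by auto
  qed
  show "bad h C" if C: "bad k C" "v \<notin> C" for C
  proof (rule bad_transfer[OF C(1)])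
    fix u assume u: "u \<in> C"
    then have "u \<in> centres k" "u \<noteq> v" using C by (auto simp: bad_def)
    moreover from this have "u \<noteq> w" using w by (auto simp: centres_def)
    ultimately show "u \<in> centres h \<and> leaves h u = leaves k u" using cent L[of u] by auto
  qed
  show "minimal h" using minimal_subset(1)[OF k star bb] .
qed

text \<open>The turned edge lies outside the pieces and the fringe, where all tokens agree with
  \<open>f\<close>; the same turn can be made in every token.\<close>

lemma region_recentre_leaf:
  assumes reg: "region f \<C>" and v: "v \<in> centres f" "leaves f v = {w}" "v \<notin> \<Union>\<C>" and w: "w \<notin> fringe f \<C>"
  shows "region (f(v := w, w := w)) \<C>" "fringe (f(v := w, w := w)) \<C> = fringe f \<C>"
proof -
  let ?h = "\<lambda>k. k(v := w, w := w)"
  have "w \<in> leaves f v" using v by simp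
  then have w': "w \<in> V" "w \<noteq> v" "f w = v" by (auto simp: leaves_def)
  have vf: "f v = v" "v \<in> V" using v by (auto simp: centres_def)
  have "w \<notin> centres f" using w' by (simp add: centres_def)
  then have wW: "w \<notin> \<Union>\<C>" using region_centres(1)[OF reg] by blast
  show fr: "fringe (?h f) \<C> = fringe f \<C>"
    using v(3) w' vf wW by (auto simp: fringe_def)
  have vfr: "v \<notin> fringe f \<C>" using vf by (simp add: fringe_def)
  have mf: "minimal f" using reg by (simp add: region_def)
  have "\<exists>g. token (?h f) \<C> C g" if C: "C \<in> \<C>" for C
  proof -
    obtain g where g: "token f \<C> C g" using reg C by (auto simp: region_def)
    then have g': "minimal g" "centres g = centres f" "bad g C"
      "\<And>x. x \<in> V \<Longrightarrow> x \<notin> fringe f \<C> \<Longrightarrow> g x = f x" "\<And>x. x \<in> fringe f \<C> \<Longrightarrow> g x \<in> \<Union>\<C>"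
      by (auto simp: token_def)
    have "g x = v \<longleftrightarrow> f x = v" if "x \<in> V" for x
    proof (cases "x \<in> fringe f \<C>")
      case True
      then have "g x \<noteq> v" "f x \<noteq> v" using g'(5) v(3) by (auto simp: fringe_def)
      then show ?thesis by simp
    next
      case False
      then show ?thesis using g'(4)[OF that] by simp
    qed
    then have lg: "leaves g v = {w}" using v(2) by (auto simp: leaves_def)
    have vg: "v \<in> centres g" using v g' by simp
    have "v \<notin> C" using v(3) C by blast
    note sg = recentre_leaf[OF g'(1) vg lg] and sf = recentre_leaf[OF mf v(1,2)]
    have "token (?h f) \<C> C (?h g)"
      unfolding token_def fr
    proof (intro conjI ballI impI)
      show "minimal (?h g)" by (rule sg)
      show "centres (?h g) = centres (?h f)" using sg(2) sf(2) g'(2) by simp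
      show "bad (?h g) C" by (rule sg(4)[OF g'(3) \<open>v \<notin> C\<close>])
    next
      fix x assume "x \<in> V" "x \<notin> fringe f \<C>"
      then show "(?h g) x = (?h f) x" using g'(4) by simp
    next
      fix x assume x: "x \<in> fringe f \<C>"
      then have "x \<noteq> v" "x \<noteq> w" using vfr w by auto
      then show "(?h g) x \<in> \<Union>\<C>" using g'(5)[OF x] by simp
    qed
    then show ?thesis by blast
  qed
  then show "region (?h f) \<C>"
    using reg recentre_leaf(5)[OF mf v(1,2)] by (simp add: region_def fr)
qed

text \<open>A neighbouring centre outside the pieces would allow the region to grow, so
  \<open>w'\<close> would be a leaf. The edge between the leaves \<open>w\<close> and
  \<open>w'\<close> is then used to rebuild stars; what can be done depends on what is left of the
  star of \<open>w'\<close> once \<open>w\<close> and \<open>w'\<close> are taken away.\<close>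

lemma fringe_nbrs:
  assumes reg: "region f \<C>" and max: "\<And>f' \<C>'. region f' \<C>' \<Longrightarrow> card (\<Union>\<C>') \<le> card (\<Union>\<C>)"
    and w: "w \<in> fringe f \<C>" "E w w'"
  shows "w' \<in> \<Union>\<C>"
proof (rule ccontr)
  assume w'W: "w' \<notin> \<Union>\<C>"
  \<comment> \<open>Stated for every partition that carries the region, as it is applied both to
    \<open>f\<close> and to a version of \<open>f\<close> with one edge turned round.\<close>
  have closed: "z \<in> \<Union>\<C>" if h: "region h \<C>" "y \<in> fringe h \<C>" "z \<in> centres h" "E y z" for h y z
  proof (rule ccontr)
    assume z: "z \<notin> \<Union>\<C>"
    obtain f' C' where f': "region f' (insert C' \<C>)" "z \<in> C'"
      using region_extend[OF h(1,2,3) z h(4)] by blast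
    have "\<Union>(insert C' \<C>) \<subseteq> V" using region_centres(1)[OF f'(1)] by (auto simp: centres_def)
    then have "card (\<Union>\<C>) < card (\<Union>(insert C' \<C>))"
      using f'(2) z finV finite_subset by (intro psubset_card_mono) blast+
    then show False using max[OF f'(1)] by simp
  qed
  have w'J: "w' \<notin> centres f" using closed[OF reg w(1) _ w(2)] w'W by blast
  have closedJ: "N y \<inter> centres f \<subseteq> \<Union>\<C>" if "y \<in> fringe f \<C>" for y
    using closed[OF reg that] by auto
  define v where "v = f w"
  have v: "v \<in> \<Union>\<C>" "E v w" "v \<noteq> w"
    using w minimal_star[of f] reg by (auto simp: fringe_def v_def region_def star_on_def)
  then obtain C where C: "C \<in> \<C>" "v \<in> C" by blast
  obtain g where g: "token f \<C> C g" using reg C by (auto simp: region_def)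
  then have g': "minimal g" "centres g = centres f" "bad g C" by (auto simp: token_def)
  have sg: "star_on V g" using g'(1) minimal_star by blast
  have CJ: "\<Union>\<C> \<subseteq> centres f" using region_centres[OF reg] by auto
  have wJ: "w \<notin> centres f" "w \<in> V" using w by (auto simp: fringe_def centres_def)
  have wC: "w \<notin> C" using C CJ wJ by auto
  have gw: "g w = v" using bad_leaf(1)[OF sg g'(3) C(2) v(2) wC] .
  have vJ: "v \<in> V" "g v = v" using C CJ g'(2) by (auto simp: centres_def)
  have w'V: "w' \<in> V" "w' \<noteq> w" using w E_dom2 E_irrefl by auto
  define v' where "v' = g w'"
  have v': "v' \<in> V" "g v' = v'" "v' \<noteq> w'" "E v' w'" "v' \<in> centres g"
    using sg w'V w'J g'(2) by (auto simp: v'_def star_on_def centres_def)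
  have cg: "x \<noteq> w" "x \<noteq> w'" if "g x = x" for x using that gw v(3) v'(3) by (auto simp: v'_def)
  have ne: "v \<noteq> w'" "v' \<noteq> w" using cg vJ v' by auto
  have gw': "g w' = v'" by (simp add: v'_def)
  have two: "\<exists>y\<in>leaves g v. y \<noteq> w"
  proof -
    obtain b where b: "2 \<le> b" "\<And>u. u \<in> C \<Longrightarrow> card (leaves g u) = b"
      using bad_props[OF sg g'(3)] by metis
    have "leaves g v \<noteq> {w}" using b(1) b(2)[OF C(2)] by auto
    moreover have "w \<in> leaves g v" using gw v wJ by (auto simp: leaves_def)
    ultimately show ?thesis by blast
  qed
  consider (a) "\<exists>y\<in>V. y \<noteq> v' \<and> y \<noteq> w \<and> y \<noteq> w' \<and> g y = v'"
    | (b) "v' \<noteq> v" "\<forall>y\<in>V. g y = v' \<longrightarrow> y = v' \<or> y = w \<or> y = w'"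
    | (c) "v' = v" "\<forall>y\<in>V. g y = v' \<longrightarrow> y = v' \<or> y = w \<or> y = w'" by blast
  then show False
  proof cases
    case a
    then obtain y0 where y0: "y0 \<in> V" "y0 \<noteq> v'" "y0 \<noteq> w" "y0 \<noteq> w'" "g y0 = v'" by blast
    \<comment> \<open>The edge from \<open>w\<close> to \<open>w'\<close> becomes a star of its own.
      Neither \<open>v\<close> nor \<open>v'\<close> is in a bad piece afterwards: \<open>v\<close>
      has the new centre \<open>w\<close> as neighbour, which has a single leaf, and
      \<open>v'\<close> has lost \<open>w'\<close>.\<close>
    define h where "h = g(w := w, w' := w)"
    have hs: "star_on V h"
      unfolding star_on_def
    proof
      fix x assume x: "x \<in> V"
      have gx: "g x \<in> V" "g (g x) = g x" "g x \<noteq> x \<longrightarrow> E (g x) x" using sg x by (auto simp: star_on_def)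
      consider "x = w" | "x = w'" | "x \<noteq> w" "x \<noteq> w'" by blast
      then show "star_at V h x"
      proof cases
        case 1
        then show ?thesis using w'V wJ by (auto simp: h_def intro!: bexI[of _ w'])
      next
        case 2
        then show ?thesis using w'V wJ w(2) by (simp add: h_def)
      next
        case 3
        have "g x \<noteq> w" "g x \<noteq> w'" using cg gx(2) by auto
        moreover have "\<exists>y\<in>V. y \<noteq> x \<and> h y = x" if "g x = x"
        proof -
          consider "x = v'" | "x = v" "x \<noteq> v'" | "x \<noteq> v" "x \<noteq> v'" by blast
          then show ?thesis
          proof cases
            case 1
            then show ?thesis using y0 by (intro bexI[of _ y0]) (auto simp: h_def)
          next
            case 2
            obtain y where y: "y \<in> leaves g v" "y \<noteq> w" using two by blast
            then have "y \<noteq> w'" using 2 gw' by (auto simp: leaves_def)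
            then show ?thesis using y 2 by (intro bexI[of _ y]) (auto simp: h_def leaves_def)
          next
            case 3
            obtain y where y: "y \<in> V" "y \<noteq> x" "g y = x" using star_leaf[OF sg x \<open>g x = x\<close>] by blast
            then have "y \<noteq> w" "y \<noteq> w'" using gw gw' 3 by auto
            then show ?thesis using y by (intro bexI[of _ y]) (auto simp: h_def)
          qed
        qed
        ultimately show ?thesis using gx 3 by (auto simp: h_def)
      qed
    qed
    have hJ: "centres h = insert w (centres g)" using wJ w'V w'J g'(2) gw
      by (auto simp: centres_def h_def)
    have "g x \<noteq> w" if "x \<in> V" for x
    proof -
      have "g (g x) = g x" using sg that by (simp add: star_on_def)
      then show ?thesis using cg(1) by blast
    qed
    then have "leaves h w \<subseteq> {w'}" by (auto simp: leaves_def h_def split: if_splits)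
    then have w1: "card (leaves h w) \<le> 1" using card_mono[of "{w'}" "leaves h w"] by simp
    have wb: "w \<notin> C'" if "bad h C'" for C'
    proof
      assume "w \<in> C'"
      obtain b where "2 \<le> b" "\<And>u. u \<in> C' \<Longrightarrow> card (leaves h u) = b"
        using bad_props[OF hs \<open>bad h C'\<close>] by metis
      then show False using w1 \<open>w \<in> C'\<close> by fastforce
    qed
    have vb: "v \<notin> C'" if "bad h C'" for C'
    proof
      assume "v \<in> C'"
      then have "w \<in> C'" using bad_centre_nbr[OF hs that _ v(2)] hJ by blast
      then show False using wb that by blast
    qed
    have v'b: "v' \<notin> C'" if "bad h C'" for C'
    proof
      assume "v' \<in> C'"
      moreover have "w' \<notin> C'" using that hJ w'J g'(2) w'V by (auto simp: bad_def)
      ultimately have "h w' = v'" using bad_leaf(1)[OF hs that _ v'(4)] by blast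
      then show False using ne by (simp add: h_def)
    qed
    have bb: "bad g C'" if "bad h C'" for C'
    proof (rule bad_transfer[OF that])
      fix u assume u: "u \<in> C'"
      then have "u \<in> centres h" "u \<noteq> w" "u \<noteq> v" "u \<noteq> v'"
        using that wb[OF that] vb[OF that] v'b[OF that] by (auto simp: bad_def)
      then show "u \<in> centres g \<and> leaves g u = leaves h u"
        using hJ gw gw' by (auto simp: leaves_def h_def)
    qed
    have nb: "\<not> bad h C" using vb[of C] C(2) by blast
    show False by (rule minimal_drop[OF g'(1) hs g'(3) nb]) (rule bb)
  next
    case b
    have lv': "leaves g v' = {w'}"
    proof (rule equalityI; rule subsetI)
      fix x assume "x \<in> leaves g v'"
      then have x: "x \<in> V" "x \<noteq> v'" "g x = v'" by (auto simp: leaves_def)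
      then have "x = w \<or> x = w'" using b(2) by blast
      then show "x \<in> {w'}" using x(3) gw b(1) by auto
    next
      fix x assume "x \<in> {w'}"
      then show "x \<in> leaves g v'" using w'V v'(3) gw' by (auto simp: leaves_def)
    qed
    show ?thesis
    proof (cases "v' \<in> \<Union>\<C>")
      \<comment> \<open>Outside the region the star of \<open>v'\<close> can be turned round already
        in \<open>f\<close>. Then \<open>w'\<close> is a centre adjacent to the fringe, which
        maximality rules out.\<close>
      case False
      have gf: "g x = v' \<longleftrightarrow> f x = v'" if "x \<in> V" for x
      proof (cases "x \<in> fringe f \<C>")
        case True
        then have "g x \<noteq> v'" "f x \<noteq> v'" using g False by (auto simp: fringe_def token_def)
        then show ?thesis by simp
      next
        case False
        then show ?thesis using g that by (simp add: token_def)
      qed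
      have lf: "leaves f v' = {w'}" using lv' gf by (auto simp: leaves_def)
      have "f w' = v'" using gf[OF w'V(1)] gw' by simp
      then have "w' \<notin> fringe f \<C>" using False by (auto simp: fringe_def)
      note h = region_recentre_leaf[OF reg _ lf False this]
      have v'f: "v' \<in> centres f" using v' g'(2) by simp
      have "w' \<in> centres (f(v' := w', w' := w'))" using w'V by (simp add: centres_def)
      then have "w' \<in> \<Union>\<C>" using closed[OF h(1)[OF v'f] _ _ w(2)] h(2)[OF v'f] w(1) by blast
      then show False using w'W by simp
    next
      case True
      \<comment> \<open>Inside the region \<open>w'\<close> takes over its former centre
        \<open>v'\<close> and the leaf \<open>w\<close>; \<open>recentre_not_bad\<close> applies to
        \<open>w'\<close>, and \<open>v\<close> has lost \<open>w\<close>.\<close>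
      define h where "h = g(v' := w', w' := w', w := w')"
      have hs: "star_on V h"
        unfolding star_on_def
      proof
        fix x assume x: "x \<in> V"
        have gx: "g x \<in> V" "g (g x) = g x" "g x \<noteq> x \<longrightarrow> E (g x) x" using sg x by (auto simp: star_on_def)
        consider "x = w" | "x = w'" | "x = v'" | "x \<noteq> w" "x \<noteq> w'" "x \<noteq> v'" by blast
        then show "star_at V h x"
        proof cases
          case 1
          then show ?thesis using w'V E_sym[OF w(2)] by (simp add: h_def)
        next
          case 2
          then show ?thesis using w'V wJ by (auto simp: h_def intro!: bexI[of _ w])
        next
          case 3
          then show ?thesis using w'V E_sym[OF v'(4)] ne v'(3) by (simp add: h_def)
        next
          case 4
          have "g x \<noteq> w" "g x \<noteq> w'" using cg gx(2) by auto
          moreover have "g x \<noteq> v'" using b(2) x 4 by blast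
          moreover have "\<exists>y\<in>V. y \<noteq> x \<and> h y = x" if "g x = x"
          proof (cases "x = v")
            case True
            obtain y where y: "y \<in> leaves g v" "y \<noteq> w" using two by blast
            then have "y \<noteq> w'" "y \<noteq> v'" using b(1) v'(2) gw' by (auto simp: leaves_def)
            then show ?thesis using y True by (intro bexI[of _ y]) (auto simp: h_def leaves_def)
          next
            case False
            obtain y where y: "y \<in> V" "y \<noteq> x" "g y = x" using star_leaf[OF sg x \<open>g x = x\<close>] by blast
            then have "y \<noteq> w" "y \<noteq> w'" "y \<noteq> v'" using gw gw' False 4 v'(2) by auto
            then show ?thesis using y by (intro bexI[of _ y]) (auto simp: h_def)
          qed
          ultimately show ?thesis using gx 4 by (auto simp: h_def)
        qed
      qed
      have hJ: "centres h = insert w' (centres f - {v'})"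
        unfolding g'(2)[symmetric] using wJ w'V w'J gw v v' ne g'(2) by (auto simp: centres_def h_def)
      have w'F: "w' \<in> fringe f \<C>"
      proof -
        have "w' \<in> fringe g \<C>" using True w'V v'(3) gw' by (simp add: fringe_def)
        then show ?thesis using token_fringe[OF g] by simp
      qed
      have hv': "h v' = w'" using ne by (simp add: h_def)
      have w'b: "w' \<notin> C'" if "bad h C'" for C'
        using recentre_not_bad[OF reg w'F closedJ[OF w'F] hs hJ hv' v'(3) that] by blast
      have vb: "v \<notin> C'" if "bad h C'" for C'
      proof
        assume "v \<in> C'"
        moreover have "w \<notin> C'" using that hJ wJ w'V by (auto simp: bad_def)
        ultimately have "h w = v" using bad_leaf(1)[OF hs that _ v(2)] by blast
        then show False using ne by (simp add: h_def)
      qed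
      have bb: "bad g C'" if "bad h C'" for C'
      proof (rule bad_transfer[OF that])
        fix u assume u: "u \<in> C'"
        then have "u \<in> centres h" "u \<noteq> w'" "u \<noteq> v"
          using that w'b[OF that] vb[OF that] by (auto simp: bad_def)
        then show "u \<in> centres g \<and> leaves g u = leaves h u"
          using hJ gw gw' g'(2) v'(2) by (auto simp: leaves_def h_def)
      qed
      have nb: "\<not> bad h C" using vb[of C] C(2) by blast
    show False by (rule minimal_drop[OF g'(1) hs g'(3) nb]) (rule bb)
    qed
  next
    case c
    \<comment> \<open>The star of \<open>v\<close> has only the leaves \<open>w\<close> and
      \<open>w'\<close>; it is recentred at \<open>w\<close>, to which
      \<open>recentre_not_bad\<close> applies.\<close>
    define h where "h = g(v := w, w := w, w' := w)"
    have hs: "star_on V h"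
      unfolding star_on_def
    proof
      fix x assume x: "x \<in> V"
      have gx: "g x \<in> V" "g (g x) = g x" "g x \<noteq> x \<longrightarrow> E (g x) x" using sg x by (auto simp: star_on_def)
      consider "x = w" | "x = w'" | "x = v" | "x \<noteq> w" "x \<noteq> w'" "x \<noteq> v" by blast
      then show "star_at V h x"
      proof cases
        case 1
        then show ?thesis using w'V wJ by (auto simp: h_def intro!: bexI[of _ w'])
      next
        case 2
        then show ?thesis using w'V wJ w(2) by (simp add: h_def)
      next
        case 3
        then show ?thesis using wJ E_sym[OF v(2)] ne w'V v(3) by (simp add: h_def)
      next
        case 4
        have "g x \<noteq> w" "g x \<noteq> w'" using cg gx(2) by auto
        moreover have "g x \<noteq> v" using c x 4 by blast
        moreover have "\<exists>y\<in>V. y \<noteq> x \<and> h y = x" if "g x = x"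
        proof -
          obtain y where y: "y \<in> V" "y \<noteq> x" "g y = x" using star_leaf[OF sg x \<open>g x = x\<close>] by blast
          then have "y \<noteq> w" "y \<noteq> w'" "y \<noteq> v" using gw gw' 4 vJ c(1) by auto
          then show ?thesis using y by (intro bexI[of _ y]) (auto simp: h_def)
        qed
        ultimately show ?thesis using gx 4 by (auto simp: h_def)
      qed
    qed
    have "h x = x \<longleftrightarrow> x = w \<or> x \<noteq> v \<and> g x = x" for x
      using cg[of x] v(3) ne(1) w'V(2) by (auto simp: h_def)
    then have "centres h = insert w (centres g - {v})" using wJ(2) by (auto simp: centres_def)
    then have hJ: "centres h = insert w (centres f - {v})" using g'(2) by simp
    have hv: "h v = w" using ne by (simp add: h_def)
    have wb: "w \<notin> C'" if "bad h C'" for C'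
      using recentre_not_bad[OF reg w(1) closedJ[OF w(1)] hs hJ hv v(3) that] by blast
    have vb: "v \<notin> C'" if "bad h C'" for C'
      using that hJ v(3) by (auto simp: bad_def)
    have bb: "bad g C'" if "bad h C'" for C'
    proof (rule bad_transfer[OF that])
      fix u assume u: "u \<in> C'"
      then have "u \<in> centres h" "u \<noteq> w" "u \<noteq> v"
        using that wb[OF that] vb[OF that] by (auto simp: bad_def)
      then show "u \<in> centres g \<and> leaves g u = leaves h u"
        using hJ gw gw' g'(2) vJ c(1) by (auto simp: leaves_def h_def)
    qed
    have nb: "\<not> bad h C" using vb[of C] C(2) by blast
    show False by (rule minimal_drop[OF g'(1) hs g'(3) nb]) (rule bb)
  qed
qed

text \<open>The second alternative no longer mentions star partitions and can be compared with
  \<open>special\<close> directly. It arises from a region that covers as many vertices as possible: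
  its pieces and fringe are closed under adjacency.\<close>

lemma star_or_tree:
  assumes conn: "cset V" and V2: "2 \<le> card V"
  shows "(\<exists>f. star_on V f \<and> (\<forall>C. \<not> bad f C)) \<or>
    (\<exists>\<C>. (\<forall>C\<in>\<C>. (\<exists>a b. piece a b C) \<and> (\<forall>u\<in>C. card (N u) = D \<and> N u \<inter> \<Union>\<C> \<subseteq> C)) \<and>
      indep (V - \<Union>\<C>) \<and>
      (\<forall>w\<in>V - \<Union>\<C>. \<forall>z\<in>N w. \<exists>A\<subseteq>V - {w}. N w \<inter> A = {z} \<and> (\<forall>x\<in>A. N x \<subseteq> insert w A)))"
proof -
  obtain f0 where "star_on V f0" using star_exists[OF conn V2] by blast
  then obtain f1 where f1: "star_on V f1" "\<And>g. star_on V g \<Longrightarrow> card (Bad f1) \<le> card (Bad g)"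
    using ex_has_least_nat[of "star_on V" f0 "\<lambda>f. card (Bad f)"] by blast
  then have m1: "minimal f1" by (simp add: minimal_def)
  show ?thesis
  proof (cases "\<exists>C. bad f1 C")
    case False
    then show ?thesis using f1(1) by blast
  next
    case True
    then obtain C0 where "bad f1 C0" by blast
    then have init: "region f1 {C0}" using region_init[OF m1] by blast
    have inV: "\<Union>\<C> \<subseteq> V" if "region f \<C>" for f \<C>
      using region_centres(1)[OF that] by (auto simp: centres_def)
    define P where "P = (\<lambda>(f, \<C>). region f \<C>)"
    have "P (f1, {C0})" using init by (simp add: P_def)
    moreover have "\<forall>y. P y \<longrightarrow> card (\<Union>(snd y)) < Suc (card V)"
      using inV card_mono[OF finV] by (auto simp: P_def less_Suc_eq_le)
    ultimately obtain p where p: "P p" "\<And>y. P y \<Longrightarrow> card (\<Union>(snd y)) \<le> card (\<Union>(snd p))"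
      using ex_has_greatest_nat[of P "(f1, {C0})" "\<lambda>y. card (\<Union>(snd y))" "Suc (card V)"]
      by (metis less_imp_le)
    obtain f \<C> where fC: "p = (f, \<C>)" by (cases p)
    have reg: "region f \<C>" using p(1) fC by (simp add: P_def)
    have max: "card (\<Union>\<C>') \<le> card (\<Union>\<C>)" if "region f' \<C>'" for f' \<C>'
      using p(2)[of "(f', \<C>')"] that fC by (simp add: P_def)
    let ?W = "\<Union>\<C>"
    let ?F = "fringe f \<C>"
    have Fn: "N w \<subseteq> ?W" if "w \<in> ?F" for w using fringe_nbrs[OF reg max that] by auto
    have Wn: "N u \<subseteq> C \<union> ?F" if "C \<in> \<C>" "u \<in> C" for C u using region_nbrs[OF reg that] .
    have dis: "?W \<inter> ?F = {}" "?W \<subseteq> V" using region_centres[OF reg] inV[OF reg] by auto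
    have FV: "?F \<subseteq> V" by (auto simp: fringe_def)
    have tok: "\<exists>g. star_on V g \<and> bad g C" if "C \<in> \<C>" for C
      using reg that minimal_star by (fastforce simp: region_def token_def)
    have ne: "?W \<noteq> {}"
    proof -
      have "\<C> \<noteq> {}" using reg by (simp add: region_def)
      then obtain C where "C \<in> \<C>" by blast
      moreover from this have "C \<noteq> {}" using tok by (auto simp: bad_def piece_def)
      ultimately show ?thesis by blast
    qed
    then obtain u0 where u0: "u0 \<in> ?W" by blast
    have "V \<subseteq> ?W \<union> ?F"
    proof (rule cset_subset[OF conn])
      show "u0 \<in> V" "u0 \<in> ?W \<union> ?F" using u0 dis by auto
      fix u w assume "u \<in> ?W \<union> ?F" "E u w"
      then have "w \<in> N u" by simp
      show "w \<in> ?W \<union> ?F"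
      proof (cases "u \<in> ?F")
        case True
        then show ?thesis using Fn \<open>w \<in> N u\<close> by blast
      next
        case False
        then obtain C where "C \<in> \<C>" "u \<in> C" using \<open>u \<in> ?W \<union> ?F\<close> by blast
        then show ?thesis using Wn \<open>w \<in> N u\<close> by blast
      qed
    qed
    then have VF: "V - ?W = ?F" "V = ?W \<union> ?F" using dis FV by auto
    have "(\<exists>a b. piece a b C) \<and> (\<forall>u\<in>C. card (N u) = D \<and> N u \<inter> ?W \<subseteq> C)" if C: "C \<in> \<C>" for C
    proof -
      obtain g where g: "star_on V g" "bad g C" using tok[OF C] by blast
      have "\<exists>a b. piece a b C" using g(2) by (auto simp: bad_def)
      moreover have "card (N u) = D" if "u \<in> C" for u
        by (rule bad_props[OF g]) (use that in simp)
      moreover have "N u \<inter> ?W \<subseteq> C" if "u \<in> C" for u using Wn[OF C that] dis by blast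
      ultimately show ?thesis by blast
    qed
    note 1 = this
    have 2: "indep (V - ?W)"
      unfolding VF(1) indep_def
    proof (intro ballI notI)
      fix x y assume "x \<in> ?F" "y \<in> ?F" "E x y"
      then have "y \<in> ?W" using Fn[of x] by auto
      then show False using \<open>y \<in> ?F\<close> dis by blast
    qed
    have 3: "\<exists>A\<subseteq>V - {w}. N w \<inter> A = {z} \<and> (\<forall>x\<in>A. N x \<subseteq> insert w A)"
      if w: "w \<in> V - ?W" "z \<in> N w" for w z
    proof -
      have wF: "w \<in> ?F" using w(1) VF by blast
      then have "z \<in> ?W" using Fn w(2) by blast
      moreover have "cuts ?W ?F" using reg by (simp add: region_def)
      ultimately obtain A where A: "A \<subseteq> ?W \<union> ?F - {w}" "N w \<inter> A \<inter> ?W = {z}"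
        "\<forall>x\<in>A. \<forall>y\<in>?W \<union> ?F. E x y \<and> (x \<in> ?W \<or> y \<in> ?W) \<longrightarrow> y \<in> insert w A"
        using wF w(2) unfolding cuts_def in_N by meson
      have "A \<subseteq> V - {w}" using A(1) VF(2) by blast
      moreover have "N w \<inter> A = {z}" using A(2) Fn[OF wF] by blast
      \<comment> \<open>Now the fringe is independent, so every edge has an end in a piece and the
        closure condition of \<open>cuts\<close> covers all edges.\<close>
      moreover have "N x \<subseteq> insert w A" if "x \<in> A" for x
      proof
        fix y assume y: "y \<in> N x"
        have "x \<in> ?W \<or> y \<in> ?W"
        proof (cases "x \<in> ?F")
          case True
          then show ?thesis using Fn y by blast
        next
          case False
          then show ?thesis using that A(1) by blast
        qed
        moreover have "y \<in> ?W \<union> ?F" using y N_subset VF(2) by blast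
        ultimately show "y \<in> insert w A" using A(3) that y by simp
      qed
      ultimately show ?thesis by (intro exI[of _ A] conjI ballI)
    qed
    show ?thesis
    proof (rule disjI2, rule exI[of _ \<C>], rule conjI[OF ballI conjI[OF 2]])
      show "\<forall>w\<in>V - ?W. \<forall>z\<in>N w. \<exists>A\<subseteq>V - {w}. N w \<inter> A = {z} \<and> (\<forall>x\<in>A. N x \<subseteq> insert w A)"
        by (intro ballI) (rule 3)
    qed (rule 1)
  qed
qed

section \<open>The exact value for special graphs\<close>

text \<open>Double counting of the edges between \<open>B\<close> and \<open>C - B\<close>: each
  vertex of \<open>B\<close> sends two of them, each vertex of \<open>C - B\<close> receives at most
  two.\<close>

lemma two_regular_indep_le:
  assumes "finite C" "\<And>u. u \<in> C \<Longrightarrow> card (N u \<inter> C) = 2" "B \<subseteq> C" "indep B"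
  shows "card B \<le> card C div 2"
proof -
  have fB: "finite B" using assms finite_subset by blast
  have "N x \<inter> C = {y \<in> C - B. E x y}" if "x \<in> B" for x
    using that assms(4) by (auto simp: indep_def)
  then have l: "card {y \<in> C - B. E x y} = 2" if "x \<in> B" for x
    using assms(2)[of x] assms(3) that by auto
  have r: "card {x \<in> B. E x y} \<le> 2" if "y \<in> C - B" for y
  proof -
    have "card {x \<in> B. E x y} \<le> card (N y \<inter> C)"
      by (rule card_mono) (use assms(3) E_sym in auto)
    then show ?thesis using assms(2)[of y] that by simp
  qed
  have count: "card {y \<in> A. Q y} = (\<Sum>y\<in>A. if Q y then 1 else 0)" if "finite A" for A :: "'a set" and Q
    using sum.inter_filter[OF that, of "\<lambda>_. 1::nat" Q] by simp
  have "(\<Sum>x\<in>B. card {y \<in> C - B. E x y}) = (\<Sum>x\<in>B. \<Sum>y\<in>C - B. if E x y then 1 else 0)"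
    using assms(1) by (intro sum.cong count) auto
  also have "\<dots> = (\<Sum>y\<in>C - B. \<Sum>x\<in>B. if E x y then 1 else 0)" by (rule sum.swap)
  also have "\<dots> = (\<Sum>y\<in>C - B. card {x \<in> B. E x y})"
    using fB by (intro sum.cong count[symmetric]) auto
  also have "\<dots> \<le> (\<Sum>y\<in>C - B. 2)" by (rule sum_mono) (rule r)
  finally have "2 * card B \<le> 2 * card (C - B)" using l by simp
  also have "card (C - B) = card C - card B" using assms(3) fB by (simp add: card_Diff_subset)
  finally show ?thesis by simp
qed

text \<open>\<open>k\<close> is the independence number: 1 for a clique and half the length, rounded
  down, for an odd cycle. It is attained away from any prescribed vertex, as gluing will require.
  Adding \<open>b\<close> pendant vertices to each vertex of the piece gives n = |C| (1 + b) and i =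
  b |C| - (b - 1) k; the identity is (c + D) (i - 1) = c (n - 1).\<close>

lemma piece_independence:
  assumes "piece a b C"
  obtains k where "\<And>B. B \<subseteq> C \<Longrightarrow> indep B \<Longrightarrow> card B \<le> k"
    "\<And>z. z \<in> C \<Longrightarrow> \<exists>B\<subseteq>C - {z}. indep B \<and> (\<forall>v\<in>C - B. \<exists>u\<in>B. E v u) \<and> card B = k"
    "(quarter + int D) * (int b * int (card C) - (int b - 1) * int k - 1) =
      quarter * (int (card C) * (1 + int b) - 1)"
proof -
  have p: "C \<noteq> {}" "C \<subseteq> V" "cset C" "a + b = D" "a * b = D\<^sup>2 div 4" "\<And>u. u \<in> C \<Longrightarrow> card (N u \<inter> C) = a"
    and cases: "card C = Suc a \<or> D = 4 \<and> odd (card C)"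
    using assms by (auto simp: piece_def)
  have fC: "finite C" using p(2) finV finite_subset by blast
  show ?thesis
  proof (cases "card C = Suc a")
    case True
    have clique: "E u v" if "u \<in> C" "v \<in> C" "u \<noteq> v" for u v
    proof -
      have "N u \<inter> C = C - {u}"
        by (rule card_subset_eq) (use fC E_irrefl p(6) True that in auto)
      moreover have "v \<in> C - {u}" using that by simp
      ultimately have "v \<in> N u \<inter> C" by simp
      then show ?thesis by simp
    qed
    show ?thesis
    proof (rule that[of 1])
      fix B assume B: "B \<subseteq> C" "indep B"
      have "x = y" if "x \<in> B" "y \<in> B" for x y
        using clique[of x y] B that unfolding indep_def by blast
      then show "card B \<le> 1" using card_le_Suc0_iff_eq[of B] finite_subset[OF B(1) fC] by auto
    next
      fix z assume z: "z \<in> C"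
      have "C \<noteq> {z}" using True piece_params[OF assms] by auto
      then obtain u where u: "u \<in> C" "u \<noteq> z" using z by blast
      have "indep {u}" using E_irrefl by (simp add: indep_def)
      moreover have "\<forall>v\<in>C - {u}. \<exists>x\<in>{u}. E v x" using clique u by blast
      ultimately show "\<exists>B\<subseteq>C - {z}. indep B \<and> (\<forall>v\<in>C - B. \<exists>u\<in>B. E v u) \<and> card B = 1"
        using u by (intro exI[of _ "{u}"]) auto
    next
      have c: "quarter = int a * int b" using p(5) by (metis of_nat_mult)
      have d: "int D = int a + int b" using p(4) by simp
      show "(quarter + int D) * (int b * int (card C) - (int b - 1) * int 1 - 1) =
        quarter * (int (card C) * (1 + int b) - 1)"
        unfolding c d True by (simp add: algebra_simps)
    qed
  next
    case False
    then have D: "D = 4" "odd (card C)" using cases by auto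
    have "a = 2" "b = 2"
      using piece_params[OF assms] p(4) D by auto
    then have reg: "\<And>u. u \<in> C \<Longrightarrow> card (N u \<inter> C) = 2" using p(6) by simp
    have le: "card B \<le> card C div 2" if "B \<subseteq> C" "indep B" for B
      using two_regular_indep_le[OF fC reg that] .
    show ?thesis
    proof (rule that[of "card C div 2"])
      fix z assume z: "z \<in> C"
      obtain B where B: "B \<subseteq> C" "indep B" "card B = card C div 2" "z \<notin> B"
        using cycle_indep[OF fC p(3) reg z] D by blast
      have "\<exists>u\<in>B. E v u" if v: "v \<in> C - B" for v
      proof (rule ccontr)
        assume "\<not> ?thesis"
        then have "indep (insert v B)" using B(2) E_sym E_irrefl unfolding indep_def by blast
        then have "card (insert v B) \<le> card C div 2" using le v B(1) by blast
        moreover have "finite B" using B(1) fC finite_subset by blast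
        ultimately show False using v B(3) by simp
      qed
      then show "\<exists>B\<subseteq>C - {z}. indep B \<and> (\<forall>v\<in>C - B. \<exists>u\<in>B. E v u) \<and> card B = card C div 2"
        using B by (intro exI[of _ B]) auto
    next
      obtain j where j: "card C = 2 * j + 1" using D(2) by (rule oddE)
      show "(quarter + int D) * (int b * int (card C) - (int b - 1) * int (card C div 2) - 1) =
        quarter * (int (card C) * (1 + int b) - 1)"
        unfolding D(1) \<open>b = 2\<close> j by simp
    qed (rule le)
  qed
qed

text \<open>A cycle through \<open>v\<close> expressed without closed walks: two distinct neighbours
  stay linked after deletion of \<open>v\<close>. \<open>cycle_verts_iff\<close> relates it to the
  cycles of the digraph.\<close>

definition cyc :: "'a \<Rightarrow> bool" where
  "cyc v \<longleftrightarrow> (\<exists>z z'. z \<noteq> z' \<and> E v z \<and> E v z' \<and> lnk (V - {v}) z z')"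

definition unhit :: "'a set \<Rightarrow> 'a set \<Rightarrow> 'a set" where
  "unhit F B = {x \<in> F. \<forall>u\<in>B. \<not> E u x}"

text \<open>
  With \<open>W\<close> the union of the pieces and \<open>F\<close> their outer neighbours, an independent dominating set is
  determined by its trace \<open>B\<close> on \<open>W\<close> and consists of \<open>B\<close> and the vertices of \<open>F\<close> not hit by \<open>B\<close>.
\<close>

definition tight_value :: "'a set \<Rightarrow> 'a set \<Rightarrow> bool" where
  "tight_value W F \<longleftrightarrow>
    (\<forall>B\<subseteq>W. indep B \<longrightarrow> quarter * (int (card W + card F) - 1) + (quarter + int D)
       \<le> (quarter + int D) * (int (card (unhit F B)) + int (card B))) \<and>
    (\<exists>B\<subseteq>W. indep B \<and> (\<forall>v\<in>W - B. \<exists>u\<in>B. E v u) \<and>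
      (quarter + int D) * (int (card (unhit F B)) + int (card B))
       \<le> quarter * (int (card W + card F) - 1) + (quarter + int D))"

lemma card_unhit_piece:
  assumes C: "finite C" and F: "F = (\<Union>u\<in>C. N u - C)"
    and card: "\<forall>u\<in>C. card (N u - C) = b"
    and disj: "\<forall>u\<in>C. \<forall>u'\<in>C. u \<noteq> u' \<longrightarrow> (N u - C) \<inter> (N u' - C) = {}"
    and B: "B \<subseteq> C"
  shows "int (card (unhit F B)) = int b * int (card C) - int b * int (card B)" "card F = b * card C"
proof -
  have *: "card (\<Union>u\<in>X. N u - C) = b * card X" if "X \<subseteq> C" for X
  proof -
    have "card (\<Union>u\<in>X. N u - C) = (\<Sum>u\<in>X. card (N u - C))"
    proof (rule card_UN_disjoint)
      show "finite X" using that C finite_subset by blast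
      show "\<forall>i\<in>X. \<forall>j\<in>X. i \<noteq> j \<longrightarrow> (N i - C) \<inter> (N j - C) = {}" using disj that by blast
    qed simp
    also have "\<dots> = (\<Sum>u\<in>X. b)" by (rule sum.cong) (use card that in auto)
    finally show ?thesis by simp
  qed
  show "card F = b * card C" using *[of C] F by simp
  have "unhit F B = (\<Union>u\<in>C - B. N u - C)"
  proof
    show "unhit F B \<subseteq> (\<Union>u\<in>C - B. N u - C)" by (auto simp: unhit_def F)
    show "(\<Union>u\<in>C - B. N u - C) \<subseteq> unhit F B"
    proof
      fix x assume "x \<in> (\<Union>u\<in>C - B. N u - C)"
      then obtain u where u: "u \<in> C - B" "x \<in> N u - C" by blast
      have "\<not> E u' x" if "u' \<in> B" for u'
      proof
        assume "E u' x"
        then have "x \<in> (N u - C) \<inter> (N u' - C)" using u by simp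
        moreover have "u' \<in> C" "u \<noteq> u'" using u that B by auto
        ultimately show False using disj u by blast
      qed
      then show "x \<in> unhit F B" using u by (auto simp: unhit_def F)
    qed
  qed
  then have "card (unhit F B) = b * card (C - B)" using *[of "C - B"] by simp
  moreover have "card (C - B) = card C - card B" using B C finite_subset by (metis card_Diff_subset)
  moreover have "card B \<le> card C" using B C card_mono by blast
  ultimately show "int (card (unhit F B)) = int b * int (card C) - int b * int (card B)"
    by (simp add: of_nat_diff algebra_simps)
qed

text \<open>A choice \<open>B\<close> in the piece leaves \<open>b\<close> outer neighbours unhit
  for each vertex not chosen. Since \<open>b \<ge> 1\<close>, the total is smallest for a largest
  independent \<open>B\<close>.\<close>

lemma piece_value:
  assumes p: "piece a b C" and F: "F = (\<Union>u\<in>C. N u - C)"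
    and deg: "\<And>u. u \<in> C \<Longrightarrow> card (N u) = D"
    and disj: "\<forall>u\<in>C. \<forall>u'\<in>C. u \<noteq> u' \<longrightarrow> (N u - C) \<inter> (N u' - C) = {}"
  shows "\<And>B. B \<subseteq> C \<Longrightarrow> indep B \<Longrightarrow> quarter * (int (card C + card F) - 1)
       \<le> (quarter + int D) * (int (card (unhit F B)) + int (card B) - 1)"
    "\<And>z. z \<in> C \<Longrightarrow> \<exists>B\<subseteq>C - {z}. indep B \<and> (\<forall>v\<in>C - B. \<exists>u\<in>B. E v u) \<and>
      (quarter + int D) * (int (card (unhit F B)) + int (card B) - 1)
       \<le> quarter * (int (card C + card F) - 1)"
proof -
  have fC: "finite C" using p finV finite_subset unfolding piece_def by blast
  have ab: "a + b = D" "\<And>u. u \<in> C \<Longrightarrow> card (N u \<inter> C) = a" using p by (auto simp: piece_def)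
  have card: "card (N u - C) = b" if "u \<in> C" for u
  proof -
    have "card (N u) = card (N u \<inter> C) + card (N u - C)"
      by (metis Int_Diff_disjoint Int_Diff_Un card_Un_disjoint finN finite_Diff finite_Int)
    then show ?thesis using deg ab that by auto
  qed
  then have card': "\<forall>u\<in>C. card (N u - C) = b" by blast
  note cu = card_unhit_piece[OF fC F card' disj]
  have cF: "card F = b * card C" using cu(2)[of "{}"] by simp
  have b1: "1 \<le> b" using piece_params[OF p] by simp
  obtain k where k: "\<And>B. B \<subseteq> C \<Longrightarrow> indep B \<Longrightarrow> card B \<le> k"
    "\<And>z. z \<in> C \<Longrightarrow> \<exists>B\<subseteq>C - {z}. indep B \<and> (\<forall>v\<in>C - B. \<exists>u\<in>B. E v u) \<and> card B = k"
    "(quarter + int D) * (int b * int (card C) - (int b - 1) * int k - 1) =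
      quarter * (int (card C) * (1 + int b) - 1)"
    using piece_independence[OF p] by blast
  have rhs: "quarter * (int (card C + card F) - 1) = quarter * (int (card C) * (1 + int b) - 1)"
    by (simp add: cF algebra_simps)
  have lhs: "int (card (unhit F B)) + int (card B) - 1 = int b * int (card C) - (int b - 1) * int (card B) - 1"
    if "B \<subseteq> C" for B
    using cu(1)[OF that] by (simp add: algebra_simps)
  show "quarter * (int (card C + card F) - 1)
       \<le> (quarter + int D) * (int (card (unhit F B)) + int (card B) - 1)"
    if "B \<subseteq> C" "indep B" for B
  proof -
    have "(int b - 1) * int (card B) \<le> (int b - 1) * int k"
      using k(1)[OF that] b1 by (intro mult_left_mono) auto
    then have "(quarter + int D) * (int b * int (card C) - (int b - 1) * int k - 1) \<le>
        (quarter + int D) * (int b * int (card C) - (int b - 1) * int (card B) - 1)"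
      by (intro mult_left_mono) auto
    then show ?thesis unfolding rhs lhs[OF that(1)] k(3) .
  qed
  show "\<exists>B\<subseteq>C - {z}. indep B \<and> (\<forall>v\<in>C - B. \<exists>u\<in>B. E v u) \<and>
      (quarter + int D) * (int (card (unhit F B)) + int (card B) - 1)
       \<le> quarter * (int (card C + card F) - 1)" if z: "z \<in> C" for z
  proof -
    obtain B where B: "B \<subseteq> C - {z}" "indep B" "\<forall>v\<in>C - B. \<exists>u\<in>B. E v u" "card B = k"
      using k(2)[OF z] by blast
    then have BC: "B \<subseteq> C" by blast
    have "(quarter + int D) * (int (card (unhit F B)) + int (card B) - 1)
       \<le> quarter * (int (card C + card F) - 1)"
    proof -
      have l: "int (card (unhit F B)) + int (card B) - 1 = int b * int (card C) - (int b - 1) * int k - 1"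
        using lhs[OF BC] unfolding B(4) .
      show ?thesis by (simp only: l rhs k(3) order_refl)
    qed
    then show ?thesis using B by blast
  qed
qed

text \<open>The parts share only \<open>w\<close>, so the vertex count minus 1 is additive, and the
  bounds show that the optimal size minus 1 is so too. For the upper bound the choice in
  \<open>C\<close> must avoid \<open>z\<close>, the only vertex of \<open>C\<close> adjacent to
  \<open>w\<close>.\<close>

lemma tight_value_attach:
  assumes tv: "tight_value W F" and fin: "finite W" "finite F" "finite C" "finite L"
    and CW: "C \<inter> W = {}" and FL: "F \<inter> L = {w}" and z: "z \<in> C"
    and lower: "\<And>B. B \<subseteq> C \<Longrightarrow> indep B \<Longrightarrow> quarter * (int (card C + card L) - 1)
       \<le> (quarter + int D) * (int (card (unhit L B)) + int (card B) - 1)"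
    and upper: "\<exists>B\<subseteq>C - {z}. indep B \<and> (\<forall>v\<in>C - B. \<exists>u\<in>B. E v u) \<and>
      (quarter + int D) * (int (card (unhit L B)) + int (card B) - 1)
       \<le> quarter * (int (card C + card L) - 1)"
    and cross: "\<And>u x. u \<in> C \<Longrightarrow> x \<in> F \<Longrightarrow> E u x \<Longrightarrow> u = z \<and> x = w"
      "\<And>q x. q \<in> W \<Longrightarrow> x \<in> L \<Longrightarrow> E q x \<Longrightarrow> x = w" "\<And>u q. u \<in> C \<Longrightarrow> q \<in> W \<Longrightarrow> \<not> E u q"
  shows "tight_value (C \<union> W) (L \<union> F)"
proof -
  define c where "c = quarter"
  have c0: "0 \<le> c" by (simp add: c_def)
  have fu: "finite (unhit X B)" if "finite X" for X B using that by (simp add: unhit_def)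
  have cCW: "card (C \<union> W) = card C + card W" using fin CW by (simp add: card_Un_disjoint)
  have "card (L \<union> F) + 1 = card L + card F"
    using card_Un_Int[of L F] fin FL by (simp add: Int_commute)
  then have cLF: "int (card (L \<union> F)) = int (card L) + int (card F) - 1" by linarith
  have total: "c * (int (card (C \<union> W) + card (L \<union> F)) - 1) + (c + int D) =
      c * (int (card W + card F) - 1) + (c + int D) + c * (int (card C + card L) - 1)"
    by (simp add: cCW cLF algebra_simps)
  have low: "c * (int (card (C \<union> W) + card (L \<union> F)) - 1) + (c + int D)
       \<le> (c + int D) * (int (card (unhit (L \<union> F) B)) + int (card B))"
    if B: "B \<subseteq> C \<union> W" "indep B" for B
  proof -
    let ?U1 = "unhit F (B \<inter> W)" and ?U2 = "unhit L (B \<inter> C)" and ?U = "unhit (L \<union> F) B"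
    have ind: "indep (B \<inter> W)" "indep (B \<inter> C)" using B(2) by (auto simp: indep_def)
    have "B = (B \<inter> C) \<union> (B \<inter> W)" using B(1) by blast
    moreover have "card ((B \<inter> C) \<union> (B \<inter> W)) = card (B \<inter> C) + card (B \<inter> W)"
      by (rule card_Un_disjoint) (use fin CW in auto)
    ultimately have cB: "card B = card (B \<inter> C) + card (B \<inter> W)" by simp
    have sub: "x \<in> ?U" if x: "x \<in> ?U1 \<union> ?U2" "x \<noteq> w" for x
    proof -
      have "\<not> E u x" if u: "u \<in> B" for u
      proof
        assume e: "E u x"
        consider "x \<in> ?U1" "u \<in> W" | "x \<in> ?U1" "u \<in> C" | "x \<in> ?U2" "u \<in> W" | "x \<in> ?U2" "u \<in> C"
          using x(1) u B(1) by blast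
        then show False
          using e u x(2) cross(1)[of u x] cross(2)[of u x] by cases (auto simp: unhit_def)
      qed
      then show ?thesis using x(1) by (auto simp: unhit_def)
    qed
    have both: "w \<in> ?U" if "w \<in> ?U1" "w \<in> ?U2"
      using that B(1) by (auto simp: unhit_def)
    have fU: "finite ?U" "finite ?U1" "finite ?U2" using fu fin by auto
    have "card ?U1 + card ?U2 = card (?U1 \<union> ?U2) + card (?U1 \<inter> ?U2)"
      using card_Un_Int fU by blast
    \<comment> \<open>If \<open>w\<close> is unhit from both sides it remains unhit and is counted
      twice; if it is unhit from one side only, it may be lost. In either case the deficit is at
      most one.\<close>
    also have "\<dots> \<le> card ?U + 1"
    proof (cases "w \<in> ?U1 \<inter> ?U2")
      case True
      then have "?U1 \<union> ?U2 \<subseteq> ?U" using sub both by blast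
      then have "card (?U1 \<union> ?U2) \<le> card ?U" by (rule card_mono[rotated]) (use fU in simp)
      moreover have "?U1 \<inter> ?U2 \<subseteq> {w}" using FL by (auto simp: unhit_def)
      then have "card (?U1 \<inter> ?U2) \<le> 1" using card_mono[of "{w}" "?U1 \<inter> ?U2"] by simp
      ultimately show ?thesis by simp
    next
      case False
      have "?U1 \<union> ?U2 \<subseteq> insert w ?U" using sub by blast
      then have "card (?U1 \<union> ?U2) \<le> card (insert w ?U)"
        by (rule card_mono[rotated]) (use fU in simp)
      also have "\<dots> \<le> card ?U + 1" using card_insert_le_m1[of "card ?U + 1" ?U w] by simp
      moreover have "?U1 \<inter> ?U2 = {}" using False FL by (auto simp: unhit_def)
      ultimately show ?thesis by simp
    qed
    finally have "int (card ?U1) + int (card ?U2) - 1 \<le> int (card ?U)" by linarith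
    then have "(c + int D) * ((int (card ?U1) + int (card (B \<inter> W))) + (int (card ?U2) + int (card (B \<inter> C)) - 1))
        \<le> (c + int D) * (int (card ?U) + int (card B))"
      using c0 cB by (intro mult_left_mono) auto
    moreover have "c * (int (card W + card F) - 1) + (c + int D) \<le>
        (c + int D) * (int (card ?U1) + int (card (B \<inter> W)))"
      using tv ind(1) unfolding tight_value_def c_def by blast
    moreover have "c * (int (card C + card L) - 1) \<le> (c + int D) * (int (card ?U2) + int (card (B \<inter> C)) - 1)"
      using lower[of "B \<inter> C"] ind(2) unfolding c_def by blast
    ultimately show ?thesis unfolding total by (simp only: distrib_left)
  qed
  obtain B1 where B1: "B1 \<subseteq> W" "indep B1" "\<forall>v\<in>W - B1. \<exists>u\<in>B1. E v u"
      "(c + int D) * (int (card (unhit F B1)) + int (card B1)) \<le> c * (int (card W + card F) - 1) + (c + int D)"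
    using tv unfolding tight_value_def c_def by blast
  obtain B2 where B2: "B2 \<subseteq> C - {z}" "indep B2" "\<forall>v\<in>C - B2. \<exists>u\<in>B2. E v u"
      "(c + int D) * (int (card (unhit L B2)) + int (card B2) - 1) \<le> c * (int (card C + card L) - 1)"
    using upper unfolding c_def by blast
  let ?B = "B2 \<union> B1"
  have iB: "indep ?B"
    unfolding indep_def
  proof (intro ballI notI)
    fix x y assume xy: "x \<in> ?B" "y \<in> ?B" "E x y"
    consider "x \<in> B1" "y \<in> B1" | "x \<in> B2" "y \<in> B2" | "x \<in> B1" "y \<in> B2" | "x \<in> B2" "y \<in> B1"
      using xy by blast
    then show False
    proof cases
      case 3
      then have "x \<in> W" "y \<in> C" using B1(1) B2(1) by auto
      then show False using cross(3)[of y x] E_sym[OF xy(3)] by blast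
    next
      case 4
      then have "x \<in> C" "y \<in> W" using B1(1) B2(1) by auto
      then show False using cross(3)[of x y] xy(3) by blast
    qed (use xy(3) B1(2) B2(2) in \<open>auto simp: indep_def\<close>)
  qed
  have dB: "\<exists>u\<in>?B. E v u" if "v \<in> C \<union> W - ?B" for v
    using that B1(3) B2(3) by blast
  \<comment> \<open>The choice \<open>B2\<close> leaves \<open>w\<close> unhit, so \<open>w\<close>
    is counted for \<open>L\<close> and can be subtracted there; whether it is needed is decided by
    \<open>B1\<close> alone.\<close>
  have wU: "w \<in> unhit L B2"
  proof -
    have "\<not> E u w" if "u \<in> B2" for u using cross(1)[of u w] FL that B2(1) by blast
    then show ?thesis using FL by (auto simp: unhit_def)
  qed
  have "unhit (L \<union> F) ?B \<subseteq> unhit F B1 \<union> (unhit L B2 - {w})"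
    using FL by (auto simp: unhit_def)
  then have "card (unhit (L \<union> F) ?B) \<le> card (unhit F B1 \<union> (unhit L B2 - {w}))"
    using fu fin by (intro card_mono) auto
  also have "\<dots> \<le> card (unhit F B1) + card (unhit L B2 - {w})" by (rule card_Un_le)
  finally have "int (card (unhit (L \<union> F) ?B)) \<le> int (card (unhit F B1)) + int (card (unhit L B2)) - 1"
    using card_Suc_Diff1[OF fu[OF fin(4)] wU] by linarith
  moreover have "card ?B \<le> card B1 + card B2" using card_Un_le[of B2 B1] by simp
  ultimately have "(c + int D) * (int (card (unhit (L \<union> F) ?B)) + int (card ?B)) \<le>
      (c + int D) * ((int (card (unhit F B1)) + int (card B1)) + (int (card (unhit L B2)) + int (card B2) - 1))"
    using c0 by (intro mult_left_mono) auto
  then have up: "(c + int D) * (int (card (unhit (L \<union> F) ?B)) + int (card ?B)) \<le>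
      c * (int (card (C \<union> W) + card (L \<union> F)) - 1) + (c + int D)"
    using B1(4) B2(4) unfolding total by (simp only: distrib_left)
  have "?B \<subseteq> C \<union> W" using B1(1) B2(1) by blast
  then have ex: "\<exists>B\<subseteq>C \<union> W. indep B \<and> (\<forall>v\<in>C \<union> W - B. \<exists>u\<in>B. E v u) \<and>
      (c + int D) * (int (card (unhit (L \<union> F) B)) + int (card B)) \<le>
      c * (int (card (C \<union> W) + card (L \<union> F)) - 1) + (c + int D)"
    using iB dB up by (intro exI[of _ ?B] conjI ballI)
  show ?thesis
    unfolding tight_value_def c_def[symmetric] using low ex by (intro conjI allI impI) 
qed

text \<open>Pieces are attached to a maximal connected union. An edge leaving it leads from an outer
  vertex \<open>w\<close> to a new piece, and as no cycle passes through \<open>w\<close>, the new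
  piece meets the old part in \<open>w\<close> only.\<close>

lemma special_value:
  assumes conn: "cset V" and V0: "V \<noteq> {}"
    and pieces: "\<And>C. C \<in> \<C> \<Longrightarrow> \<exists>a b. piece a b C"
    and deg: "\<And>C u. C \<in> \<C> \<Longrightarrow> u \<in> C \<Longrightarrow> card (N u) = D"
    and closed: "\<And>C u. C \<in> \<C> \<Longrightarrow> u \<in> C \<Longrightarrow> N u \<inter> \<Union>\<C> \<subseteq> C"
    and ind: "indep (V - \<Union>\<C>)" and acyc: "\<And>w. w \<in> V - \<Union>\<C> \<Longrightarrow> \<not> cyc w"
  shows "tight_value (\<Union>\<C>) (V - \<Union>\<C>)"
proof -
  have csetC: "cset C" "C \<noteq> {}" "C \<subseteq> V" if "C \<in> \<C>" for C
    using pieces[OF that] by (auto simp: piece_def)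
  have closed': "x \<in> C" if "C \<in> \<C>" "u \<in> C" "E u x" "x \<in> \<Union>\<C>" for C u x
  proof -
    have "x \<in> N u \<inter> \<Union>\<C>" using that by simp
    then show ?thesis using closed[OF that(1,2)] by blast
  qed
  have WV: "\<Union>\<C> \<subseteq> V" using csetC(3) by blast
  define Fr where "Fr = (\<lambda>\<D>. (\<Union>u\<in>\<Union>\<D>. N u) - \<Union>\<C>)"
  have FrV: "Fr \<D> \<subseteq> V - \<Union>\<C>" for \<D> using N_subset by (auto simp: Fr_def dest: E_dom2)
  have Fr1: "Fr {C} = (\<Union>u\<in>C. N u - C)" if "C \<in> \<C>" for C
    using closed[OF that] that by (auto simp: Fr_def)
  have NC: "N u \<subseteq> C \<union> Fr {C}" if "C \<in> \<C>" "u \<in> C" for C u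
    using Fr1[OF that(1)] that by blast
  \<comment> \<open>A common outer neighbour of two vertices of \<open>C\<close> would lie on a
    cycle running through the connected set \<open>C\<close>.\<close>
  have disj: "\<forall>u\<in>C. \<forall>u'\<in>C. u \<noteq> u' \<longrightarrow> (N u - C) \<inter> (N u' - C) = {}" if C: "C \<in> \<C>" for C
  proof (intro ballI impI)
    fix u u' assume u: "u \<in> C" "u' \<in> C" "u \<noteq> u'"
    show "(N u - C) \<inter> (N u' - C) = {}"
    proof (rule ccontr)
      assume "(N u - C) \<inter> (N u' - C) \<noteq> {}"
      then obtain x where x: "E u x" "E u' x" "x \<notin> C" by auto
      then have "x \<in> Fr {C}" using Fr1[OF C] u by auto
      then have xI: "x \<in> V - \<Union>\<C>" using FrV by blast
      have "lnk C u u'" using csetC(1)[OF C] u by (simp add: cset_def)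
      then have "lnk (V - {x}) u u'" by (rule lnk_mono) (use csetC(3)[OF C] x in auto)
      then have "cyc x" unfolding cyc_def using u(3) E_sym x by blast
      then show False using acyc xI by blast
    qed
  qed
  have val1: "quarter * (int (card C + card (Fr {C})) - 1)
       \<le> (quarter + int D) * (int (card (unhit (Fr {C}) B)) + int (card B) - 1)"
    if C: "C \<in> \<C>" "B \<subseteq> C" "indep B" for C B
  proof -
    obtain a b where p: "piece a b C" using pieces[OF C(1)] by blast
    show ?thesis
      by (rule piece_value(1)[OF p Fr1[OF C(1)] deg[OF C(1)] disj[OF C(1)] C(2,3)])
  qed
  have val2: "\<exists>B\<subseteq>C - {z}. indep B \<and> (\<forall>v\<in>C - B. \<exists>u\<in>B. E v u) \<and>
      (quarter + int D) * (int (card (unhit (Fr {C}) B)) + int (card B) - 1)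
       \<le> quarter * (int (card C + card (Fr {C})) - 1)" if C: "C \<in> \<C>" "z \<in> C" for C z
  proof -
    obtain a b where p: "piece a b C" using pieces[OF C(1)] by blast
    show ?thesis
      by (rule piece_value(2)[OF p Fr1[OF C(1)] deg[OF C(1)] disj[OF C(1)] C(2)])
  qed
  show ?thesis
  proof (cases "\<C> = {}")
    case True
    \<comment> \<open>Without pieces the graph is a connected independent set, that is, a single
      vertex, and the claimed value is 1.\<close>
    obtain x where x: "x \<in> V" using V0 by blast
    have "V \<subseteq> {x}"
      by (rule cset_subset[OF conn x]) (use ind True in \<open>auto simp: indep_def\<close>)
    then have V: "V = {x}" using x by blast
    have "unhit {x} {} = {x}" by (simp add: unhit_def)
    then show ?thesis using True V by (auto simp: tight_value_def indep_def)
  next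
    case False
    define Q where "Q = (\<lambda>\<D>. \<D> \<subseteq> \<C> \<and> \<D> \<noteq> {} \<and> cset (\<Union>\<D> \<union> Fr \<D>) \<and> tight_value (\<Union>\<D>) (Fr \<D>))"
    have csetCF: "cset (C \<union> Fr {C})" if C: "C \<in> \<C>" for C
    proof -
      obtain x where x: "x \<in> C" using csetC(2)[OF C] by blast
      have lk: "lnk (C \<union> Fr {C}) x y" if "y \<in> C" for y
        using csetC(1)[OF C] x that lnk_mono[of C x y] by (auto simp: cset_def)
      show ?thesis
      proof (rule csetI[of _ x])
        fix y assume "y \<in> C \<union> Fr {C}"
        then show "lnk (C \<union> Fr {C}) x y"
        proof
          assume y: "y \<in> Fr {C}"
          then obtain u where "u \<in> C" "E u y" by (auto simp: Fr_def)
          then show ?thesis using lk lnk_step y by blast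
        qed (rule lk)
      qed (use x in simp)
    qed
    obtain C0 where C0: "C0 \<in> \<C>" using False by blast
    have "tight_value C0 (Fr {C0})"
    proof -
      obtain z0 where z0: "z0 \<in> C0" using csetC(2)[OF C0] by blast
      obtain B where B: "B \<subseteq> C0" "indep B" "\<forall>v\<in>C0 - B. \<exists>u\<in>B. E v u"
        "(quarter + int D) * (int (card (unhit (Fr {C0}) B)) + int (card B) - 1)
          \<le> quarter * (int (card C0 + card (Fr {C0})) - 1)"
        using val2[OF C0 z0] by (meson Diff_subset subset_trans)
      have shift: "p * (q + r) = p * (q + r - 1) + p" for p q r :: int by (simp add: algebra_simps)
      show ?thesis
        unfolding tight_value_def shift
      proof (intro conjI allI impI)
        fix B' assume "B' \<subseteq> C0" "indep B'"
        then show "quarter * (int (card C0 + card (Fr {C0})) - 1) + (quarter + int D)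
          \<le> (quarter + int D) * (int (card (unhit (Fr {C0}) B')) + int (card B') - 1) +
            (quarter + int D)"
          using val1[OF C0, of B'] by simp
      next
        show "\<exists>B\<subseteq>C0. indep B \<and> (\<forall>v\<in>C0 - B. \<exists>u\<in>B. E v u) \<and>
          (quarter + int D) * (int (card (unhit (Fr {C0}) B)) + int (card B) - 1) +
            (quarter + int D)
          \<le> quarter * (int (card C0 + card (Fr {C0})) - 1) + (quarter + int D)"
          using B by (intro exI[of _ B]) simp
      qed
    qed
    then have Q0: "Q {C0}" using C0 csetCF[OF C0] by (simp add: Q_def)
    have "finite {\<D>. Q \<D>}"
    proof (rule finite_subset)
      show "{\<D>. Q \<D>} \<subseteq> Pow (Pow V)" using csetC(3) by (auto simp: Q_def)
    qed (use finV in simp)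
    then obtain \<D> where QD: "Q \<D>" and max: "\<And>\<D>'. Q \<D>' \<Longrightarrow> \<D> \<subseteq> \<D>' \<Longrightarrow> \<D> = \<D>'"
      using finite_has_maximal[of "{\<D>. Q \<D>}"] Q0 by blast
    let ?W = "\<Union>\<D>" and ?F = "Fr \<D>"
    have D: "\<D> \<subseteq> \<C>" "\<D> \<noteq> {}" "cset (?W \<union> ?F)" "tight_value ?W ?F" using QD by (auto simp: Q_def)
    have DV: "?W \<subseteq> V" "?W \<subseteq> \<Union>\<C>" using D WV by blast+
    have "V \<subseteq> ?W \<union> ?F"
    proof (rule ccontr)
      assume "\<not> V \<subseteq> ?W \<union> ?F"
      moreover obtain y where y: "y \<in> ?W" using D csetC(2) by blast
      ultimately obtain u x where ux: "u \<in> ?W \<union> ?F" "x \<in> V" "E u x" "x \<notin> ?W \<union> ?F"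
        using cset_subset[OF conn, of y "?W \<union> ?F"] DV by blast
      \<comment> \<open>All neighbours of the pieces in \<open>\<D>\<close> already belong to the
        union, so an edge leaving it starts in the fringe.\<close>
      have "u \<in> ?F"
      proof (rule ccontr)
        assume "u \<notin> ?F"
        then have uW: "u \<in> ?W" using ux by blast
        then obtain C where C: "C \<in> \<D>" "u \<in> C" by blast
        show False
        proof (cases "x \<in> \<Union>\<C>")
          case True
          then have "x \<in> C" using closed'[of C u x] C D(1) ux(3) by blast
          then show False using C ux(4) by blast
        next
          case False
          then have "x \<in> ?F" using uW ux(3) by (auto simp: Fr_def)
          then show False using ux(4) by blast
        qed
      qed
      define w z where "w = u" and "z = x"
      have w: "w \<in> ?F" "w \<in> V - \<Union>\<C>" "E w z" "z \<notin> ?W" "z \<notin> ?F" "w \<in> V"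
        using \<open>u \<in> ?F\<close> ux FrV by (auto simp: w_def z_def)
      have "z \<in> \<Union>\<C>"
      proof (rule ccontr)
        assume "z \<notin> \<Union>\<C>"
        then have "z \<in> V - \<Union>\<C>" using ux(2) by (simp add: z_def)
        then show False using ind w unfolding indep_def by blast
      qed
      then obtain C where C: "C \<in> \<C>" "z \<in> C" by blast
      let ?L = "Fr {C}"
      have CW: "C \<inter> ?W = {}"
      proof (rule ccontr)
        assume "C \<inter> ?W \<noteq> {}"
        then obtain q C2 where q: "q \<in> C" "C2 \<in> \<D>" "q \<in> C2" by blast
        have "C \<subseteq> C2"
        proof (rule cset_subset[OF csetC(1)[OF C(1)] q(1,3)])
          fix s t assume "s \<in> C2" "s \<in> C" "t \<in> C" "E s t"
          then show "t \<in> C2" using closed'[of C2 s t] q(2) D(1) C(1) by blast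
        qed
        then show False using C(2) q(2) w(4) by blast
      qed
      have wC: "w \<notin> C" using w(2) C by blast
      have CV: "C \<subseteq> V" using csetC(3) C by blast
      have lC: "lnk (V - {w}) z s" if "s \<in> C" for s
      proof -
        have "lnk C z s" using csetC(1)[OF C(1)] C(2) that by (simp add: cset_def)
        then show ?thesis by (rule lnk_mono) (use CV wC in auto)
      qed
      have nocyc: "s = z" if "lnk (V - {w}) z s" "E w s" for s
      proof (rule ccontr)
        assume "s \<noteq> z"
        then have "cyc w" unfolding cyc_def using w(3) that by (intro exI[of _ z] exI[of _ s]) simp
        then show False using acyc[OF w(2)] by simp
      qed
      have one: "s = z \<and> y = w" if s: "s \<in> C" "y \<in> ?F" "E s y" for s y
      proof (cases "y = w")
        case True
        then show ?thesis using nocyc[OF lC[OF s(1)]] E_sym[OF s(3)] by simp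
      next
        case False
        \<comment> \<open>Suppose \<open>C\<close> also touches the old part at \<open>y\<close>.
          The old vertices linked to \<open>z\<close> without \<open>w\<close> include
          \<open>y\<close> and are closed in the old part: a step from \<open>t\<close> to
          \<open>w\<close> would give \<open>t = z\<close> by \<open>nocyc\<close>, but
          \<open>z\<close> is new. So they would include \<open>w\<close> itself.\<close>
        define A where "A = {t. lnk (V - {w}) z t} \<inter> (?W \<union> ?F)"
        have FV: "?F \<subseteq> V" using FrV by blast
        have yA: "y \<in> A" using lnk_step[OF lC[OF s(1)] s(3)] False s(2) FV by (auto simp: A_def)
        have "?W \<union> ?F \<subseteq> A"
        proof (rule cset_subset[OF D(3) _ yA])
          show "y \<in> ?W \<union> ?F" using s by blast
          fix t r assume tr: "t \<in> A" "r \<in> ?W \<union> ?F" "E t r"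
          have "r \<noteq> w"
          proof
            assume "r = w"
            then have "t = z" using nocyc[of t] tr(1) E_sym[OF tr(3)] by (simp add: A_def)
            then show False using tr(1) w by (auto simp: A_def)
          qed
          moreover have "r \<in> V" using tr(2) DV FV by blast
          ultimately have "lnk (V - {w}) z r" 
            using tr(1) lnk_step[OF _ tr(3)] by (simp add: A_def)
          then show "r \<in> A" using tr by (simp add: A_def)
        qed
        then have "lnk (V - {w}) z w" using w(1) by (auto simp: A_def)
        moreover have "z \<in> V - {w}" using C CV wC by auto
        ultimately have "w \<in> V - {w}" by (rule lnk_in)
        then show ?thesis by blast
      qed
      have zL: "w \<in> ?L" using E_sym[OF w(3)] C w(2) by (auto simp: Fr_def)
      have FL: "?F \<inter> ?L = {w}"
      proof
        show "?F \<inter> ?L \<subseteq> {w}"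
        proof
          fix y assume y: "y \<in> ?F \<inter> ?L"
          then obtain s where "s \<in> C" "E s y" by (auto simp: Fr_def)
          then show "y \<in> {w}" using one[of s y] y by blast
        qed
      qed (use zL w in blast)
      have FrD: "Fr (insert C \<D>) = ?L \<union> ?F" by (auto simp: Fr_def)
      have WD: "\<Union>(insert C \<D>) = C \<union> ?W" by simp
      have fin: "finite ?W" "finite ?F" "finite C" "finite ?L"
        using finV DV FrV CV finite_subset by (meson Diff_subset subset_trans)+
      have "tight_value (C \<union> ?W) (?L \<union> ?F)"
      proof (rule tight_value_attach[OF D(4) fin CW FL C(2)])
        show "s = z \<and> y = w" if "s \<in> C" "y \<in> ?F" "E s y" for s y by (rule one[OF that])
        show "y = w" if "q \<in> ?W" "y \<in> ?L" "E q y" for q y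
        proof -
          have "y \<in> ?F" using that by (auto simp: Fr_def)
          then show ?thesis using FL that(2) by blast
        qed
        show "\<not> E s q" if "s \<in> C" "q \<in> ?W" for s q
        proof
          assume "E s q"
          then have "q \<in> C" using closed'[OF C(1) that(1)] DV(2) that(2) by blast
          then show False using CW that(2) by blast
        qed
      qed (rule val1[OF C(1)] val2[OF C]; assumption?)+
      moreover have "cset ((?W \<union> ?F) \<union> (C \<union> ?L))"
        by (rule cset_Un[OF D(3) csetCF[OF C(1)] _ _ w(3)]) (use w C in blast)+
      moreover have "(?W \<union> ?F) \<union> (C \<union> ?L) = (C \<union> ?W) \<union> (?L \<union> ?F)" by blast
      ultimately have "Q (insert C \<D>)" unfolding Q_def FrD WD using C(1) D(1) by simp
      then have "\<D> = insert C \<D>" using max by blast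
      then show False using C w(4) by blast
    qed
    then have "?F = V - \<Union>\<C>" "?W = \<Union>\<C>" using FrV[of \<D>] DV WV by blast+
    then show ?thesis using D(4) by simp
  qed
qed

lemma ids_value:
  assumes tv: "tight_value W (V - W)" and WV: "W \<subseteq> V" and ind: "indep (V - W)"
  shows "\<And>S. ids S \<Longrightarrow> quarter * (int (card V) - 1) + (quarter + int D)
      \<le> (quarter + int D) * int (card S)"
    "\<exists>S. ids S \<and> (quarter + int D) * int (card S)
      \<le> quarter * (int (card V) - 1) + (quarter + int D)"
proof -
  have fin: "finite W" "finite (V - W)" using finV WV finite_subset by auto
  have cV: "card W + card (V - W) = card V"
    using card_Un_disjoint[of W "V - W"] fin WV by (simp add: Un_absorb1)
  have csum: "card (B \<union> unhit (V - W) B) = card B + card (unhit (V - W) B)" if "B \<subseteq> W" for B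
    by (rule card_Un_disjoint) (use that fin finite_subset in \<open>auto simp: unhit_def\<close>)
  show "quarter * (int (card V) - 1) + (quarter + int D)
      \<le> (quarter + int D) * int (card S)" if S: "ids S" for S
  proof -
    have S': "S \<subseteq> V" "indep S" "\<And>v. v \<in> V - S \<Longrightarrow> \<exists>u\<in>S. E v u" using S by (auto simp: ids_def)
    \<comment> \<open>As \<open>V - W\<close> is independent, a vertex outside \<open>W\<close> can
      be dominated only from \<open>W\<close>, and so belongs to \<open>S\<close> exactly when no
      vertex of \<open>S \<inter> W\<close> hits it.\<close>
    have "S = (S \<inter> W) \<union> unhit (V - W) (S \<inter> W)"
    proof
      show "S \<subseteq> (S \<inter> W) \<union> unhit (V - W) (S \<inter> W)"
        using S' unfolding unhit_def indep_def by blast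
      show "(S \<inter> W) \<union> unhit (V - W) (S \<inter> W) \<subseteq> S"
      proof
        fix x assume "x \<in> (S \<inter> W) \<union> unhit (V - W) (S \<inter> W)"
        then consider "x \<in> S" | "x \<in> V - W" "\<forall>u\<in>S \<inter> W. \<not> E u x" by (auto simp: unhit_def)
        then show "x \<in> S"
        proof cases
          case 2
          show ?thesis
          proof (rule ccontr)
            assume "x \<notin> S"
            then obtain u where u: "u \<in> S" "E x u" using S'(3) 2 by blast
            then have "u \<notin> W" using 2 E_sym by blast
            then have "u \<in> V - W" using u S' by blast
            then show False using ind 2 u(2) unfolding indep_def by blast
          qed
        qed
      qed
    qed
    then have "card S = card (S \<inter> W) + card (unhit (V - W) (S \<inter> W))"
      using csum[of "S \<inter> W"] by simp
    moreover have "indep (S \<inter> W)" using S'(2) unfolding indep_def by blast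
    ultimately show ?thesis
      using tv unfolding tight_value_def cV by (metis add.commute inf_le2 of_nat_add)
  qed
  obtain B where B: "B \<subseteq> W" "indep B" "\<forall>v\<in>W - B. \<exists>u\<in>B. E v u"
    "(quarter + int D) * (int (card (unhit (V - W) B)) + int (card B))
       \<le> quarter * (int (card V) - 1) + (quarter + int D)"
    using tv unfolding tight_value_def cV by blast
  let ?S = "B \<union> unhit (V - W) B"
  have "ids ?S"
    unfolding ids_def
  proof (intro conjI ballI)
    show "?S \<subseteq> V" using B(1) WV by (auto simp: unhit_def)
    show "indep ?S"
      unfolding indep_def
    proof (intro ballI notI)
      fix x y assume xy: "x \<in> ?S" "y \<in> ?S" "E x y"
      then show False
        using B(2) ind E_sym[OF xy(3)] unfolding indep_def unhit_def by blast
    qed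
    fix v assume v: "v \<in> V - ?S"
    show "\<exists>u\<in>?S. E v u"
    proof (cases "v \<in> W")
      case True
      then show ?thesis using B(3) v by blast
    next
      case False
      then show ?thesis using v E_sym unfolding unhit_def by blast
    qed
  qed
  then show "\<exists>S. ids S \<and> (quarter + int D) * int (card S)
      \<le> quarter * (int (card V) - 1) + (quarter + int D)"
    using B(4) csum[OF B(1)] by (intro exI[of _ ?S]) (simp add: add.commute)
qed

end

section \<open>Graphs as symmetric digraphs\<close>

locale bounded_graph = Digraph.graph G for G :: "('a, 'b) pre_digraph" (structure) +
  fixes \<Delta> :: nat
  assumes \<Delta>4: "4 \<le> \<Delta>" and out_degree_le: "v \<in> verts G \<Longrightarrow> out_degree G v \<le> \<Delta>"
begin

sublocale ugraph "verts G" "\<lambda>u v. u \<rightarrow>\<^bsub>G\<^esub> v"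
proof
  show "finite (verts G)" by simp
  show "y \<rightarrow>\<^bsub>G\<^esub> x" if "x \<rightarrow>\<^bsub>G\<^esub> y" for x y using that graph_symmetric by blast
  show "\<not> x \<rightarrow>\<^bsub>G\<^esub> x" for x using adj_not_same by blast
  show "x \<in> verts G" if "x \<rightarrow>\<^bsub>G\<^esub> y" for x y using that adj_in_verts by blast
qed

lemma out_degree_eq: "out_degree G v = card (N v)"
proof -
  have "N v = {u. (v, u) \<in> arcs_ends G}" by auto
  also have "\<dots> = head G ` out_arcs G v" unfolding arcs_ends_conv out_arcs_def by auto
  finally have "N v = head G ` out_arcs G v" .
  moreover have "inj_on (head G) (out_arcs G v)"
    by (rule inj_onI) (auto simp: arc_to_ends_def intro: no_multi_arcs)
  ultimately show ?thesis by (simp add: card_image out_degree_def)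
qed

sublocale dgraph "verts G" "\<lambda>u v. u \<rightarrow>\<^bsub>G\<^esub> v" \<Delta>
  by unfold_locales (use \<Delta>4 out_degree_le in \<open>auto simp: out_degree_eq\<close>)

text \<open>\<open>H\<close> may have a different type of arcs, because \<open>connected\<close> is
  defined through \<open>mk_symmetric G\<close>, whose arcs are pairs of vertices.\<close>

lemma strongly_connected_iff_cset:
  assumes H: "wf_digraph H" "verts H \<subseteq> verts G"
    and adj: "\<And>u v. u \<rightarrow>\<^bsub>H\<^esub> v \<longleftrightarrow> u \<rightarrow>\<^bsub>G\<^esub> v \<and> u \<in> verts H \<and> v \<in> verts H"
  shows "strongly_connected H \<longleftrightarrow> verts H \<noteq> {} \<and> cset (verts H)"
proof -
  interpret H: wf_digraph H by (rule H)
  have "lnk (verts H) u v" if "u \<rightarrow>\<^sup>*\<^bsub>H\<^esub> v" for u v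
    using that
  proof (induction rule: H.reachable_induct)
    case (step x y)
    then show ?case using lnk_step adj by blast
  qed simp
  moreover have "u \<rightarrow>\<^sup>*\<^bsub>H\<^esub> v" if "lnk (verts H) u v" "u \<in> verts H" for u v
  proof -
    have "v \<in> {v. u \<rightarrow>\<^sup>*\<^bsub>H\<^esub> v}"
    proof (rule lnk_induct[OF that(1)])
      show "u \<in> {v. u \<rightarrow>\<^sup>*\<^bsub>H\<^esub> v}" using that(2) by simp
      fix x w assume x: "x \<in> {v. u \<rightarrow>\<^sup>*\<^bsub>H\<^esub> v}" "w \<in> verts H" "x \<rightarrow>\<^bsub>G\<^esub> w"
      then have "x \<in> verts H" using H.reachable_in_verts by blast
      then have "x \<rightarrow>\<^bsub>H\<^esub> w" using adj x by blast
      then show "w \<in> {v. u \<rightarrow>\<^sup>*\<^bsub>H\<^esub> v}" using x(1) H.reachable_adj_trans by blast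
    qed
    then show ?thesis by simp
  qed
  ultimately show ?thesis by (auto simp: strongly_connected_def cset_def)
qed

lemma induce_adj: "u \<rightarrow>\<^bsub>G \<restriction> X\<^esub> v \<longleftrightarrow> u \<rightarrow>\<^bsub>G\<^esub> v \<and> u \<in> X \<and> v \<in> X"
  by (auto simp: arcs_ends_conv)

lemma connected_iff_cset: "Digraph_Component.connected G \<longleftrightarrow> verts G \<noteq> {} \<and> cset (verts G)"
proof -
  have "arcs_ends (with_proj (mk_symmetric G)) = arcs_ends G"
    using adj_mk_symmetric_eq[OF sym_arcs] by simp
  moreover have "wf_digraph (with_proj (mk_symmetric G))"
    using wellformed_mk_symmetric wf_digraph_wp_iff by blast
  moreover have "(u, v) \<in> arcs_ends G \<longleftrightarrow> (u, v) \<in> arcs_ends G \<and> u \<in> verts G \<and> v \<in> verts G" for u v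
    using adj_in_verts by blast
  ultimately show ?thesis
    unfolding connected_def
    using strongly_connected_iff_cset[of "with_proj (mk_symmetric G)"] by simp
qed

section \<open>Vertices on cycles\<close>

lemma cyc_in_verts: "cyc v \<Longrightarrow> v \<in> verts G"
  using E_dom by (auto simp: cyc_def)

lemma cas_nth:
  assumes "cas u p v" "Suc i < length p"
  shows "head G (p ! i) = tail G (p ! Suc i)"
  using assms
proof (induction p arbitrary: u i)
  case (Cons e p)
  show ?case
  proof (cases i)
    case 0
    then show ?thesis using Cons.prems by (cases p) auto
  next
    case (Suc j)
    then show ?thesis using Cons.IH[of "head G e" j] Cons.prems by simp
  qed
qed simp

lemma cas_last: "cas u p v \<Longrightarrow> p \<noteq> [] \<Longrightarrow> tail G (p ! 0) = u \<and> head G (p ! (length p - 1)) = v"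
proof (induction p arbitrary: u)
  case (Cons e p)
  then show ?case by (cases p) auto
qed simp

text \<open>Removing \<open>v\<close> from a cycle leaves a path between its two neighbours on the
  cycle, which are distinct as the length is at least 3. Conversely, a simple path from
  \<open>z\<close> to \<open>z'\<close> avoiding \<open>v\<close> closes up through
  \<open>v\<close>.\<close>

lemma cycle_verts_iff: "v \<in> cycle_verts G \<longleftrightarrow> cyc v"
proof
  assume "v \<in> cycle_verts G"
  then obtain p where p: "cycle p" "3 \<le> length p" "v \<in> tail G ` set p"
    by (auto simp: cycle_verts_def)
  obtain u where u: "awalk u p u" "distinct (tl (awalk_verts u p))" "p \<noteq> []"
    using p(1) by (auto simp: cycle_def)
  define n where "n = length p"
  define T where "T = (\<lambda>i. tail G (p ! (i mod n)))"
  have n: "3 \<le> n" using p by (simp add: n_def)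
  have cas: "cas u p u" "set p \<subseteq> arcs G" using u by (auto simp: awalk_def)
  have adj: "T i \<rightarrow>\<^bsub>G\<^esub> T (Suc i)" for i
  proof -
    have i: "i mod n < n" using n by simp
    have "p ! (i mod n) \<in> arcs G" using cas(2) i by (auto simp: n_def)
    moreover have "head G (p ! (i mod n)) = T (Suc i)"
    proof (cases "Suc (i mod n) < n")
      case True
      then have "Suc i mod n = Suc (i mod n)" by (simp add: mod_Suc)
      then show ?thesis using cas_nth[OF cas(1)] True by (simp add: T_def n_def)
    next
      case False
      then have "i mod n = n - 1" "Suc i mod n = 0" using i by (auto simp: mod_Suc)
      then show ?thesis using cas_last[OF cas(1) u(3)] by (simp add: T_def n_def)
    qed
    ultimately show ?thesis by (auto simp: T_def arcs_ends_conv)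
  qed
  \<comment> \<open>\<open>tl\<close> removes the first occurrence of \<open>u\<close> and keeps the
    last one, so the tails of all arcs are pairwise distinct.\<close>
  have "awalk_verts u p = map (tail G) p @ [u]"
    using awalk_verts_conv[of u p] u(3) cas_last[OF cas(1) u(3)] by (simp add: last_conv_nth)
  moreover obtain e q where "p = e # q" using u(3) by (cases p) auto
  ultimately have "distinct (map (tail G) p)"
    using u(2) cas_last[OF cas(1) u(3)] by auto
  then have inj: "tail G (p ! i) = tail G (p ! j) \<longleftrightarrow> i = j" if "i < n" "j < n" for i j
    using that by (metis distinct_conv_nth length_map n_def nth_map)
  then have Tinj: "T i = T j \<longleftrightarrow> i mod n = j mod n" for i j using n by (simp add: T_def)
  obtain k where k: "k < n" "v = T k" using p(3) by (auto simp: T_def n_def in_set_conv_nth)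
  \<comment> \<open>The indices from \<open>k + 1\<close> to \<open>k + n - 1\<close> run once
    around the cycle and stop just before returning to \<open>v\<close>.\<close>
  have far: "T (k + 1 + j) \<noteq> v" if "j \<le> n - 2" for j
  proof
    assume "T (k + 1 + j) = v"
    then have "(k + (1 + j)) mod n = k mod n" using k Tinj by (simp add: add.assoc)
    then have "n dvd 1 + j" by (metis add_diff_cancel_left' le_add1 mod_eq_dvd_iff_nat)
    then show False using that n by (auto dest: dvd_imp_le)
  qed
  have walk: "lnk (verts G - {v}) (T (k + 1)) (T (k + 1 + j))" if "j \<le> n - 2" for j
    using that
  proof (induction j)
    case (Suc j)
    have "T (k + 1 + j) \<rightarrow>\<^bsub>G\<^esub> T (k + 1 + Suc j)" using adj[of "k + 1 + j"] by simp
    moreover have "T (k + 1 + Suc j) \<in> verts G - {v}" using far[OF Suc.prems] E_dom2[OF calculation] by simp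
    ultimately show ?case using Suc lnk_step by auto
  qed simp
  have last: "k + 1 + (n - 2) = k + (n - 1)" using n by arith
  have lk: "lnk (verts G - {v}) (T (k + 1)) (T (k + (n - 1)))"
    using walk[of "n - 2"] unfolding last by simp
  have "T (k + (n - 1)) \<rightarrow>\<^bsub>G\<^esub> T (k + n)" using adj[of "k + (n - 1)"] n by simp
  moreover have "T (k + n) = v" using k by (simp add: Tinj)
  ultimately have "v \<rightarrow>\<^bsub>G\<^esub> T (k + (n - 1))" using E_sym by simp
  moreover have "v \<rightarrow>\<^bsub>G\<^esub> T (k + 1)" using adj[of k] k by simp
  moreover have "T (k + 1) \<noteq> T (k + (n - 1))"
  proof
    assume "T (k + 1) = T (k + (n - 1))"
    then have "(k + 1 + (n - 2)) mod n = (k + 1) mod n" unfolding last using Tinj by metis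
    then have "n dvd n - 2" by (metis add_diff_cancel_left' le_add1 mod_eq_dvd_iff_nat)
    then show False using n by (auto dest: dvd_imp_le)
  qed
  ultimately show "cyc v" using lk unfolding cyc_def by blast
next
  assume "cyc v"
  then obtain z z' where z: "z \<noteq> z'" "v \<rightarrow>\<^bsub>G\<^esub> z" "v \<rightarrow>\<^bsub>G\<^esub> z'" "lnk (verts G - {v}) z z'"
    by (auto simp: cyc_def)
  let ?X = "verts G - {v}"
  let ?H = "G \<restriction> ?X"
  interpret H: wf_digraph ?H by (rule wellformed_induce_subgraph)
  have zX: "z \<in> ?X" using z E_dom2 E_irrefl by blast
  have "z' \<in> {y. z \<rightarrow>\<^sup>*\<^bsub>?H\<^esub> y}"
  proof (rule lnk_induct[OF z(4)])
    show "z \<in> {y. z \<rightarrow>\<^sup>*\<^bsub>?H\<^esub> y}" using H.reachable_refl[of z] zX by simp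
    fix x w assume x: "x \<in> {y. z \<rightarrow>\<^sup>*\<^bsub>?H\<^esub> y}" "w \<in> ?X" "x \<rightarrow>\<^bsub>G\<^esub> w"
    then have "x \<in> verts ?H" using H.reachable_in_verts(2)[of z x] by simp
    then have "x \<in> ?X" by simp
    then have "x \<rightarrow>\<^bsub>?H\<^esub> w" using induce_adj x by blast
    then show "w \<in> {y. z \<rightarrow>\<^sup>*\<^bsub>?H\<^esub> y}" using x(1) H.reachable_adj_trans by blast
  qed
  then obtain q where q: "H.apath z q z'" unfolding mem_Collect_eq H.reachable_apath by blast
  have aveq: "H.awalk_verts = awalk_verts"
    by (rule compatible_awalk_verts) (rule compatible_induce_subgraph)
  have aq: "H.awalk z q z'" "distinct (awalk_verts z q)" using q unfolding H.apath_def aveq by auto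
  have sub: "subgraph ?H G" by (rule subgraph_induce_subgraphI) auto
  have wq: "awalk z q z'" using subgraph_awalk_imp_awalk[OF aq(1) sub] .
  have "set (H.awalk_verts z q) \<subseteq> verts ?H" using aq(1) H.awalkE by blast
  then have av: "v \<notin> set (awalk_verts z q)" unfolding aveq by auto
  have "q \<noteq> []" using wq z(1) by (auto simp: awalk_Nil_iff)
  obtain e1 where e1: "e1 \<in> arcs G" "tail G e1 = v" "head G e1 = z" using z(2) by auto
  have "z' \<rightarrow>\<^bsub>G\<^esub> v" using E_sym z(3) by blast
  then obtain e2 where e2: "e2 \<in> arcs G" "tail G e2 = z'" "head G e2 = v" by auto
  let ?p = "e1 # q @ [e2]"
  have w2: "awalk z (q @ [e2]) v"
    using wq e2 by (auto simp: awalk_append_iff awalk_Cons_iff awalk_Nil_iff)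
  have "awalk v ?p v" using w2 e1 by (auto simp: awalk_Cons_iff)
  moreover have "awalk_verts z (q @ [e2]) = awalk_verts z q @ [v]"
  proof -
    have "awalk_verts z q = map (tail G) q @ [z']"
      using wq \<open>q \<noteq> []\<close> cas_last[of z q z'] by (auto simp: awalk_verts_conv awalk_def last_conv_nth)
    then show ?thesis using e2 by (simp add: awalk_verts_conv)
  qed
  then have "distinct (tl (awalk_verts v ?p))" using aq(2) av e1 by simp
  ultimately have "cycle ?p" by (auto simp: cycle_def)
  moreover have "3 \<le> length ?p" using \<open>q \<noteq> []\<close> by (cases q) auto
  ultimately show "v \<in> cycle_verts G" using e1 by (force simp: cycle_verts_def)
qed

lemma cycle_verts_subset: "cycle_verts G \<subseteq> verts G"
  using cycle_verts_iff cyc_in_verts by blast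

section \<open>Strong components of induced subgraphs\<close>

lemma induced_adj:
  assumes "induced_subgraph H (G \<restriction> J)"
  shows "u \<rightarrow>\<^bsub>H\<^esub> v \<longleftrightarrow> u \<rightarrow>\<^bsub>G\<^esub> v \<and> u \<in> verts H \<and> v \<in> verts H" "verts H \<subseteq> J"
    "tail H = tail G" "head H = head G" "wf_digraph H"
    "arcs H = {e \<in> arcs G. tail G e \<in> verts H \<and> head G e \<in> verts H}"
proof -
  show sub: "verts H \<subseteq> J" using assms by (auto simp: induced_subgraph_def subgraph_def)
  show th: "tail H = tail G" "head H = head G"
    using assms by (auto simp: induced_subgraph_def subgraph_def compatible_def)
  show "wf_digraph H" using assms by (auto simp: induced_subgraph_def subgraph_def)
  show ar: "arcs H = {e \<in> arcs G. tail G e \<in> verts H \<and> head G e \<in> verts H}"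
    using assms sub by (auto simp: induced_subgraph_def)
  show "u \<rightarrow>\<^bsub>H\<^esub> v \<longleftrightarrow> u \<rightarrow>\<^bsub>G\<^esub> v \<and> u \<in> verts H \<and> v \<in> verts H"
    unfolding arcs_ends_conv ar th by auto
qed

text \<open>A vertex of \<open>J\<close> adjacent to a component could be added without losing
  connectedness, against maximality.\<close>

lemma sccsD:
  assumes J: "J \<subseteq> verts G" and H: "H \<in> pre_digraph.sccs (G \<restriction> J)"
  shows "induced_subgraph H (G \<restriction> J)" "verts H \<noteq> {}" "cset (verts H)"
    "\<And>u w. u \<in> verts H \<Longrightarrow> w \<in> J \<Longrightarrow> u \<rightarrow>\<^bsub>G\<^esub> w \<Longrightarrow> w \<in> verts H"
proof -
  have h: "induced_subgraph H (G \<restriction> J)" "strongly_connected H"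
    "\<And>H'. induced_subgraph H' (G \<restriction> J) \<Longrightarrow> strongly_connected H' \<Longrightarrow> \<not> verts H \<subset> verts H'"
    using H by (auto simp: pre_digraph.sccs_def)
  show "induced_subgraph H (G \<restriction> J)" by (rule h)
  have HV: "verts H \<subseteq> verts G" using induced_adj(2)[OF h(1)] J by blast
  have sc: "verts H \<noteq> {} \<and> cset (verts H)"
    using strongly_connected_iff_cset[OF induced_adj(5)[OF h(1)] HV induced_adj(1)[OF h(1)]] h(2) by simp
  then show "verts H \<noteq> {}" "cset (verts H)" by auto
  fix u w assume u: "u \<in> verts H" "w \<in> J" "u \<rightarrow>\<^bsub>G\<^esub> w"
  show "w \<in> verts H"
  proof (rule ccontr)
    assume w: "w \<notin> verts H"
    let ?C = "insert w (verts H)"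
    have CJ: "?C \<subseteq> J" using induced_adj(2)[OF h(1)] u by blast
    have wfJ: "wf_digraph (G \<restriction> J)" by (rule wellformed_induce_subgraph)
    have "induced_subgraph (G \<restriction> ?C) (G \<restriction> J)"
      unfolding induced_subgraph_def subgraph_def compatible_def
      using CJ wfJ wellformed_induce_subgraph[of ?C] by auto
    moreover have "strongly_connected (G \<restriction> ?C)"
    proof -
      have "cset ?C" using cset_insert[OF _ u(1,3)] sc by blast
      moreover have "verts (G \<restriction> ?C) \<subseteq> verts G" using CJ J by auto
      ultimately show ?thesis
        using strongly_connected_iff_cset[OF wellformed_induce_subgraph[of ?C]] induce_adj by auto
    qed
    ultimately show False using h(3)[of "G \<restriction> ?C"] w by auto
  qed
qed

lemma sccsI:
  assumes J: "J \<subseteq> verts G" and C: "C \<subseteq> J" "C \<noteq> {}" "cset C"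
    and closed: "\<And>u w. u \<in> C \<Longrightarrow> w \<in> J \<Longrightarrow> u \<rightarrow>\<^bsub>G\<^esub> w \<Longrightarrow> w \<in> C"
  shows "G \<restriction> C \<in> pre_digraph.sccs (G \<restriction> J)"
proof -
  have wfJ: "wf_digraph (G \<restriction> J)" by (rule wellformed_induce_subgraph)
  have "induced_subgraph (G \<restriction> C) (G \<restriction> J)"
    unfolding induced_subgraph_def subgraph_def compatible_def
    using C(1) wfJ wellformed_induce_subgraph[of C] by auto
  moreover have "strongly_connected (G \<restriction> C)"
  proof -
    have "verts (G \<restriction> C) \<subseteq> verts G" using C J by auto
    then show ?thesis
      using strongly_connected_iff_cset[OF wellformed_induce_subgraph[of C]] induce_adj C by auto
  qed
  moreover have "\<not> C \<subset> verts H" if h: "induced_subgraph H (G \<restriction> J)" "strongly_connected H" for H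
  proof
    assume CH: "C \<subset> verts H"
    have HV: "verts H \<subseteq> verts G" using induced_adj(2)[OF h(1)] J by blast
    have "cset (verts H)"
      using strongly_connected_iff_cset[OF induced_adj(5)[OF h(1)] HV induced_adj(1)[OF h(1)]] h(2) by simp
    moreover obtain u where "u \<in> C" using C by blast
    ultimately have "verts H \<subseteq> C"
      using cset_subset[of "verts H" u C] closed induced_adj(2)[OF h(1)] CH by blast
    then show False using CH by blast
  qed
  ultimately show ?thesis by (auto simp: pre_digraph.sccs_def)
qed

end

section \<open>Recognising complete graphs and odd cycles\<close>

lemma cycle_graph_nbrs:
  assumes "i < n" "3 \<le> n"
  shows "card {j. j < n \<and> (j = Suc i mod n \<or> i = Suc j mod n)} = 2"
proof -
  define s t where "s = (if Suc i < n then Suc i else 0)" and "t = (if i = 0 then n - 1 else i - 1)"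
  have "{j. j < n \<and> (j = Suc i mod n \<or> i = Suc j mod n)} = {s, t}"
    using assms by (auto simp: s_def t_def mod_Suc split: if_splits)
  moreover have "s \<noteq> t" using assms by (auto simp: s_def t_def)
  ultimately show ?thesis by simp
qed

context bounded_graph
begin

lemma complete_induced:
  assumes H: "induced_subgraph H (G \<restriction> J)" and J: "J \<subseteq> verts G"
  shows "complete_digraph n H \<longleftrightarrow> card (verts H) = n \<and> (\<forall>u\<in>verts H. N u \<inter> verts H = verts H - {u})"
proof
  assume "complete_digraph n H"
  then have c: "card (verts H) = n" "arcs_ends H = {(u, v). (u, v) \<in> verts H \<times> verts H \<and> u \<noteq> v}"
    by (auto simp: complete_digraph_def)
  have "N u \<inter> verts H = verts H - {u}" if u: "u \<in> verts H" for u
  proof -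
    have "v \<in> N u \<inter> verts H \<longleftrightarrow> v \<in> verts H - {u}" for v
      using induced_adj(1)[OF H, of u v] c(2) u by auto
    then show ?thesis by blast
  qed
  then show "card (verts H) = n \<and> (\<forall>u\<in>verts H. N u \<inter> verts H = verts H - {u})" using c by blast
next
  assume r: "card (verts H) = n \<and> (\<forall>u\<in>verts H. N u \<inter> verts H = verts H - {u})"
  have sub: "subgraph H G"
    using H J induced_adj[OF H] wf_digraph by (auto simp: subgraph_def compatible_def)
  have "induced_subgraph H G"
    using sub induced_adj(6)[OF H] by (simp add: induced_subgraph_def)
  then have "symmetric H" using induced_graph_imp_symmetric sym_arcs by blast
  then have gH: "Digraph.graph H" using digraph_subgraph[OF sub] digraph.graphI by blast
  have "u \<rightarrow>\<^bsub>H\<^esub> v \<longleftrightarrow> u \<in> verts H \<and> v \<in> verts H \<and> u \<noteq> v" for u v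
  proof (cases "u \<in> verts H")
    case True
    then have "v \<in> N u \<inter> verts H \<longleftrightarrow> v \<in> verts H - {u}" using r by blast
    then show ?thesis using induced_adj(1)[OF H, of u v] True by auto
  next
    case False
    then show ?thesis using induced_adj(1)[OF H, of u v] by blast
  qed
  then have "arcs_ends H = {(u, v). (u, v) \<in> verts H \<times> verts H \<and> u \<noteq> v}" by auto
  then show "complete_digraph n H" using gH r by (simp add: complete_digraph_def)
qed

text \<open>The isomorphism maps the neighbours of \<open>u\<close> in \<open>H\<close> bijectively
  to the cyclic successor and predecessor of the index of \<open>u\<close>.\<close>

lemma odd_cycle_induced:
  assumes H: "induced_subgraph H (G \<restriction> J)" and J: "J \<subseteq> verts G" and o: "odd_cycle_graph H"
  shows "odd (card (verts H))" "\<And>u. u \<in> verts H \<Longrightarrow> card (N u \<inter> verts H) = 2"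
proof -
  obtain n hom where n: "3 \<le> n" "odd n" and hom: "pre_digraph.digraph_isomorphism H hom"
    "with_proj (cycle_graph n) = app_iso hom H"
    using o by (auto simp: odd_cycle_graph_def digraph_iso_def)
  define f where "f = iso_verts hom"
  have inj: "inj_on f (verts H)" using hom(1) by (simp add: pre_digraph.digraph_isomorphism_def f_def)
  have "verts (with_proj (cycle_graph n)) = f ` verts H" unfolding hom(2) by (simp add: f_def)
  then have fV: "f ` verts H = {..<n}" by (simp add: cycle_graph_def)
  then show "odd (card (verts H))" using card_image[OF inj] n by simp
  have "arcs_ends (with_proj (cycle_graph n)) = (\<lambda>(u, v). (f u, f v)) ` arcs_ends H"
    unfolding hom(2) using hom(1)
    by (force simp: arcs_ends_conv pre_digraph.digraph_isomorphism_def f_def image_image)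
  then have ae: "(\<lambda>(u, v). (f u, f v)) ` arcs_ends H =
      {(i, j). i < n \<and> j < n \<and> (j = Suc i mod n \<or> i = Suc j mod n)}"
    by (simp add: cycle_graph_def)
  fix u assume u: "u \<in> verts H"
  have "f ` (N u \<inter> verts H) = {j. j < n \<and> (j = Suc (f u) mod n \<or> f u = Suc j mod n)}"
  proof (rule equalityI; rule subsetI)
    fix j assume "j \<in> f ` (N u \<inter> verts H)"
    then obtain v where v: "v \<in> N u" "v \<in> verts H" "j = f v" by blast
    then have "(u, v) \<in> arcs_ends H" using induced_adj(1)[OF H] u by simp
    then have "(f u, f v) \<in> (\<lambda>(u, v). (f u, f v)) ` arcs_ends H" by force
    then show "j \<in> {j. j < n \<and> (j = Suc (f u) mod n \<or> f u = Suc j mod n)}"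
      unfolding ae v(3) by simp
  next
    fix j assume j: "j \<in> {j. j < n \<and> (j = Suc (f u) mod n \<or> f u = Suc j mod n)}"
    have "f u < n" using fV u by blast
    then have "(f u, j) \<in> (\<lambda>(u, v). (f u, f v)) ` arcs_ends H" unfolding ae using j by simp
    then obtain x y where xy: "(x, y) \<in> arcs_ends H" "f x = f u" "j = f y" by force
    then have xyH: "x \<rightarrow>\<^bsub>G\<^esub> y" "x \<in> verts H" "y \<in> verts H" using induced_adj(1)[OF H] by blast+
    then have "x = u" using inj u xy(2) by (auto dest: inj_onD)
    then show "j \<in> f ` (N u \<inter> verts H)" using xyH xy(3) by auto
  qed
  then have "card (f ` (N u \<inter> verts H)) = 2"
    using cycle_graph_nbrs[of "f u" n] fV u n by auto
  moreover have "inj_on f (N u \<inter> verts H)" using inj by (rule inj_on_subset) simp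
  ultimately show "card (N u \<inter> verts H) = 2" by (simp add: card_image)
qed

lemma odd_cycle_graphI:
  assumes H: "induced_subgraph H (G \<restriction> J)" and J: "J \<subseteq> verts G"
    and C: "cset (verts H)" "verts H \<noteq> {}" "odd (card (verts H))"
    and reg: "\<And>u. u \<in> verts H \<Longrightarrow> card (N u \<inter> verts H) = 2"
  shows "odd_cycle_graph H"
proof -
  let ?C = "verts H"
  let ?n = "card ?C"
  have fC: "finite ?C" using induced_adj(2)[OF H] J finV by (meson finite_subset)
  obtain z where z: "z \<in> ?C" using C by blast
  obtain p :: "nat \<Rightarrow> 'a" where p: "bij_betw p {..<?n} ?C" "3 \<le> ?n"
    "\<And>i j. i < ?n \<Longrightarrow> j < ?n \<Longrightarrow> p i \<rightarrow>\<^bsub>G\<^esub> p j \<longleftrightarrow> j = Suc i mod ?n \<or> i = Suc j mod ?n"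
    using cycle_enumeration[OF fC C(1) reg z] by metis
  define f where "f = the_inv_into {..<?n} p"
  have bf: "bij_betw f ?C {..<?n}" unfolding f_def using p(1) by (rule bij_betw_the_inv_into)
  have pf: "p (f u) = u" if "u \<in> ?C" for u
    unfolding f_def using p(1) that by (simp add: f_the_inv_into_f_bij_betw)
  have fp: "f (p i) = i" if "i < ?n" for i
    unfolding f_def using p(1) that by (simp add: bij_betw_def the_inv_into_f_f)
  have pC: "p i \<in> ?C" if "i < ?n" for i using p(1) that by (auto simp: bij_betw_def)
  have fn: "f u < ?n" if "u \<in> ?C" for u using bf that by (auto simp: bij_betw_def)
  \<comment> \<open>Arcs go to pairs of indices, to match the arcs of \<open>cycle_graph\<close>;
    this is injective since there are no parallel arcs.\<close>
  define hom where "hom = \<lparr>iso_verts = f, iso_arcs = (\<lambda>a. (f (tail G a), f (head G a))),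
    iso_head = snd, iso_tail = fst\<rparr>"
  have inC: "tail G a \<in> ?C" "head G a \<in> ?C" "a \<in> arcs G" if "a \<in> arcs H" for a
    using that induced_adj(6)[OF H] by auto
  have "pre_digraph.digraph_isomorphism H hom"
    unfolding pre_digraph.digraph_isomorphism_def
  proof (intro conjI ballI)
    show "wf_digraph H" by (rule induced_adj(5)[OF H])
    show "inj_on (iso_verts hom) ?C" using bf by (simp add: hom_def bij_betw_def)
    show "inj_on (iso_arcs hom) (arcs H)"
    proof (rule inj_onI)
      fix a b assume ab: "a \<in> arcs H" "b \<in> arcs H" "iso_arcs hom a = iso_arcs hom b"
      then have "f (tail G a) = f (tail G b)" "f (head G a) = f (head G b)" by (auto simp: hom_def)
      then have "tail G a = tail G b" "head G a = head G b"
        using pf inC[OF ab(1)] inC[OF ab(2)] by metis+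
      then show "a = b" using no_multi_arcs[of a b] inC(3) ab by (simp add: arc_to_ends_def)
    qed
  qed (use induced_adj(3,4)[OF H] in \<open>simp_all add: hom_def\<close>)
  moreover have "with_proj (cycle_graph ?n) = app_iso hom H"
  proof -
    have "f ` ?C = {..<?n}" using bf by (simp add: bij_betw_def)
    moreover have "(\<lambda>a. (f (tail G a), f (head G a))) ` arcs H =
        {(i, j). i < ?n \<and> j < ?n \<and> (j = Suc i mod ?n \<or> i = Suc j mod ?n)}"
    proof (rule equalityI; rule subsetI)
      fix x assume "x \<in> (\<lambda>a. (f (tail G a), f (head G a))) ` arcs H"
      then obtain a where a: "a \<in> arcs H" "x = (f (tail G a), f (head G a))" by blast
      have "tail G a \<rightarrow>\<^bsub>G\<^esub> head G a" using inC(3)[OF a(1)] by (auto simp: arcs_ends_conv)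
      then have "p (f (tail G a)) \<rightarrow>\<^bsub>G\<^esub> p (f (head G a))" using pf inC[OF a(1)] by simp
      then show "x \<in> {(i, j). i < ?n \<and> j < ?n \<and> (j = Suc i mod ?n \<or> i = Suc j mod ?n)}"
        using p(3)[OF fn[OF inC(1)[OF a(1)]] fn[OF inC(2)[OF a(1)]]]
          fn[OF inC(1)[OF a(1)]] fn[OF inC(2)[OF a(1)]] a(2) by simp
    next
      fix x assume "x \<in> {(i, j). i < ?n \<and> j < ?n \<and> (j = Suc i mod ?n \<or> i = Suc j mod ?n)}"
      then obtain i j where ij: "x = (i, j)" "i < ?n" "j < ?n" "j = Suc i mod ?n \<or> i = Suc j mod ?n"
        by blast
      then have "p i \<rightarrow>\<^bsub>G\<^esub> p j" using p(3) by blast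
      then have "p i \<rightarrow>\<^bsub>H\<^esub> p j" using induced_adj(1)[OF H] pC ij by blast
      then obtain a where "a \<in> arcs H" "tail H a = p i" "head H a = p j" by (rule reachableE)
      then show "x \<in> (\<lambda>a. (f (tail G a), f (head G a))) ` arcs H"
        using induced_adj(3,4)[OF H] fp ij by (intro image_eqI[of _ _ a]) auto
    qed
    ultimately show ?thesis by (simp add: with_proj_def cycle_graph_def app_iso_def hom_def)
  qed
  ultimately have "digraph_iso H (with_proj (cycle_graph ?n))" by (auto simp: digraph_iso_def)
  then show ?thesis using p(2) C(3) by (auto simp: odd_cycle_graph_def)
qed

section \<open>Special graphs and trees of pieces\<close>

lemma half_sizes: "nat \<lceil>real \<Delta> / 2\<rceil> = (\<Delta> + 1) div 2" "nat \<lfloor>real \<Delta> / 2\<rfloor> = \<Delta> div 2"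
proof -
  show "nat \<lfloor>real \<Delta> / 2\<rfloor> = \<Delta> div 2"
    using floor_divide_of_nat_eq[of \<Delta> 2, where 'a=real] by simp
  have "\<lceil>real \<Delta> / 2\<rceil> = int ((\<Delta> + 1) div 2)"
  proof (rule ceiling_unique)
    show "of_int (int ((\<Delta> + 1) div 2)) - 1 < real \<Delta> / 2" by (cases "even \<Delta>") (auto elim!: evenE oddE)
    show "real \<Delta> / 2 \<le> of_int (int ((\<Delta> + 1) div 2))" by (cases "even \<Delta>") (auto elim!: evenE oddE)
  qed
  then show "nat \<lceil>real \<Delta> / 2\<rceil> = (\<Delta> + 1) div 2" by simp
qed

text \<open>Converse of \<open>balanced_product\<close>: halves up to rounding attain the rounded
  quarter of the square.\<close>

lemma half_product:
  assumes "a = (\<Delta> + 1) div 2 \<or> a = \<Delta> div 2"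
  shows "a * (\<Delta> - a) = \<Delta>\<^sup>2 div 4" "a \<le> \<Delta>"
proof -
  show "a \<le> \<Delta>" using assms \<Delta>4 by auto
  show "a * (\<Delta> - a) = \<Delta>\<^sup>2 div 4"
  proof (cases "even \<Delta>")
    case True
    then obtain k where k: "\<Delta> = 2 * k" by (rule evenE)
    then have "a = k" using assms by auto
    then show ?thesis using k by (simp add: power2_eq_square)
  next
    case False
    then obtain k where k: "\<Delta> = 2 * k + 1" by (rule oddE)
    have "\<Delta>\<^sup>2 = 4 * (k * (k + 1)) + 1" unfolding k by (simp add: power2_eq_square algebra_simps)
    then have "\<Delta>\<^sup>2 div 4 = k * (k + 1)" by simp
    moreover have "a = k \<or> a = k + 1" using assms k by auto
    ultimately show ?thesis using k by auto
  qed
qed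

lemma special_imp_tight:
  assumes sp: "special \<Delta> G"
  shows "tight_value (cycle_verts G) (verts G - cycle_verts G)" "indep (verts G - cycle_verts G)"
proof -
  let ?J = "cycle_verts G"
  have J: "?J \<subseteq> verts G" by (rule cycle_verts_subset)
  have s: "Digraph_Component.connected G" "\<And>v. v \<in> ?J \<Longrightarrow> out_degree G v = \<Delta>"
    "\<And>e. e \<in> arcs G \<Longrightarrow> tail G e \<in> ?J \<or> head G e \<in> ?J"
    "\<And>H. H \<in> pre_digraph.sccs (G \<restriction> ?J) \<Longrightarrow>
        complete_digraph (nat \<lceil>real \<Delta> / 2\<rceil> + 1) H \<or> complete_digraph (nat \<lfloor>real \<Delta> / 2\<rfloor> + 1) H \<or>
        \<Delta> = 4 \<and> odd_cycle_graph H"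
    using sp by (auto simp: special_def)
  have conn: "verts G \<noteq> {}" "cset (verts G)" using s(1) connected_iff_cset by auto
  \<comment> \<open>The components of the graph induced by the vertices on cycles are the
    pieces.\<close>
  define \<C> where "\<C> = comp ?J ` ?J"
  have UC: "\<Union>\<C> = ?J" using comp_subset by (auto simp: \<C>_def)
  have sub: "C \<subseteq> ?J" "C \<noteq> {}" "cset C" "\<And>u w. u \<in> C \<Longrightarrow> w \<in> ?J \<Longrightarrow> u \<rightarrow>\<^bsub>G\<^esub> w \<Longrightarrow> w \<in> C"
    if "C \<in> \<C>" for C
  proof -
    obtain v where v: "v \<in> ?J" "C = comp ?J v" using \<open>C \<in> \<C>\<close> by (auto simp: \<C>_def)
    show "C \<subseteq> ?J" "cset C" using v comp_subset cset_comp by auto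
    show "C \<noteq> {}" using v comp_self by blast
    show "w \<in> C" if "u \<in> C" "w \<in> ?J" "u \<rightarrow>\<^bsub>G\<^esub> w" for u w using comp_closed that v(2) by blast
  qed
  show ind: "indep (verts G - ?J)"
    unfolding indep_def using s(3) by (force simp: arcs_ends_conv)
  have pieces: "\<exists>a b. piece a b C" if C: "C \<in> \<C>" for C
  proof -
    let ?H = "G \<restriction> C"
    have scc: "?H \<in> pre_digraph.sccs (G \<restriction> ?J)" by (rule sccsI[OF J sub[OF C]])
    have H: "induced_subgraph ?H (G \<restriction> ?J)" by (rule sccsD(1)[OF J scc])
    have CV: "C \<subseteq> verts G" using sub(1)[OF C] J by blast
    have fC: "finite C" using CV finV finite_subset by blast
    have complete: "piece a (\<Delta> - a) C"
      if a: "a = (\<Delta> + 1) div 2 \<or> a = \<Delta> div 2" and c: "complete_digraph (a + 1) ?H" for a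
    proof -
      have cc: "card C = a + 1" "\<forall>u\<in>C. N u \<inter> C = C - {u}"
        using c complete_induced[OF H J, of "a + 1"] by auto
      have "card (N u \<inter> C) = a" if "u \<in> C" for u using cc that fC by simp
      then show ?thesis
        using half_product[OF a] cc sub(2,3)[OF C] CV by (simp add: piece_def)
    qed
    have "piece 2 2 C" if o: "\<Delta> = 4" "odd_cycle_graph ?H"
    proof -
      have "odd (card C)" "\<And>u. u \<in> C \<Longrightarrow> card (N u \<inter> C) = 2"
        using odd_cycle_induced[OF H J o(2)] by auto
      then show ?thesis unfolding piece_def using o(1) sub(2,3)[OF C] CV by auto
    qed
    then show ?thesis using s(4)[OF scc] complete unfolding half_sizes by blast
  qed
  show "tight_value ?J (verts G - ?J)"
  proof (rule special_value[of \<C>, unfolded UC])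
    show "card (N u) = \<Delta>" if "C \<in> \<C>" "u \<in> C" for C u
      using s(2) sub(1)[OF that(1)] that(2) by (auto simp: out_degree_eq)
    show "N u \<inter> ?J \<subseteq> C" if "C \<in> \<C>" "u \<in> C" for C u
      using sub(4)[OF that(1,2)] by auto
    show "\<not> cyc w" if "w \<in> verts G - ?J" for w using that cycle_verts_iff by blast
  qed (use conn pieces ind in auto)
qed

text \<open>The main point is that the vertices on cycles are exactly those in pieces. In a piece
  each vertex has two neighbours linked without it; an outer vertex lies on no cycle because
  \<open>cut\<close> separates each of its neighbours from the others.\<close>

lemma tree_imp_special:
  assumes conn: "Digraph_Component.connected G"
    and pieces: "\<And>C. C \<in> \<C> \<Longrightarrow> \<exists>a b. piece a b C"
    and deg: "\<And>C u. C \<in> \<C> \<Longrightarrow> u \<in> C \<Longrightarrow> card (N u) = \<Delta>"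
    and closed: "\<And>C u. C \<in> \<C> \<Longrightarrow> u \<in> C \<Longrightarrow> N u \<inter> \<Union>\<C> \<subseteq> C"
    and ind: "indep (verts G - \<Union>\<C>)"
    and cut: "\<And>w z. w \<in> verts G - \<Union>\<C> \<Longrightarrow> z \<in> N w \<Longrightarrow>
      \<exists>A\<subseteq>verts G - {w}. N w \<inter> A = {z} \<and> (\<forall>x\<in>A. N x \<subseteq> insert w A)"
  shows "special \<Delta> G"
proof -
  let ?W = "\<Union>\<C>"
  have CV: "C \<subseteq> verts G" "C \<noteq> {}" "cset C" if "C \<in> \<C>" for C
    using pieces[OF that] by (auto simp: piece_def)
  have fC: "finite C" if "C \<in> \<C>" for C using CV(1)[OF that] finV finite_subset by blast
  have clique: "N u \<inter> C = C - {u}" if "C \<in> \<C>" "piece a b C" "card C = Suc a" "u \<in> C" for C a b u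
  proof (rule card_subset_eq)
    show "N u \<inter> C \<subseteq> C - {u}" using E_irrefl by auto
    show "card (N u \<inter> C) = card (C - {u})" using that fC[OF that(1)] by (simp add: piece_def)
  qed (use fC that in simp)
  have two: "a = 2" "b = 2" if "piece a b C" "\<Delta> = 4" for a b C
  proof -
    have "a + b = \<Delta>" using that(1) unfolding piece_def by blast
    then have "a + b = 4" using that(2) by simp
    then show "a = 2" "b = 2" using piece_params[OF that(1)] by linarith+
  qed
  have on: "cyc v" if v: "v \<in> ?W" for v
  proof -
    obtain C where C: "C \<in> \<C>" "v \<in> C" using v by blast
    obtain a b where p: "piece a b C" using pieces[OF C(1)] by blast
    show ?thesis
    proof (cases "card C = Suc a")
      case True
      have a2: "2 \<le> a" using piece_params[OF p] by simp
      have Nv: "N v \<inter> C = C - {v}" by (rule clique[OF C(1) p True C(2)])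
      have "card (C - {v}) = a" using True C(2) fC[OF C(1)] by simp
      then obtain x where x: "x \<in> C - {v}" using a2 by (metis all_not_in_conv card.empty not_numeral_le_zero)
      have "card (C - {v} - {x}) \<noteq> 0" using \<open>card (C - {v}) = a\<close> x a2 fC[OF C(1)] by simp
      then obtain y where y: "y \<in> C - {v} - {x}" by (metis all_not_in_conv card.empty)
      have "y \<in> N x \<inter> C" using clique[OF C(1) p True, of x] x y by blast
      moreover have "y \<in> verts G - {v}" using y CV(1)[OF C(1)] by blast
      ultimately have "lnk (verts G - {v}) x y" using lnk_edge by simp
      moreover have "x \<in> N v \<inter> C" "y \<in> N v \<inter> C" using Nv x y by blast+
      ultimately show ?thesis unfolding cyc_def using y by (intro exI[of _ x] exI[of _ y]) auto
    next
      case False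
      then have "\<Delta> = 4" using p unfolding piece_def by blast
      then have "a = 2" using two[OF p] by simp
      moreover have "\<forall>u\<in>C. card (N u \<inter> C) = a" using p unfolding piece_def by blast
      ultimately have reg: "\<And>u. u \<in> C \<Longrightarrow> card (N u \<inter> C) = 2" by simp
      obtain p :: "nat \<Rightarrow> 'a" where p: "p 0 = v" "bij_betw p {..<card C} C" "3 \<le> card C"
        "\<And>i j. i < card C \<Longrightarrow> j < card C \<Longrightarrow>
          p i \<rightarrow>\<^bsub>G\<^esub> p j \<longleftrightarrow> j = Suc i mod card C \<or> i = Suc j mod card C"
        using cycle_enumeration[OF fC[OF C(1)] CV(3)[OF C(1)] reg C(2)] by metis
      let ?n = "card C"
      have inj: "p i = p j \<longleftrightarrow> i = j" if "i < ?n" "j < ?n" for i j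
        using p(2) that by (auto simp: bij_betw_def inj_on_def)
      have pV: "p i \<in> verts G" if "i < ?n" for i
        using p(2) that CV(1)[OF C(1)] by (auto simp: bij_betw_def)
      have walk: "lnk (verts G - {v}) (p 1) (p (Suc j))" if "Suc j < ?n" for j
        using that
      proof (induction j)
        case (Suc j)
        have "p (Suc j) \<rightarrow>\<^bsub>G\<^esub> p (Suc (Suc j))" using p(4)[of "Suc j" "Suc (Suc j)"] Suc.prems by simp
        moreover have "p (Suc (Suc j)) \<noteq> v" using inj[of "Suc (Suc j)" 0] p(1,3) Suc.prems by simp
        ultimately show ?case using Suc lnk_step pV by simp
      qed simp
      have "Suc (?n - 2) = ?n - 1" "?n - 1 < ?n" using p(3) by auto
      then have "lnk (verts G - {v}) (p 1) (p (?n - 1))" using walk[of "?n - 2"] by metis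
      moreover have "v \<rightarrow>\<^bsub>G\<^esub> p 1" using p(4)[of 0 1] p(1,3) by simp
      moreover have "v \<rightarrow>\<^bsub>G\<^esub> p (?n - 1)" using p(4)[of 0 "?n - 1"] p(1,3) by simp
      moreover have "p 1 \<noteq> p (?n - 1)" using inj[of 1 "?n - 1"] p(3) by simp
      ultimately show ?thesis unfolding cyc_def by blast
    qed
  qed
  have off: "\<not> cyc w" if w: "w \<in> verts G - ?W" for w
  proof
    assume "cyc w"
    then obtain z z' where z: "z \<noteq> z'" "w \<rightarrow>\<^bsub>G\<^esub> z" "w \<rightarrow>\<^bsub>G\<^esub> z'" "lnk (verts G - {w}) z z'"
      by (auto simp: cyc_def)
    then obtain A where A: "N w \<inter> A = {z}" "\<forall>x\<in>A. N x \<subseteq> insert w A" using cut[OF w, of z] by auto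
    have "z' \<in> A"
    proof (rule lnk_induct[OF z(4)])
      show "z \<in> A" using A(1) by blast
      fix x y assume xy: "x \<in> A" "y \<in> verts G - {w}" "x \<rightarrow>\<^bsub>G\<^esub> y"
      then have "y \<in> N x" by simp
      then show "y \<in> A" using A(2) xy(1,2) by blast
    qed
    then have "z' \<in> N w \<inter> A" using z(3) by simp
    then have "z' \<in> {z}" by (simp only: A(1))
    then show False using z(1) by simp
  qed
  have WV: "?W \<subseteq> verts G" using CV(1) by blast
  have J: "cycle_verts G = ?W"
  proof (rule equalityI; rule subsetI)
    fix v assume v: "v \<in> cycle_verts G"
    then have "cyc v" "v \<in> verts G" using cycle_verts_iff cycle_verts_subset by blast+
    then show "v \<in> ?W" using off by blast
  qed (use on cycle_verts_iff in blast)
  have "complete_digraph (nat \<lceil>real \<Delta> / 2\<rceil> + 1) H \<or> complete_digraph (nat \<lfloor>real \<Delta> / 2\<rfloor> + 1) H \<or>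
      \<Delta> = 4 \<and> odd_cycle_graph H" if H: "H \<in> pre_digraph.sccs (G \<restriction> ?W)" for H
  proof -
    note scc = sccsD[OF WV H]
    obtain v where v: "v \<in> verts H" using scc(2) by blast
    then obtain C where C: "C \<in> \<C>" "v \<in> C" using induced_adj(2)[OF scc(1)] by blast
    have eq: "verts H = C"
    proof
      show "verts H \<subseteq> C"
      proof (rule cset_subset[OF scc(3) v C(2)])
        fix s t assume st: "s \<in> C" "t \<in> verts H" "s \<rightarrow>\<^bsub>G\<^esub> t"
        then have "t \<in> N s \<inter> ?W" using induced_adj(2)[OF scc(1)] by auto
        then show "t \<in> C" using closed[OF C(1) st(1)] by blast
      qed
      show "C \<subseteq> verts H"
      proof (rule cset_subset[OF CV(3)[OF C(1)] C(2) v])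
        fix s t assume st: "s \<in> verts H" "t \<in> C" "s \<rightarrow>\<^bsub>G\<^esub> t"
        then have "t \<in> ?W" using C(1) by blast
        then show "t \<in> verts H" using scc(4)[OF st(1) _ st(3)] by blast
      qed
    qed
    obtain a b where p: "piece a b C" using pieces[OF C(1)] by blast
    show ?thesis
    proof (cases "card C = Suc a")
      case True
      have "complete_digraph (a + 1) H"
        using complete_induced[OF scc(1) WV, of "a + 1"] clique[OF C(1) p True] True unfolding eq by simp
      moreover have "a = (\<Delta> + 1) div 2 \<or> a = \<Delta> div 2"
      proof -
        have ab: "a + b = \<Delta>" "a * b = \<Delta>\<^sup>2 div 4" using p by (auto simp: piece_def)
        then have "a = b \<or> a = Suc b \<or> b = Suc a" using balanced_product[of a b] by simp
        then show ?thesis unfolding ab(1)[symmetric] by (elim disjE) auto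
      qed
      ultimately show ?thesis unfolding half_sizes by blast
    next
      case False
      then have o: "\<Delta> = 4" "odd (card C)" using p unfolding piece_def by blast+
      then have "a = 2" using two[OF p] by simp
      moreover have "\<forall>u\<in>C. card (N u \<inter> C) = a" using p unfolding piece_def by blast
      ultimately have "\<And>u. u \<in> C \<Longrightarrow> card (N u \<inter> C) = 2" by simp
      then have "odd_cycle_graph H" using odd_cycle_graphI[OF scc(1) WV] scc(2,3) o(2) unfolding eq by blast
      then show ?thesis using o(1) by blast
    qed
  qed
  moreover have "out_degree G v = \<Delta>" if "v \<in> ?W" for v using deg that by (auto simp: out_degree_eq)
  moreover have "tail G e \<in> ?W \<or> head G e \<in> ?W" if e: "e \<in> arcs G" for e
  proof (rule ccontr)
    assume "\<not> ?thesis"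
    then have "tail G e \<in> verts G - ?W" "head G e \<in> verts G - ?W" using e by auto
    moreover have "tail G e \<rightarrow>\<^bsub>G\<^esub> head G e" using e by (auto simp: arcs_ends_conv)
    ultimately show False using ind unfolding indep_def by blast
  qed
  ultimately show ?thesis unfolding special_def J using conn by blast
qed

lemma special_or_bound:
  assumes conn: "Digraph_Component.connected G"
  shows "special \<Delta> G \<or> (\<exists>S. ids S \<and> (if \<Delta> = 5 then 9 * card S \<le> 5 * card (verts G)
    else (\<Delta>\<^sup>2 div 4 + \<Delta>) * card S \<le> \<Delta>\<^sup>2 div 4 * card (verts G)))"
proof -
  have c: "verts G \<noteq> {}" "cset (verts G)" using conn connected_iff_cset by auto
  show ?thesis
  proof (cases "2 \<le> card (verts G)")
    case False
    moreover have "card (verts G) \<noteq> 0" using c(1) by simp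
    ultimately have "card (verts G) = 1" by linarith
    then obtain x where x: "verts G = {x}" by (rule card_1_singletonE)
    have none: "\<not> u \<rightarrow>\<^bsub>G\<^esub> w" for u w
    proof
      assume "u \<rightarrow>\<^bsub>G\<^esub> w"
      then have "u = x" "w = x" using E_dom E_dom2 x by blast+
      then show False using \<open>u \<rightarrow>\<^bsub>G\<^esub> w\<close> E_irrefl by blast
    qed
    \<comment> \<open>A single vertex has no star partition, as stars need a leaf; it is special
      with the empty family of pieces.\<close>
    have "special \<Delta> G"
    proof (rule tree_imp_special[OF conn, of "{}"])
      show "indep (verts G - \<Union>{})" unfolding indep_def using none by blast
      show "\<exists>A\<subseteq>verts G - {w}. N w \<inter> A = {z} \<and> (\<forall>x\<in>A. N x \<subseteq> insert w A)"
        if "z \<in> N w" for w z using none that unfolding in_N by blast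
    qed simp_all
    then show ?thesis by blast
  next
    case True
    consider f where "star_on (verts G) f" "\<forall>C. \<not> bad f C"
      | \<C> where "\<forall>C\<in>\<C>. (\<exists>a b. piece a b C) \<and> (\<forall>u\<in>C. card (N u) = \<Delta> \<and> N u \<inter> \<Union>\<C> \<subseteq> C)"
        "indep (verts G - \<Union>\<C>)"
        "\<forall>w\<in>verts G - \<Union>\<C>. \<forall>z\<in>N w. \<exists>A\<subseteq>verts G - {w}. N w \<inter> A = {z} \<and> (\<forall>x\<in>A. N x \<subseteq> insert w A)"
      using star_or_tree[OF c(2) True] by blast
    then show ?thesis
    proof cases
      case 1
      show ?thesis by (rule disjI2, rule no_bad_bound[OF 1(1)]) (use 1(2) in simp)
    next
      case 2
      have "special \<Delta> G"
      proof (rule tree_imp_special[OF conn _ _ _ 2(2)])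
        show "\<exists>a b. piece a b C" if "C \<in> \<C>" for C using 2(1) that by simp
        show "card (N u) = \<Delta>" "N u \<inter> \<Union>\<C> \<subseteq> C" if "C \<in> \<C>" "u \<in> C" for C u
          using bspec[OF 2(1) that(1)] that(2) by simp_all
        show "\<exists>A\<subseteq>verts G - {w}. N w \<inter> A = {z} \<and> (\<forall>x\<in>A. N x \<subseteq> insert w A)"
          if "w \<in> verts G - \<Union>\<C>" "z \<in> N w" for w z
          by (rule bspec[OF bspec[OF 2(3) that(1)] that(2)])
      qed
      then show ?thesis by (rule disjI1)
    qed
  qed
qed

section \<open>The independent domination number and the final bounds\<close>

lemma ids_iff: "independent_dominating_set G S \<longleftrightarrow> ids S"
  by (simp add: independent_dominating_set_def ids_def indep_def)

lemma domination_number: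
  shows "\<And>S. ids S \<Longrightarrow> independent_domination_number G \<le> card S"
    "\<exists>S. ids S \<and> independent_domination_number G = card S"
proof -
  let ?A = "card ` {S. ids S}"
  have eq: "independent_domination_number G = Min ?A"
    by (simp add: independent_domination_number_def ids_iff)
  have "{S. ids S} \<subseteq> Pow (verts G)" by (auto simp: ids_def)
  then have "finite {S. ids S}" by (rule finite_subset) (simp add: finV)
  then have fin: "finite ?A" by (rule finite_imageI)
  show "independent_domination_number G \<le> card S" if "ids S" for S
    unfolding eq by (rule Min_le[OF fin]) (use that in simp)
  \<comment> \<open>Extending the empty set shows that the minimum is taken over a non-empty
    set.\<close>
  have "indep {}" by (simp add: indep_def)
  then obtain S where "ids S" by (rule ids_extend) simp_all
  then have "?A \<noteq> {}" by blast
  then have "Min ?A \<in> ?A" by (rule Min_in[OF fin])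
  then show "\<exists>S. ids S \<and> independent_domination_number G = card S" unfolding eq by blast
qed

end

theorem theorem1p2:
  fixes G :: "('a, 'b) pre_digraph" and \<Delta> :: nat
  assumes "\<Delta> \<ge> 4"
    and "Digraph.graph G"
    and "Digraph_Component.connected G"
    and "\<And>v. v \<in> verts G \<Longrightarrow> out_degree G v \<le> \<Delta>"
  shows "(special \<Delta> G \<longrightarrow>
            real (independent_domination_number G) =
              (1 - real \<Delta> / (real_of_int \<lfloor>(real \<Delta>)\<^sup>2 / 4\<rfloor> + real \<Delta>)) * real (card (verts G))
              + real \<Delta> / (real_of_int \<lfloor>(real \<Delta>)\<^sup>2 / 4\<rfloor> + real \<Delta>))
       \<and> (\<not> special \<Delta> G \<and> \<Delta> \<noteq> 5 \<longrightarrow>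
            real (independent_domination_number G) \<le>
              (1 - real \<Delta> / (real_of_int \<lfloor>(real \<Delta>)\<^sup>2 / 4\<rfloor> + real \<Delta>)) * real (card (verts G)))
       \<and> (\<not> special \<Delta> G \<and> \<Delta> = 5 \<longrightarrow>
            real (independent_domination_number G) \<le> 5 / 9 * real (card (verts G)))"
proof -
  interpret Digraph.graph G by (rule assms(2))
  interpret bounded_graph G \<Delta> by unfold_locales (use assms in auto)
  define c where "c = \<Delta>\<^sup>2 div 4"
  define i n where "i = independent_domination_number G" and "n = card (verts G)"
  have fl: "real_of_int \<lfloor>(real \<Delta>)\<^sup>2 / 4\<rfloor> = real c"
    using floor_divide_of_nat_eq[of "\<Delta>\<^sup>2" 4, where 'a=real] by (simp add: c_def)
  have pos: "0 < real c + real \<Delta>" using assms(1) by simp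
  have coeff: "1 - real \<Delta> / (real c + real \<Delta>) = real c / (real c + real \<Delta>)"
    using pos by (simp add: field_simps)
  have "real i = real c / (real c + real \<Delta>) * real n + real \<Delta> / (real c + real \<Delta>)" if sp: "special \<Delta> G"
  proof -
    note tv = special_imp_tight[OF sp]
    note val = ids_value[OF tv(1) cycle_verts_subset tv(2)]
    obtain S where S: "ids S" "i = card S" using domination_number(2) by (auto simp: i_def)
    obtain S' where S': "ids S'" "(int c + int \<Delta>) * int (card S') \<le> int c * (int n - 1) + (int c + int \<Delta>)"
      using val(2) by (auto simp: c_def n_def)
    have "i \<le> card S'" using domination_number(1)[OF S'(1)] by (simp add: i_def)
    then have "(int c + int \<Delta>) * int i \<le> (int c + int \<Delta>) * int (card S')" by (intro mult_left_mono) auto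
    moreover have "int c * (int n - 1) + (int c + int \<Delta>) \<le> (int c + int \<Delta>) * int i"
      using val(1)[OF S(1)] by (simp add: c_def n_def S(2))
    ultimately have "(int c + int \<Delta>) * int i = int c * int n + int \<Delta>"
      using S'(2) by (simp add: algebra_simps)
    then have "real_of_int ((int c + int \<Delta>) * int i) = real_of_int (int c * int n + int \<Delta>)" by simp
    then have "(real c + real \<Delta>) * real i = real c * real n + real \<Delta>" by simp
    then have "real i = (real c * real n + real \<Delta>) / (real c + real \<Delta>)"
      using pos by (simp add: eq_divide_eq mult.commute)
    then show ?thesis by (simp add: add_divide_distrib)
  qed
  moreover have "real i \<le> real c / (real c + real \<Delta>) * real n" if h: "\<not> special \<Delta> G" "\<Delta> \<noteq> 5"
  proof -
    obtain S where S: "ids S" "(c + \<Delta>) * card S \<le> c * n"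
      using special_or_bound[OF assms(3)] h by (auto simp: c_def n_def)
    have "(c + \<Delta>) * i \<le> (c + \<Delta>) * card S"
      using domination_number(1)[OF S(1)] by (simp add: i_def)
    then have "real ((c + \<Delta>) * i) \<le> real (c * n)" using S(2) by (simp only: of_nat_le_iff)
    then have "(real c + real \<Delta>) * real i \<le> real c * real n" by simp
    then show ?thesis using pos by (simp add: field_simps)
  qed
  moreover have "real i \<le> 5 / 9 * real n" if h: "\<not> special \<Delta> G" "\<Delta> = 5"
  proof -
    obtain S where S: "ids S" "9 * card S \<le> 5 * n"
      using special_or_bound[OF assms(3)] h by (auto simp: n_def)
    have "i \<le> card S" using domination_number(1)[OF S(1)] by (simp add: i_def)
    then show ?thesis using S(2) by linarith
  qed
  ultimately show ?thesis unfolding fl coeff i_def n_def by blast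
qed

end
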